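(* Let $P\subset\mathbb{R}^d$ be a full-dimensional convex polytope with $0\in\operatorname{int}(P)$, let $\mathfrak{I}$ be the Izmestiev coloring and $\mathfrak{m}$ the metric coloring of the edge-graph $G_P$. Then the product coloring $\mathfrak{I}\times\mathfrak{m}$ captures the orthogonal symmetries of $P$; that is, the natural homomorphism $\phi^{\mathfrak{I}\times\mathfrak{m}}\colon \operatorname{Aut}_{\mathrm{O}}(P)\to\operatorname{Aut}(G_P^{\mathfrak{I}\times\mathfrak{m}})$, $T\mapsto\sigma_T$, is well-defined and is a group isomorphism.
   Context: A polytope is the convex hull of finitely many points; $P\subset\mathbb{R}^d$ is full-dimensional (not contained in a proper affine subspace) with $0\in\operatorname{int}(P)$. Its vertices are enumerated $v_1,\dots,v_n$. The edge-graph $G_P=(V,E)$ is the simple graph with $V=\{1,\dots,n\}$ and $ij\in E$ iff $\operatorname{conv}\{v_i,v_j\}$ is an edge (1-dimensional face) of $P$. $\operatorname{Aut}_{\mathrm{O}}(P):=\{T\in\mathrm{O}(\mathbb{R}^d)\mid TP=P\}$. $\operatorname{Aut}(G_P)$ is the group of permutations $\sigma$ of $V$ with $ij\in E\Leftrightarrow\sigma(i)\sigma(j)\in E$. Each $T\in\operatorname{Aut}_{\mathrm{O}}(P)$ induces $\sigma_T\in\operatorname{Aut}(G_P)$ by $Tv_i=v_{\sigma_T(i)}$ for all $i\in V$. A coloring of $G_P$ is a map $\mathfrak{c}\colon V\,\dot\cup\,E\to\mathfrak{C}$ to a set $\mathfrak{C}$; $G_P^{\mathfrak{c}}$ denotes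 the colored graph, and $\operatorname{Aut}(G_P^{\mathfrak{c}})$ is the group of all $\sigma\in\operatorname{Aut}(G_P)$ with $\mathfrak{c}(i)=\mathfrak{c}(\sigma(i))$ for all $i\in V$ and $\mathfrak{c}(ij)=\mathfrak{c}(\sigma(i)\sigma(j))$ for all $ij\in E$. The natural homomorphism is $\phi^{\mathfrak{c}}\colon\operatorname{Aut}_{\mathrm{O}}(P)\to\operatorname{Aut}(G_P^{\mathfrak{c}})$, $T\mapsto\sigma_T$; it is well-defined iff $\sigma_T\in\operatorname{Aut}(G_P^{\mathfrak{c}})$ for every $T\in\operatorname{Aut}_{\mathrm{O}}(P)$. The coloring $\mathfrak{c}$ captures the orthogonal symmetries of $P$ if $\phi^{\mathfrak{c}}$ is well-defined and an isomorphism. For $c=(c_1,\dots,c_n)\in\mathbb{R}^n$ let $P^\circ(c):=\{x\in\mathbb{R}^d\mid\langle x,v_i\rangle\le c_i\text{ for all }i\in V\}$. The Izmestiev matrix $M\in\mathbb{R}^{n\times n}$ of $P$ has entries $$M_{ij}:=\frac{\partial^2\operatorname{vol}(P^\circ(c))}{\partial c_i\,\partial c_j}\Big|_{c=(1,\dots,1)},$$ where $\operatorname{vol}$ is the volume (the function $c\mapsto\operatorname{vol}(P^\circ(c))$ is known to be twice continuously differentiable near $c=(1,\dots,1)$). The Izmestiev coloring $\mathfrak{I}\colon V\,\dot\cup\,E\to\mathbb{R}$ is $\mathfrak{I}(i):=M_{ii}$ for $i\in V$ and $\mathfrak{I}(ij):=M_{ij}$ for $ij\in E$. The metric coloring $\mathfrak{m}\colon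 V\,\dot\cup\,E\to\mathbb{R}$ is $\mathfrak{m}(i):=\|v_i\|^2$ for $i\in V$ and $\mathfrak{m}(ij):=\langle v_i,v_j\rangle$ for $ij\in E$. The product of colorings $\mathfrak{c}\colon V\,\dot\cup\,E\to\mathfrak{C}$ and $\bar{\mathfrak{c}}\colon V\,\dot\cup\,E\to\bar{\mathfrak{C}}$ is $\mathfrak{c}\times\bar{\mathfrak{c}}\colon V\,\dot\cup\,E\to\mathfrak{C}\times\bar{\mathfrak{C}}$, with $(\mathfrak{c}\times\bar{\mathfrak{c}})(i):=(\mathfrak{c}(i),\bar{\mathfrak{c}}(i))$ for $i\in V$ and $(\mathfrak{c}\times\bar{\mathfrak{c}})(ij):=(\mathfrak{c}(ij),\bar{\mathfrak{c}}(ij))$ for $ij\in E$. *)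

theory Defs
  imports "HOL-Analysis.Analysis" "HOL-Algebra.Group"
begin

section \<open>Edge-graphs and colorings\<close>

definition vertex_enumeration :: "(real^'d) set \<Rightarrow> nat \<Rightarrow> (nat \<Rightarrow> real^'d) \<Rightarrow> bool" where
  "vertex_enumeration P n v \<longleftrightarrow> bij_betw v {1..n} {x. x extreme_point_of P}"

definition edge_graph :: "(real^'d) set \<Rightarrow> nat \<Rightarrow> (nat \<Rightarrow> real^'d) \<Rightarrow> nat set set" where
  "edge_graph P n v =
     {{i, j} | i j. i \<in> {1..n} \<and> j \<in> {1..n} \<and> (convex hull {v i, v j}) edge_of P}"

text \<open>A coloring is a function on the disjoint union of vertices (\<open>Inl i\<close>) and edges
  (\<open>Inr {i, j}\<close>); only its values on \<open>{1..n}\<close> and on the edge set \<open>E\<close> matter.\<close>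

type_synonym 'c coloring = "nat + nat set \<Rightarrow> 'c"

definition graph_automorphisms :: "nat \<Rightarrow> nat set set \<Rightarrow> (nat \<Rightarrow> nat) set" where
  "graph_automorphisms n E =
     {\<sigma>. \<sigma> permutes {1..n} \<and>
         (\<forall>i\<in>{1..n}. \<forall>j\<in>{1..n}. {i, j} \<in> E \<longleftrightarrow> {\<sigma> i, \<sigma> j} \<in> E)}"

definition colored_graph_automorphisms ::
    "nat \<Rightarrow> nat set set \<Rightarrow> 'c coloring \<Rightarrow> (nat \<Rightarrow> nat) set" where
  "colored_graph_automorphisms n E c =
     {\<sigma> \<in> graph_automorphisms n E.
         (\<forall>i\<in>{1..n}. c (Inl i) = c (Inl (\<sigma> i))) \<and>
         (\<forall>i\<in>{1..n}. \<forall>j\<in>{1..n}. {i, j} \<in> E \<longrightarrow> c (Inr {i, j}) = c (Inr {\<sigma> i, \<sigma> j}))}"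

definition colored_aut_group ::
    "nat \<Rightarrow> nat set set \<Rightarrow> 'c coloring \<Rightarrow> (nat \<Rightarrow> nat) monoid" where
  "colored_aut_group n E c =
     \<lparr>carrier = colored_graph_automorphisms n E c, mult = (\<circ>), one = id\<rparr>"

definition product_coloring :: "'c coloring \<Rightarrow> 'b coloring \<Rightarrow> ('c \<times> 'b) coloring"
    (infixr \<open>\<times>\<^sub>c\<close> 80) where
  "(c \<times>\<^sub>c c') x = (c x, c' x)"

text \<open>The value \<open>F i j\<close> assigned to the unordered pair \<open>{i, j}\<close>, for symmetric \<open>F\<close>.\<close>

definition edge_value :: "(nat \<Rightarrow> nat \<Rightarrow> real) \<Rightarrow> nat set \<Rightarrow> real" where
  "edge_value F e = (THE x. \<forall>i j. e = {i, j} \<longrightarrow> x = F i j)"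

lemma edge_value_eq:
  assumes "F i j = F j i"
  shows "edge_value F {i, j} = F i j"
  unfolding edge_value_def using assms
  by (intro the_equality) (auto simp: doubleton_eq_iff)

definition matrix_coloring :: "(nat \<Rightarrow> nat \<Rightarrow> real) \<Rightarrow> real coloring" where
  "matrix_coloring F = case_sum (\<lambda>i. F i i) (edge_value F)"


section \<open>Orthogonal symmetries\<close>

definition orthogonal_symmetries :: "(real^'d) set \<Rightarrow> (real^'d \<Rightarrow> real^'d) set" where
  "orthogonal_symmetries P = {T. orthogonal_transformation T \<and> T ` P = P}"

definition orthogonal_aut_group :: "(real^'d) set \<Rightarrow> (real^'d \<Rightarrow> real^'d) monoid" where
  "orthogonal_aut_group P =
     \<lparr>carrier = orthogonal_symmetries P, mult = (\<circ>), one = id\<rparr>"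

definition induced_permutation ::
    "nat \<Rightarrow> (nat \<Rightarrow> real^'d) \<Rightarrow> (real^'d \<Rightarrow> real^'d) \<Rightarrow> (nat \<Rightarrow> nat)" where
  "induced_permutation n v T =
     (THE \<sigma>. \<sigma> permutes {1..n} \<and> (\<forall>i\<in>{1..n}. T (v i) = v (\<sigma> i)))"

definition captures_orthogonal_symmetries ::
    "(real^'d) set \<Rightarrow> nat \<Rightarrow> (nat \<Rightarrow> real^'d) \<Rightarrow> 'c coloring \<Rightarrow> bool" where
  "captures_orthogonal_symmetries P n v c \<longleftrightarrow>
     (\<forall>T\<in>orthogonal_symmetries P.
        induced_permutation n v T \<in> colored_graph_automorphisms n (edge_graph P n v) c) \<and>
     induced_permutation n v
       \<in> iso (orthogonal_aut_group P) (colored_aut_group n (edge_graph P n v) c)"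

text \<open>\<^const>\<open>iso\<close> does not itself require its arguments to be groups; here they always are.\<close>

lemma group_orthogonal_aut_group: "group (orthogonal_aut_group P)"
proof (rule groupI)
  fix T assume "T \<in> carrier (orthogonal_aut_group P)"
  then have o: "orthogonal_transformation T" and im: "T ` P = P"
    by (auto simp: orthogonal_aut_group_def orthogonal_symmetries_def)
  have "inv_into UNIV T ` P = P"
    using image_inv_f_f[OF orthogonal_transformation_inj[OF o], of P] unfolding im .
  moreover have "inv_into UNIV T \<circ> T = id"
    using o by (simp add: orthogonal_transformation_inj)
  ultimately show "\<exists>S\<in>carrier (orthogonal_aut_group P).
      S \<otimes>\<^bsub>orthogonal_aut_group P\<^esub> T = \<one>\<^bsub>orthogonal_aut_group P\<^esub>"
    using o by (intro bexI[of _ "inv_into UNIV T"])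
      (auto simp: orthogonal_aut_group_def orthogonal_symmetries_def
        orthogonal_transformation_inv)
next
  fix S T assume "S \<in> carrier (orthogonal_aut_group P)" "T \<in> carrier (orthogonal_aut_group P)"
  then have "orthogonal_transformation S" "S ` P = P" "orthogonal_transformation T" "T ` P = P"
    by (simp_all add: orthogonal_aut_group_def orthogonal_symmetries_def)
  moreover from this have "(S \<circ> T) ` P = P"
    by (simp only: image_comp[symmetric])
  ultimately show "S \<otimes>\<^bsub>orthogonal_aut_group P\<^esub> T \<in> carrier (orthogonal_aut_group P)"
    by (simp del: o_apply add: orthogonal_aut_group_def orthogonal_symmetries_def
        orthogonal_transformation_compose)
qed (simp_all add: orthogonal_aut_group_def orthogonal_symmetries_def o_assoc
      orthogonal_transformation_def linear_id)

lemma group_colored_aut_group: "group (colored_aut_group n E c)"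
proof (rule groupI)
  fix \<sigma> assume "\<sigma> \<in> carrier (colored_aut_group n E c)"
  then have p: "\<sigma> permutes {1..n}"
    and e: "\<And>i j. i \<in> {1..n} \<Longrightarrow> j \<in> {1..n} \<Longrightarrow> {i, j} \<in> E \<longleftrightarrow> {\<sigma> i, \<sigma> j} \<in> E"
    and cv: "\<And>i. i \<in> {1..n} \<Longrightarrow> c (Inl i) = c (Inl (\<sigma> i))"
    and ce: "\<And>i j. i \<in> {1..n} \<Longrightarrow> j \<in> {1..n} \<Longrightarrow> {i, j} \<in> E \<Longrightarrow>
      c (Inr {i, j}) = c (Inr {\<sigma> i, \<sigma> j})"
    by (auto simp: colored_aut_group_def colored_graph_automorphisms_def
        graph_automorphisms_def)
  have r: "\<sigma> (inv_into UNIV \<sigma> i) = i" for i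
    using p by (simp add: permutes_inverses)
  have m: "inv_into UNIV \<sigma> i \<in> {1..n}" if "i \<in> {1..n}" for i
    using that permutes_in_image[OF permutes_inv[OF p]] by blast
  have e': "{i, j} \<in> E \<longleftrightarrow> {inv_into UNIV \<sigma> i, inv_into UNIV \<sigma> j} \<in> E" if "i \<in> {1..n}" "j \<in> {1..n}" for i j
    using e[OF m[OF that(1)] m[OF that(2)]] unfolding r by simp
  have cv': "c (Inl i) = c (Inl (inv_into UNIV \<sigma> i))" if "i \<in> {1..n}" for i
    using cv[OF m[OF that]] unfolding r by simp
  have ce': "c (Inr {i, j}) = c (Inr {inv_into UNIV \<sigma> i, inv_into UNIV \<sigma> j})"
    if "i \<in> {1..n}" "j \<in> {1..n}" "{i, j} \<in> E" for i j
    using ce[OF m[OF that(1)] m[OF that(2)]] e'[OF that(1,2)] that(3) unfolding r by simp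
  have "inv_into UNIV \<sigma> \<in> colored_graph_automorphisms n E c"
    unfolding colored_graph_automorphisms_def graph_automorphisms_def
    by (intro CollectI conjI ballI impI permutes_inv[OF p] e' cv' ce')
  then show "\<exists>\<tau>\<in>carrier (colored_aut_group n E c).
      \<tau> \<otimes>\<^bsub>colored_aut_group n E c\<^esub> \<sigma> = \<one>\<^bsub>colored_aut_group n E c\<^esub>"
    using permutes_inv_o(2)[OF p]
    by (intro bexI[of _ "inv_into UNIV \<sigma>"]) (simp_all add: colored_aut_group_def)
next
  fix \<sigma> \<tau>
  assume s: "\<sigma> \<in> carrier (colored_aut_group n E c)"
    and t: "\<tau> \<in> carrier (colored_aut_group n E c)"
  have *: "\<rho> permutes {1..n}"
      "\<forall>i\<in>{1..n}. \<forall>j\<in>{1..n}. {i, j} \<in> E \<longleftrightarrow> {\<rho> i, \<rho> j} \<in> E"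
      "\<forall>i\<in>{1..n}. c (Inl i) = c (Inl (\<rho> i))"
      "\<forall>i\<in>{1..n}. \<forall>j\<in>{1..n}. {i, j} \<in> E \<longrightarrow> c (Inr {i, j}) = c (Inr {\<rho> i, \<rho> j})"
    if "\<rho> \<in> carrier (colored_aut_group n E c)" for \<rho>
    using that unfolding colored_aut_group_def colored_graph_automorphisms_def
      graph_automorphisms_def partial_object.simps mem_Collect_eq by blast+
  note S = *[OF s] and T = *[OF t]
  have m: "\<tau> i \<in> {1..n}" if "i \<in> {1..n}" for i
    using that permutes_in_image[OF T(1)] by blast
  have "(\<sigma> \<circ> \<tau>) permutes {1..n}"
    using T(1) S(1) by (rule permutes_compose)
  moreover have "\<forall>i\<in>{1..n}. c (Inl i) = c (Inl ((\<sigma> \<circ> \<tau>) i))"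
    unfolding o_apply using T(3) S(3) m by metis
  moreover have "\<forall>i\<in>{1..n}. \<forall>j\<in>{1..n}. {i, j} \<in> E \<longleftrightarrow> {(\<sigma> \<circ> \<tau>) i, (\<sigma> \<circ> \<tau>) j} \<in> E"
    unfolding o_apply using T(2) S(2) m by metis
  moreover have "\<forall>i\<in>{1..n}. \<forall>j\<in>{1..n}. {i, j} \<in> E \<longrightarrow>
      c (Inr {i, j}) = c (Inr {(\<sigma> \<circ> \<tau>) i, (\<sigma> \<circ> \<tau>) j})"
    unfolding o_apply using T(2,4) S(4) m by metis
  ultimately have "\<sigma> \<circ> \<tau> \<in> colored_graph_automorphisms n E c"
    unfolding colored_graph_automorphisms_def graph_automorphisms_def mem_Collect_eq
    by (intro conjI)
  then show "\<sigma> \<otimes>\<^bsub>colored_aut_group n E c\<^esub> \<tau> \<in> carrier (colored_aut_group n E c)"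
    by (simp add: colored_aut_group_def)
qed (simp_all add: colored_aut_group_def colored_graph_automorphisms_def
      graph_automorphisms_def o_assoc permutes_id)


section \<open>Izmestiev and metric colorings\<close>

text \<open>A vector \<open>c\<close> in \<open>n\<close>-space is a function on \<open>nat\<close> of which only the values on \<open>{1..n}\<close>
  are used.\<close>

definition generalized_polar ::
    "nat \<Rightarrow> (nat \<Rightarrow> real^'d) \<Rightarrow> (nat \<Rightarrow> real) \<Rightarrow> (real^'d) set" where
  "generalized_polar n v c = {x. \<forall>i\<in>{1..n}. x \<bullet> v i \<le> c i}"

definition partial_deriv ::
    "nat \<Rightarrow> ((nat \<Rightarrow> real) \<Rightarrow> real) \<Rightarrow> (nat \<Rightarrow> real) \<Rightarrow> real" where
  "partial_deriv i f c = deriv (\<lambda>t. f (c(i := t))) (c i)"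

definition izmestiev_matrix :: "nat \<Rightarrow> (nat \<Rightarrow> real^'d) \<Rightarrow> nat \<Rightarrow> nat \<Rightarrow> real" where
  "izmestiev_matrix n v i j =
     partial_deriv i (partial_deriv j (\<lambda>c. measure lebesgue (generalized_polar n v c))) (\<lambda>_. 1)"

definition izmestiev_coloring :: "nat \<Rightarrow> (nat \<Rightarrow> real^'d) \<Rightarrow> real coloring" where
  "izmestiev_coloring n v = matrix_coloring (izmestiev_matrix n v)"

definition metric_coloring :: "(nat \<Rightarrow> real^'d) \<Rightarrow> real coloring" where
  "metric_coloring v = matrix_coloring (\<lambda>i j. v i \<bullet> v j)"

lemma metric_coloring_vertex: "metric_coloring v (Inl i) = (norm (v i))\<^sup>2"
  by (simp add: metric_coloring_def matrix_coloring_def power2_norm_eq_inner)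

lemma metric_coloring_edge: "metric_coloring v (Inr {i, j}) = v i \<bullet> v j"
  by (simp add: metric_coloring_def matrix_coloring_def edge_value_eq inner_commute)

end

theory Submission
  imports Defs
begin

text \<open>
  Let \<open>M\<close> be the Izmestiev matrix. It is the Hessian of the volume at \<open>(1,\<dots>,1)\<close>, its off-diagonal entries
  vanish outside the edge-graph, and by translation invariance of the volume \<open>M\<close> annihilates all
  functions \<open>i \<mapsto> \<langle>a, v\<^sub>i\<rangle>\<close>. A colored automorphism \<open>\<sigma>\<close> commutes with \<open>M\<close>, so \<open>f\<^sub>i = \<langle>a, v\<^bsub>\<sigma>(i)\<^esub>\<rangle>\<close> lies in the
  kernel of \<open>M\<close> too, and the volume of the polar body is stationary to second order along \<open>1 + t f\<close>.

  The kernel contains nothing but linear functions. By Brunn--Minkowski the facet areas satisfy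
  \<open>A(c) A(c') \<le> A((c+c')/2)\<^sup>2\<close>. Transporting mass monotonically in direction \<open>v\<^sub>i\<close> from the body at \<open>1 - t f\<close>
  to the one at \<open>1 + t f\<close>, starting at the \<open>i\<close>-th facet, second-order stationarity forces the
  transport to be a shift by \<open>2 t f\<^sub>i + o(t)\<close>. Hence the derivative \<open>b\<close> of the barycenter satisfies
  \<open>\<langle>b, v\<^sub>i\<rangle> = f\<^sub>i\<close> for every \<open>i\<close>.

  So \<open>\<sigma>\<close> is induced by a linear map \<open>T\<close>. The metric coloring says that \<open>\<langle>T x, T y\<rangle> - \<langle>x, y\<rangle>\<close> vanishes
  whenever \<open>x\<close> and \<open>y\<close> are equal or adjacent vertices. As the edges at a vertex leave in enough
  directions, it vanishes identically and \<open>T\<close> is orthogonal.\<close>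

section \<open>Brunn--Minkowski for convex bodies\<close>

text \<open>The kernel of \<open>M\<close> is classically read off from the equality case of
  Minkowski's quadratic inequality. Here a stability estimate replaces it. The bodies at 1 + t f and
  1 - t f average to the one at (1,...,1), so second-order stationarity leaves a Brunn--Minkowski
  deficit of only o(t^2). The deficit grows at least like the integral of (T' - 1)^2, so T is a
  shift up to o(t). This is exactly enough, because the barycenter moves at order t.

  The obstacle is regularity: \<open>A j\<close> is differentiated only at (1,...,1). Derivatives
  are therefore strict ones, obtained from limits of volumes of thin corners: one nearly tight
  constraint gives a first difference of the volume, two give a mixed second difference. Diagonal
  entries of \<open>M\<close> come from no corner; translation invariance expresses them by the
  others.

  The kernel relation must also give a vanishing first variation. It does so by Euler's relation,
  whose factor d - 1 forces a separate argument for d = 1.\<close>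

lemma measure_split_hyperplane:
  fixes C :: "'a::euclidean_space set"
  assumes C: "C \<in> lmeasurable" and k: "k \<noteq> 0"
  shows "measure lebesgue (C \<inter> {x. x \<bullet> k \<le> c}) + measure lebesgue (C \<inter> {x. x \<bullet> k \<ge> c})
    = measure lebesgue C"
proof -
  have cl: "closed {x. x \<bullet> k \<le> c}" "closed {x. x \<bullet> k \<ge> c}"
    using closed_halfspace_le[where a=k and b=c] closed_halfspace_ge[where a=k and b=c]
    by (simp_all add: inner_commute)
  have m: "C \<inter> {x. x \<bullet> k \<le> c} \<in> lmeasurable" "C \<inter> {x. x \<bullet> k \<ge> c} \<in> lmeasurable"
    using cl C by (simp_all add: fmeasurable_Int_fmeasurable borel_closed)
  have "negligible ((C \<inter> {x. x \<bullet> k \<le> c}) \<inter> (C \<inter> {x. x \<bullet> k \<ge> c}))"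
    by (rule negligible_subset[OF negligible_hyperplane[where a=k and b=c]])
      (use k in \<open>auto simp: inner_commute\<close>)
  then have "measure lebesgue ((C \<inter> {x. x \<bullet> k \<le> c}) \<union> (C \<inter> {x. x \<bullet> k \<ge> c}))
    = measure lebesgue (C \<inter> {x. x \<bullet> k \<le> c}) + measure lebesgue (C \<inter> {x. x \<bullet> k \<ge> c})"
    using m measure_Un3[OF m] by (simp add: negligible_iff_measure)
  moreover have "(C \<inter> {x. x \<bullet> k \<le> c}) \<union> (C \<inter> {x. x \<bullet> k \<ge> c}) = C" by auto
  ultimately show ?thesis by simp
qed

text \<open>An explicit formula, because the volume cut off must be visibly continuous in
  \<open>c\<close> when an intermediate value argument chooses a cut.\<close>

lemma content_cbox_halfspace:
  fixes a b :: "'a::euclidean_space"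
  assumes k: "k \<in> Basis" and ab: "box a b \<noteq> {}"
  shows "measure lebesgue (cbox a b \<inter> {x. x \<bullet> k \<le> c}) =
    (\<Prod>i\<in>Basis-{k}. (b - a) \<bullet> i) * max 0 (min (b \<bullet> k) c - a \<bullet> k)"
proof -
  let ?b = "\<Sum>i\<in>Basis. (if i = k then min (b \<bullet> k) c else b \<bullet> i) *\<^sub>R i"
  have lt: "a \<bullet> i < b \<bullet> i" if "i \<in> Basis" for i using ab that by (auto simp: box_ne_empty)
  have eq: "cbox a b \<inter> {x. x \<bullet> k \<le> c} = cbox a ?b"
    using interval_split(1)[OF k] by blast
  show ?thesis
  proof (cases "a \<bullet> k \<le> c")
    case True
    have "\<forall>i\<in>Basis. a \<bullet> i \<le> ?b \<bullet> i"
      using lt True by (auto simp: less_imp_le k)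
    then have "measure lebesgue (cbox a ?b) = (\<Prod>i\<in>Basis. (?b \<bullet> i - a \<bullet> i))"
      by (simp add: inner_diff_left)
    also have "\<dots> = (min (b \<bullet> k) c - a \<bullet> k) * (\<Prod>i\<in>Basis-{k}. (?b \<bullet> i - a \<bullet> i))"
      using k by (subst prod.remove[of _ k]) auto
    also have "(\<Prod>i\<in>Basis-{k}. (?b \<bullet> i - a \<bullet> i)) = (\<Prod>i\<in>Basis-{k}. (b - a) \<bullet> i)"
      by (intro prod.cong) (auto simp: inner_diff_left)
    finally show ?thesis using True lt[OF k] unfolding eq by (simp add: max_def min_def)
  next
    case False
    then have "cbox a b \<inter> {x. x \<bullet> k \<le> c} = {}"
      using k by (fastforce simp: mem_box)
    then show ?thesis using False by (simp add: max_def min_def)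
  qed
qed

text \<open>In each coordinate p * q <= ((p + q) / 2)^2, and the product of these inequalities is
  the claim; this multiplicative form needs no d-th roots. Only containment of the midpoints in
  \<open>C\<close> is asked for, so that measurability of a Minkowski sum never becomes an
  issue.\<close>

lemma brunn_minkowski_cbox:
  fixes a b c d :: "'a::euclidean_space"
  assumes ab: "box a b \<noteq> {}" and cd: "box c d \<noteq> {}" and C: "C \<in> lmeasurable"
    and mid: "\<And>x y. x \<in> cbox a b \<Longrightarrow> y \<in> cbox c d \<Longrightarrow> (1/2) *\<^sub>R (x + y) \<in> C"
  shows "measure lebesgue (cbox a b) * measure lebesgue (cbox c d) \<le> (measure lebesgue C)\<^sup>2"
proof -
  have lt: "a \<bullet> i < b \<bullet> i" "c \<bullet> i < d \<bullet> i" if "i \<in> Basis" for i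
    using ab cd that by (auto simp: box_ne_empty)
  let ?l = "(1/2) *\<^sub>R (a + c)" and ?u = "(1/2) *\<^sub>R (b + d)"
  have sub: "cbox ?l ?u \<subseteq> C"
  proof
    fix m assume m: "m \<in> cbox ?l ?u"
    \<comment> \<open>The relative position of \<open>m\<close> between the corners, coordinate by
      coordinate. Using it in both boxes yields two points with midpoint \<open>m\<close>.\<close>
    define t where "t i = (m \<bullet> i - ?l \<bullet> i) / (?u \<bullet> i - ?l \<bullet> i)" for i
    have pos: "?u \<bullet> i - ?l \<bullet> i > 0" if "i \<in> Basis" for i
      using lt[OF that] by (simp add: inner_add_left)
    have t01: "0 \<le> t i" "t i \<le> 1" if "i \<in> Basis" for i
      using m that pos[OF that] unfolding t_def mem_box by (auto simp: divide_simps)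
    let ?x = "\<Sum>i\<in>Basis. (a \<bullet> i + t i * (b \<bullet> i - a \<bullet> i)) *\<^sub>R i"
    let ?y = "\<Sum>i\<in>Basis. (c \<bullet> i + t i * (d \<bullet> i - c \<bullet> i)) *\<^sub>R i"
    have between: "p \<le> p + s * (q - p) \<and> p + s * (q - p) \<le> q" if "p < q" "0 \<le> s" "s \<le> 1" for p q s :: real
    proof -
      have "0 \<le> s * (q - p)" "s * (q - p) \<le> q - p"
        using that mult_left_le_one_le[of "q - p" s] by simp_all
      then show ?thesis by linarith
    qed
    have x: "?x \<in> cbox a b" using between[OF lt(1) t01] by (simp add: mem_box)
    have y: "?y \<in> cbox c d" using between[OF lt(2) t01] by (simp add: mem_box)
    have "(1/2) *\<^sub>R (?x + ?y) = m"
    proof (rule euclidean_eqI)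
      fix i :: 'a assume i: "i \<in> Basis"
      have "t i * (?u \<bullet> i - ?l \<bullet> i) = m \<bullet> i - ?l \<bullet> i" using pos[OF i] unfolding t_def by simp
      moreover have "?x \<bullet> i = a \<bullet> i + t i * (b \<bullet> i - a \<bullet> i)" "?y \<bullet> i = c \<bullet> i + t i * (d \<bullet> i - c \<bullet> i)"
        using i by simp_all
      ultimately show "((1/2) *\<^sub>R (?x + ?y)) \<bullet> i = m \<bullet> i"
        by (simp only: inner_add_left inner_scaleR_left) (simp add: algebra_simps)
    qed
    then show "m \<in> C" using mid[OF x y] by simp
  qed
  have le: "measure lebesgue (cbox ?l ?u) \<le> measure lebesgue C"
    by (rule measure_mono_fmeasurable[OF sub _ C]) simp
  have "measure lebesgue (cbox a b) * measure lebesgue (cbox c d)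
      = (\<Prod>i\<in>Basis. (b \<bullet> i - a \<bullet> i) * (d \<bullet> i - c \<bullet> i))"
    using lt by (simp add: less_imp_le prod.distrib inner_diff_left)
  also have "\<dots> \<le> (\<Prod>i\<in>Basis. (?u \<bullet> i - ?l \<bullet> i)\<^sup>2)"
  proof (rule prod_mono)
    fix i :: 'a assume i: "i \<in> Basis"
    have "?u \<bullet> i - ?l \<bullet> i = ((b \<bullet> i - a \<bullet> i) + (d \<bullet> i - c \<bullet> i)) / 2"
      by (simp add: inner_add_left field_simps)
    moreover have "p * q \<le> ((p + q) / 2)\<^sup>2" for p q :: real
      using sum_squares_bound[of p q] zero_le_power2[of "p - q"] by (simp add: power2_eq_square field_simps)
    ultimately have "(b \<bullet> i - a \<bullet> i) * (d \<bullet> i - c \<bullet> i) \<le> (?u \<bullet> i - ?l \<bullet> i)\<^sup>2"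
      by metis
    then show "0 \<le> (b \<bullet> i - a \<bullet> i) * (d \<bullet> i - c \<bullet> i) \<and> (b \<bullet> i - a \<bullet> i) * (d \<bullet> i - c \<bullet> i) \<le> (?u \<bullet> i - ?l \<bullet> i)\<^sup>2"
      using lt[OF i] by (simp add: less_imp_le)
  qed
  also have "\<dots> = (measure lebesgue (cbox ?l ?u))\<^sup>2"
  proof -
    have "\<forall>i\<in>Basis. ?l \<bullet> i \<le> ?u \<bullet> i"
    proof
      fix i :: 'a assume "i \<in> Basis"
      from lt[OF this] show "?l \<bullet> i \<le> ?u \<bullet> i" by (simp add: inner_add_left)
    qed
    then have "measure lebesgue (cbox ?l ?u) = (\<Prod>i\<in>Basis. (?u \<bullet> i - ?l \<bullet> i))"
      using content_cbox[of ?l ?u] by (simp del: measure_lborel_cbox_eq content_cbox)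
    then show ?thesis by (simp only: prod_power_distrib)
  qed
  also have "\<dots> \<le> (measure lebesgue C)\<^sup>2" using le by (intro power_mono) auto
  finally show ?thesis .
qed

text \<open>Members are indexed so that the pieces of a cut keep their indices. Nonempty open boxes
  give every member positive volume.\<close>

definition box_family :: "'i set \<Rightarrow> ('i \<Rightarrow> 'a::euclidean_space set) \<Rightarrow> bool" where
  "box_family I Q \<longleftrightarrow> finite I \<and> (\<forall>i\<in>I. \<exists>a b. Q i = cbox a b \<and> box a b \<noteq> {}) \<and>
    (\<forall>i\<in>I. \<forall>j\<in>I. i \<noteq> j \<longrightarrow> interior (Q i) \<inter> interior (Q j) = {})"

lemma box_family_cut:
  fixes Q :: "'i \<Rightarrow> 'a::euclidean_space set"
  assumes fam: "box_family I Q" and k: "k \<in> Basis" and H: "H = {x. x \<bullet> k \<le> c} \<or> H = {x. x \<bullet> k \<ge> c}"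
  defines "I' \<equiv> {i\<in>I. interior (Q i \<inter> H) \<noteq> {}}"
  shows "box_family I' (\<lambda>i. Q i \<inter> H)"
    and "(\<Sum>i\<in>I'. measure lebesgue (Q i \<inter> H)) = (\<Sum>i\<in>I. measure lebesgue (Q i \<inter> H))"
proof -
  have bx: "\<exists>a b. Q i \<inter> H = cbox a b" if i: "i \<in> I" for i
  proof -
    obtain a b where ab: "Q i = cbox a b" using fam i unfolding box_family_def by meson
    from H show ?thesis
    proof
      assume "H = {x. x \<bullet> k \<le> c}"
      then show ?thesis unfolding ab by (simp only: interval_split(1)[OF k]) blast
    next
      assume "H = {x. x \<bullet> k \<ge> c}"
      then show ?thesis unfolding ab by (simp only: interval_split(2)[OF k]) blast
    qed
  qed
  show "box_family I' (\<lambda>i. Q i \<inter> H)"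
    unfolding box_family_def
  proof (intro conjI ballI impI)
    show "finite I'" using fam unfolding I'_def box_family_def by auto
  next
    fix i assume "i \<in> I'"
    then have i: "i \<in> I" "interior (Q i \<inter> H) \<noteq> {}" unfolding I'_def by auto
    obtain a b where "Q i \<inter> H = cbox a b" using bx[OF i(1)] by blast
    then show "\<exists>a b. Q i \<inter> H = cbox a b \<and> box a b \<noteq> {}" using i(2) by (metis interior_cbox)
  next
    fix i j assume "i \<in> I'" "j \<in> I'" "i \<noteq> j"
    then have "interior (Q i) \<inter> interior (Q j) = {}"
      using fam unfolding I'_def box_family_def by auto
    then show "interior (Q i \<inter> H) \<inter> interior (Q j \<inter> H) = {}" by (auto simp: interior_Int)
  qed
  show "(\<Sum>i\<in>I'. measure lebesgue (Q i \<inter> H)) = (\<Sum>i\<in>I. measure lebesgue (Q i \<inter> H))"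
  proof (rule sum.mono_neutral_left)
    show "finite I" using fam unfolding box_family_def by auto
    show "I' \<subseteq> I" unfolding I'_def by auto
    show "\<forall>i\<in>I - I'. measure lebesgue (Q i \<inter> H) = 0"
    proof
      fix i assume "i \<in> I - I'"
      then have i: "i \<in> I" "interior (Q i \<inter> H) = {}" unfolding I'_def by auto
      obtain a b where ab: "Q i \<inter> H = cbox a b" using bx[OF i(1)] by blast
      then have "negligible (cbox a b)" using i(2) by (metis interior_cbox negligible_interval(1))
      then show "measure lebesgue (Q i \<inter> H) = 0" unfolding ab using negligible_imp_measure0 by blast
    qed
  qed
qed

lemma box_family_measure_pos:
  fixes Q :: "'i \<Rightarrow> 'a::euclidean_space set"
  assumes "box_family I Q" "I \<noteq> {}" shows "(\<Sum>i\<in>I. measure lebesgue (Q i)) > 0"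
proof (rule sum_pos)
  show "finite I" "I \<noteq> {}" using assms unfolding box_family_def by auto
  fix i assume "i \<in> I"
  then obtain a b where Q: "Q i = cbox a b" and ne: "box a b \<noteq> {}"
    using assms(1) unfolding box_family_def by meson
  then have "a \<bullet> j < b \<bullet> j" if "j \<in> Basis" for j using that by (auto simp: box_ne_empty)
  then show "0 < measure lebesgue (Q i)"
    unfolding Q by (simp add: less_imp_le prod_pos inner_diff_left)
qed

text \<open>The volume below level \<open>c\<close> depends continuously on \<open>c\<close> and
  runs from 0 to the total, so the intermediate value theorem applies.\<close>

lemma box_family_split_measure:
  fixes Q :: "'i \<Rightarrow> 'a::euclidean_space set"
  assumes fam: "box_family I Q" and k: "k \<in> Basis"
    and t: "0 \<le> t" "t \<le> 1"
  obtains c where "(\<Sum>i\<in>I. measure lebesgue (Q i \<inter> {x. x \<bullet> k \<le> c})) = t * (\<Sum>i\<in>I. measure lebesgue (Q i))"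
proof -
  have fin: "finite I" using fam unfolding box_family_def by auto
  obtain a b where ab: "\<And>i. i \<in> I \<Longrightarrow> Q i = cbox (a i) (b i) \<and> box (a i) (b i) \<noteq> {}"
    using fam unfolding box_family_def by metis
  define g where "g c = (\<Sum>i\<in>I. measure lebesgue (Q i \<inter> {x. x \<bullet> k \<le> c}))" for c
  have geq: "g c = (\<Sum>i\<in>I. (\<Prod>j\<in>Basis-{k}. (b i - a i) \<bullet> j) * max 0 (min (b i \<bullet> k) c - a i \<bullet> k))" for c
    unfolding g_def by (rule sum.cong) (use ab content_cbox_halfspace[OF k] in auto)
  have cont: "continuous_on UNIV g" unfolding geq by (intro continuous_intros)
  define l where "l = - (\<Sum>i\<in>I. \<bar>a i \<bullet> k\<bar>)"
  define u where "u = (\<Sum>i\<in>I. \<bar>b i \<bullet> k\<bar>)"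
  have l: "l \<le> a i \<bullet> k" if "i \<in> I" for i
    using member_le_sum[OF that _ fin, of "\<lambda>i. \<bar>a i \<bullet> k\<bar>"] unfolding l_def by auto
  have u: "b i \<bullet> k \<le> u" if "i \<in> I" for i
    using member_le_sum[OF that _ fin, of "\<lambda>i. \<bar>b i \<bullet> k\<bar>"] unfolding u_def by auto
  define l' where "l' = min l u"
  have g0: "g l' = 0" unfolding geq l'_def by (rule sum.neutral) (use l in \<open>force simp: max_def min_def\<close>)
  have g1: "g u = (\<Sum>i\<in>I. measure lebesgue (Q i))"
    unfolding g_def
  proof (rule sum.cong)
    fix i assume i: "i \<in> I"
    have "Q i \<inter> {x. x \<bullet> k \<le> u} = Q i" using ab[OF i] u[OF i] k by (fastforce simp: mem_box)
    then show "measure lebesgue (Q i \<inter> {x. x \<bullet> k \<le> u}) = measure lebesgue (Q i)" by simp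
  qed auto
  have "g l' \<le> t * g u" "t * g u \<le> g u" using t g0 g1 by (auto simp: sum_nonneg mult_left_le_one_le)
  then obtain c where "g c = t * g u"
    using IVT'[of g l' "t * g u" u] continuous_on_subset[OF cont] l'_def by auto
  then show ?thesis using that g_def g1 by metis
qed

text \<open>The Hadwiger--Ohmann induction. Two boxes of one family are separated by a coordinate
  hyperplane, and a parallel hyperplane cuts the other family in the same ratio t : (1 - t).
  Midpoints of the two lower parts and of the two upper parts lie on different sides of the middle
  hyperplane, so the bounds t * sqrt (V * W) and (1 - t) * sqrt (V * W) add up.\<close>

lemma brunn_minkowski_box_family:
  fixes Q R :: "'i \<Rightarrow> 'a::euclidean_space set"
  assumes "box_family I Q" "box_family J R" "I \<noteq> {}" "J \<noteq> {}" "C \<in> lmeasurable"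
    and "\<And>i j x y. i \<in> I \<Longrightarrow> j \<in> J \<Longrightarrow> x \<in> Q i \<Longrightarrow> y \<in> R j \<Longrightarrow> (1/2) *\<^sub>R (x + y) \<in> C"
  shows "(\<Sum>i\<in>I. measure lebesgue (Q i)) * (\<Sum>j\<in>J. measure lebesgue (R j)) \<le> (measure lebesgue C)\<^sup>2"
  using assms
proof (induction "card I + card J" arbitrary: I J Q R C rule: less_induct)
  case less
  \<comment> \<open>Stated for arbitrary families, with the induction hypothesis as a premise,
    because it is used twice: the family with two boxes may be the first or the second one.\<close>
  have step: "(\<Sum>i\<in>I. measure lebesgue (Q i)) * (\<Sum>j\<in>J. measure lebesgue (R j)) \<le> (measure lebesgue C)\<^sup>2"
    if Q: "box_family I Q" and R: "box_family J R" and ne: "I \<noteq> {}" "J \<noteq> {}" and C: "C \<in> lmeasurable"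
      and mid: "\<And>i j x y. i \<in> I \<Longrightarrow> j \<in> J \<Longrightarrow> x \<in> Q i \<Longrightarrow> y \<in> R j \<Longrightarrow> (1/2) *\<^sub>R (x + y) \<in> C"
      and IH: "\<And>(I'::'i set) (J'::'i set) (Q'::'i \<Rightarrow> 'a set) (R'::'i \<Rightarrow> 'a set) (C'::'a set). card I' + card J' < card I + card J \<Longrightarrow> box_family I' Q' \<Longrightarrow>
        box_family J' R' \<Longrightarrow> I' \<noteq> {} \<Longrightarrow> J' \<noteq> {} \<Longrightarrow> C' \<in> lmeasurable \<Longrightarrow>
        (\<And>i j x y. i \<in> I' \<Longrightarrow> j \<in> J' \<Longrightarrow> x \<in> Q' i \<Longrightarrow> y \<in> R' j \<Longrightarrow> (1/2) *\<^sub>R (x + y) \<in> C') \<Longrightarrow>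
        (\<Sum>i\<in>I'. measure lebesgue (Q' i)) * (\<Sum>j\<in>J'. measure lebesgue (R' j)) \<le> (measure lebesgue C')\<^sup>2"
      and two: "i0 \<in> I" "j0 \<in> I" "i0 \<noteq> j0"
    for I J :: "'i set" and Q R :: "'i \<Rightarrow> 'a set" and C i0 j0
  proof -
    obtain a b where ab: "\<And>i. i \<in> I \<Longrightarrow> Q i = cbox (a i) (b i) \<and> box (a i) (b i) \<noteq> {}"
      using Q unfolding box_family_def by metis
    have "box (a i0) (b i0) \<inter> box (a j0) (b j0) = {}"
      using Q two ab unfolding box_family_def by (metis interior_cbox)
    then obtain k where k: "k \<in> Basis" and "b i0 \<bullet> k \<le> a j0 \<bullet> k \<or> b j0 \<bullet> k \<le> a i0 \<bullet> k"
      unfolding disjoint_interval using ab[OF two(1)] ab[OF two(2)]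
      by (metis box_ne_empty(2) linorder_not_less)
    then obtain i1 j1 where ij: "i1 \<in> I" "j1 \<in> I" "b i1 \<bullet> k \<le> a j1 \<bullet> k" using two by blast
    define \<alpha> where "\<alpha> = b i1 \<bullet> k"
    let ?L = "\<lambda>c. {x::'a. x \<bullet> k \<le> c}" and ?U = "\<lambda>c. {x::'a. x \<bullet> k \<ge> c}"
    define IL where "IL = {i\<in>I. interior (Q i \<inter> ?L \<alpha>) \<noteq> {}}"
    define IU where "IU = {i\<in>I. interior (Q i \<inter> ?U \<alpha>) \<noteq> {}}"
    note famL = box_family_cut[OF Q k, of "?L \<alpha>" \<alpha>, folded IL_def]
    note famU = box_family_cut[OF Q k, of "?U \<alpha>" \<alpha>, folded IU_def]
    have hyp: "interior {x::'a. x \<bullet> k = \<alpha>} = {}"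
      using interior_hyperplane[where a=k and b=\<alpha>] k by (simp add: inner_commute nonzero_Basis)
    have inQ: "a i \<bullet> k \<le> x \<bullet> k" "x \<bullet> k \<le> b i \<bullet> k" if "i \<in> I" "x \<in> Q i" for i x
      using that ab[OF that(1)] k by (simp_all add: mem_box)
    have i1: "i1 \<notin> IU"
    proof -
      have "Q i1 \<inter> ?U \<alpha> \<subseteq> {x. x \<bullet> k = \<alpha>}" using inQ(2)[OF ij(1)] unfolding \<alpha>_def by (auto intro: antisym)
      then have "interior (Q i1 \<inter> ?U \<alpha>) = {}" using hyp interior_mono by (metis subset_empty)
      then show ?thesis unfolding IU_def by simp
    qed
    have j1: "j1 \<notin> IL"
    proof -
      have "x \<bullet> k = \<alpha>" if "x \<in> Q j1" "x \<bullet> k \<le> \<alpha>" for x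
        using that inQ(1)[OF ij(2)] ij(3) unfolding \<alpha>_def by (meson antisym order_trans)
      then have "Q j1 \<inter> ?L \<alpha> \<subseteq> {x. x \<bullet> k = \<alpha>}" by auto
      then have "interior (Q j1 \<inter> ?L \<alpha>) = {}" using hyp interior_mono by (metis subset_empty)
      then show ?thesis unfolding IL_def by simp
    qed
    have QL: "Q i1 \<inter> ?L \<alpha> = Q i1" using inQ(2)[OF ij(1)] unfolding \<alpha>_def by auto
    have QU: "Q j1 \<inter> ?U \<alpha> = Q j1" using inQ(1)[OF ij(2)] ij(3) unfolding \<alpha>_def by (auto intro: order_trans)
    have "interior (Q i1) \<noteq> {}" "interior (Q j1) \<noteq> {}" using ab ij by (metis interior_cbox)+
    then have i1L: "i1 \<in> IL" and j1U: "j1 \<in> IU"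
      unfolding IL_def IU_def mem_Collect_eq QL QU using ij by auto
    have finI: "finite I" "finite J" using Q R unfolding box_family_def by auto
    have cL: "card IL < card I" using j1 ij(2) finI by (intro psubset_card_mono) (auto simp: IL_def)
    have cU: "card IU < card I" using i1 ij(1) finI by (intro psubset_card_mono) (auto simp: IU_def)
    define V where "V = (\<Sum>i\<in>I. measure lebesgue (Q i))"
    define W where "W = (\<Sum>j\<in>J. measure lebesgue (R j))"
    have VW: "V > 0" "W > 0" using box_family_measure_pos Q R ne unfolding V_def W_def by blast+
    define VL where "VL = (\<Sum>i\<in>IL. measure lebesgue (Q i \<inter> ?L \<alpha>))"
    define VU where "VU = (\<Sum>i\<in>IU. measure lebesgue (Q i \<inter> ?U \<alpha>))"
    have VLU: "VL > 0" "VU > 0" unfolding VL_def VU_def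
      using box_family_measure_pos famL(1) famU(1) i1L j1U by blast+
    have k0: "k \<noteq> 0" using k by auto
    have Qm: "Q i \<in> lmeasurable" if "i \<in> I" for i using ab[OF that] by simp
    have Rm: "R j \<in> lmeasurable" if "j \<in> J" for j using R that unfolding box_family_def by force
    have Vsum: "VL + VU = V"
    proof -
      have "VL + VU = (\<Sum>i\<in>I. measure lebesgue (Q i \<inter> ?L \<alpha>) + measure lebesgue (Q i \<inter> ?U \<alpha>))"
        using famL(2) famU(2) unfolding VL_def VU_def by (simp add: sum.distrib)
      also have "\<dots> = V" unfolding V_def
        by (intro sum.cong refl measure_split_hyperplane Qm k0)
      finally show ?thesis .
    qed
    define t where "t = VL / V"
    have t: "0 < t" "t < 1" using VLU Vsum VW unfolding t_def by (auto simp: field_simps)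
    obtain \<beta> where \<beta>: "(\<Sum>j\<in>J. measure lebesgue (R j \<inter> ?L \<beta>)) = t * W"
      using box_family_split_measure[OF R k, of t] t unfolding W_def by force
    define JL where "JL = {j\<in>J. interior (R j \<inter> ?L \<beta>) \<noteq> {}}"
    define JU where "JU = {j\<in>J. interior (R j \<inter> ?U \<beta>) \<noteq> {}}"
    note famJL = box_family_cut[OF R k, of "?L \<beta>" \<beta>, folded JL_def]
    note famJU = box_family_cut[OF R k, of "?U \<beta>" \<beta>, folded JU_def]
    define WL where "WL = (\<Sum>j\<in>JL. measure lebesgue (R j \<inter> ?L \<beta>))"
    define WU where "WU = (\<Sum>j\<in>JU. measure lebesgue (R j \<inter> ?U \<beta>))"
    have Wsum: "WL + WU = W"
    proof -
      have "WL + WU = (\<Sum>j\<in>J. measure lebesgue (R j \<inter> ?L \<beta>) + measure lebesgue (R j \<inter> ?U \<beta>))"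
        using famJL(2) famJU(2) unfolding WL_def WU_def by (simp add: sum.distrib)
      also have "\<dots> = W" unfolding W_def
        by (intro sum.cong refl measure_split_hyperplane Rm k0)
      finally show ?thesis .
    qed
    have WL: "WL = t * W" using \<beta> famJL(2) unfolding WL_def by simp
    have WU: "WU = (1 - t) * W" using Wsum WL by (simp add: algebra_simps)
    have VL': "VL = t * V" using VW unfolding t_def by simp
    have VU': "VU = (1 - t) * V" using Vsum VL' by (simp add: algebra_simps)
    have ne': "JL \<noteq> {}" "JU \<noteq> {}"
      using WL WU t VW unfolding WL_def WU_def by (auto intro: ccontr)
    have cJ: "card JL \<le> card J" "card JU \<le> card J" using finI by (auto simp: JL_def JU_def intro: card_mono)
    let ?g = "(\<alpha> + \<beta>) / 2"
    have cl: "closed (?L ?g)" "closed (?U ?g)"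
      using closed_halfspace_le[where a=k and b="?g"] closed_halfspace_ge[where a=k and b="?g"] by (simp_all add: inner_commute)
    have CL: "C \<inter> ?L ?g \<in> lmeasurable" "C \<inter> ?U ?g \<in> lmeasurable"
      using C cl by (simp_all add: fmeasurable_Int_fmeasurable borel_closed)
    have "VL * WL \<le> (measure lebesgue (C \<inter> ?L ?g))\<^sup>2"
      unfolding VL_def WL_def
    proof (rule IH[where Q'="\<lambda>i. Q i \<inter> ?L \<alpha>" and R'="\<lambda>i. R i \<inter> ?L \<beta>"])
      show "card IL + card JL < card I + card J" using cL cJ by simp
      show "box_family IL (\<lambda>i. Q i \<inter> ?L \<alpha>)" "box_family JL (\<lambda>i. R i \<inter> ?L \<beta>)" using famL famJL by auto
      show "IL \<noteq> {}" "JL \<noteq> {}" using i1L ne' by auto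
      fix i j x y assume "i \<in> IL" "j \<in> JL" "x \<in> Q i \<inter> ?L \<alpha>" "y \<in> R j \<inter> ?L \<beta>"
      then show "(1/2) *\<^sub>R (x + y) \<in> C \<inter> ?L ?g" using mid[of i j x y]
        by (auto simp: IL_def JL_def inner_add_left)
    qed (rule CL)
    then have "(t * sqrt (V * W))\<^sup>2 \<le> (measure lebesgue (C \<inter> ?L ?g))\<^sup>2"
      using VW VL' WL by (simp add: power_mult_distrib) (simp add: power2_eq_square algebra_simps)
    then have L: "t * sqrt (V * W) \<le> measure lebesgue (C \<inter> ?L ?g)"
      by (rule power2_le_imp_le) simp
    have "VU * WU \<le> (measure lebesgue (C \<inter> ?U ?g))\<^sup>2"
      unfolding VU_def WU_def
    proof (rule IH[where Q'="\<lambda>i. Q i \<inter> ?U \<alpha>" and R'="\<lambda>i. R i \<inter> ?U \<beta>"])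
      show "card IU + card JU < card I + card J" using cU cJ by simp
      show "box_family IU (\<lambda>i. Q i \<inter> ?U \<alpha>)" "box_family JU (\<lambda>i. R i \<inter> ?U \<beta>)" using famU famJU by auto
      show "IU \<noteq> {}" "JU \<noteq> {}" using j1U ne' by auto
      fix i j x y assume "i \<in> IU" "j \<in> JU" "x \<in> Q i \<inter> ?U \<alpha>" "y \<in> R j \<inter> ?U \<beta>"
      then show "(1/2) *\<^sub>R (x + y) \<in> C \<inter> ?U ?g" using mid[of i j x y]
        by (auto simp: IU_def JU_def inner_add_left)
    qed (rule CL)
    then have "((1-t) * sqrt (V * W))\<^sup>2 \<le> (measure lebesgue (C \<inter> ?U ?g))\<^sup>2"
      using VW VU' WU by (simp add: power_mult_distrib) (simp add: power2_eq_square algebra_simps)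
    then have U: "(1 - t) * sqrt (V * W) \<le> measure lebesgue (C \<inter> ?U ?g)"
      by (rule power2_le_imp_le) simp
    have "sqrt (V * W) \<le> measure lebesgue C"
      using L U measure_split_hyperplane[OF C k0, of ?g] by (simp add: algebra_simps)
    then have "(sqrt (V * W))\<^sup>2 \<le> (measure lebesgue C)\<^sup>2" using VW by (intro power_mono) auto
    then show ?thesis using VW unfolding V_def W_def by simp
  qed
  have fin: "finite I" "finite J" using less.prems unfolding box_family_def by auto
  consider i0 j0 where "i0 \<in> I" "j0 \<in> I" "i0 \<noteq> j0" | i0 j0 where "i0 \<in> J" "j0 \<in> J" "i0 \<noteq> j0"
    | i j where "I = {i}" "J = {j}" using less.prems(3,4) by (metis is_singletonI' is_singleton_def)
  then show ?case
  proof cases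
    case 1
    show ?thesis
    proof (rule step[OF less.prems(1,2,3,4,5) _ _ 1])
      fix i j x y assume "i \<in> I" "j \<in> J" "x \<in> Q i" "y \<in> R j"
      then show "(1/2) *\<^sub>R (x + y) \<in> C" by (rule less.prems(6))
    next
      fix I' J' :: "'i set" and Q' R' :: "'i \<Rightarrow> 'a set" and C'
      assume "card I' + card J' < card I + card J"
      then show "box_family I' Q' \<Longrightarrow>
        box_family J' R' \<Longrightarrow> I' \<noteq> {} \<Longrightarrow> J' \<noteq> {} \<Longrightarrow> C' \<in> lmeasurable \<Longrightarrow>
        (\<And>i j x y. i \<in> I' \<Longrightarrow> j \<in> J' \<Longrightarrow> x \<in> Q' i \<Longrightarrow> y \<in> R' j \<Longrightarrow> (1/2) *\<^sub>R (x + y) \<in> C') \<Longrightarrow>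
        (\<Sum>i\<in>I'. measure lebesgue (Q' i)) * (\<Sum>j\<in>J'. measure lebesgue (R' j)) \<le> (measure lebesgue C')\<^sup>2"
        by (rule less.hyps)
    qed
  next
    case 2
    have "(\<Sum>i\<in>J. measure lebesgue (R i)) * (\<Sum>j\<in>I. measure lebesgue (Q j)) \<le> (measure lebesgue C)\<^sup>2"
    proof (rule step[OF less.prems(2,1,4,3,5) _ _ 2])
      fix i j x y assume "i \<in> J" "j \<in> I" "x \<in> R i" "y \<in> Q j"
      then show "(1/2) *\<^sub>R (x + y) \<in> C" using less.prems(6)[of j i y x] by (simp add: add.commute)
    next
      fix I' J' :: "'i set" and Q' R' :: "'i \<Rightarrow> 'a set" and C'
      assume "card I' + card J' < card J + card I"
      then have "card I' + card J' < card I + card J" by simp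
      then show "box_family I' Q' \<Longrightarrow>
        box_family J' R' \<Longrightarrow> I' \<noteq> {} \<Longrightarrow> J' \<noteq> {} \<Longrightarrow> C' \<in> lmeasurable \<Longrightarrow>
        (\<And>i j x y. i \<in> I' \<Longrightarrow> j \<in> J' \<Longrightarrow> x \<in> Q' i \<Longrightarrow> y \<in> R' j \<Longrightarrow> (1/2) *\<^sub>R (x + y) \<in> C') \<Longrightarrow>
        (\<Sum>i\<in>I'. measure lebesgue (Q' i)) * (\<Sum>j\<in>J'. measure lebesgue (R' j)) \<le> (measure lebesgue C')\<^sup>2"
        by (rule less.hyps)
    qed
    then show ?thesis by (simp add: mult.commute)
  next
    case 3
    have ij: "i \<in> I" "j \<in> J" using 3 by simp_all
    obtain a b where ab: "Q i = cbox a b" "box a b \<noteq> {}"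
      using less.prems(1) ij(1) unfolding box_family_def by meson
    obtain c d where cd: "R j = cbox c d" "box c d \<noteq> {}"
      using less.prems(2) ij(2) unfolding box_family_def by meson
    have "measure lebesgue (Q i) * measure lebesgue (R j) \<le> (measure lebesgue C)\<^sup>2"
      unfolding ab(1) cd(1)
      by (rule brunn_minkowski_cbox[OF ab(2) cd(2) less.prems(5)], rule less.prems(6)[OF ij], unfold ab(1) cd(1))
    then show ?thesis unfolding 3 by simp
  qed
qed

text \<open>An open set is a countable union of boxes with disjoint interiors; finitely many of them
  exhaust its volume up to \<open>e\<close>.\<close>

lemma box_family_approx:
  fixes S :: "'a::euclidean_space set"
  assumes S: "open S" "bounded S" "S \<noteq> {}" and e: "e > 0"
  obtains \<F> where "box_family \<F> (\<lambda>K. K)" "\<F> \<noteq> {}" "\<Union>\<F> \<subseteq> S"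
    "measure lebesgue S - e \<le> (\<Sum>K\<in>\<F>. measure lebesgue K)"
proof -
  obtain a where a: "S \<subseteq> cbox (-a) a"
    using bounded_subset_cbox_symmetric[OF S(2)] by blast
  have bx: "box (-a) a \<noteq> {}"
    using interior_mono[OF a] S by (simp add: interior_open) blast
  \<comment> \<open>A cell tagged by a point of \<open>S\<close> is thereby forced into
    \<open>S\<close>. The tags supplied by \<open>covering_lemma\<close> all lie in
    \<open>S\<close>; the other value only completes \<open>g\<close> to a gauge.\<close>
  define g where "g x = (if x \<in> S then S else UNIV)" for x
  have g: "gauge g" unfolding g_def gauge_def using S(1) by auto
  obtain \<D> where \<D>: "countable \<D>" "\<Union>\<D> \<subseteq> cbox (-a) a"
      "\<And>K. K \<in> \<D> \<Longrightarrow> interior K \<noteq> {} \<and> (\<exists>c d. K = cbox c d)"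
      "pairwise (\<lambda>A B. interior A \<inter> interior B = {}) \<D>"
      "\<And>K. K \<in> \<D> \<Longrightarrow> \<exists>x \<in> S \<inter> K. K \<subseteq> g x"
      "S \<subseteq> \<Union>\<D>"
    using covering_lemma[OF a bx g] by metis
  have sub: "K \<subseteq> S" if "K \<in> \<D>" for K using \<D>(5)[OF that] unfolding g_def by auto
  then have US: "\<Union>\<D> = S" using \<D>(6) by auto
  have fam: "box_family \<F> (\<lambda>K. K)" if "\<F> \<subseteq> \<D>" "finite \<F>" for \<F>
    unfolding box_family_def
  proof (intro conjI ballI impI)
    fix K assume "K \<in> \<F>" then show "\<exists>a b. K = cbox a b \<and> box a b \<noteq> {}"
      using \<D>(3)[of K] that by (metis interior_cbox subsetD)
  next
    fix K L assume "K \<in> \<F>" "L \<in> \<F>" "K \<noteq> L"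
    then show "interior K \<inter> interior L = {}" using \<D>(4) that unfolding pairwise_def by blast
  qed (rule that)
  have lm: "K \<in> lmeasurable" if "K \<in> \<D>" for K using \<D>(3)[OF that] by auto
  have Sm: "S \<in> lmeasurable" using S by (simp add: lmeasurable_open)
  have "\<exists>\<F>\<subseteq>\<D>. finite \<F> \<and> \<F> \<noteq> {} \<and> measure lebesgue S - e \<le> measure lebesgue (\<Union>\<F>)"
  proof (cases "finite \<D>")
    case True
    then show ?thesis using US S e by (intro exI[of _ \<D>]) auto
  next
    case False
    define K where "K = from_nat_into \<D>"
    have K: "range K = \<D>" unfolding K_def using False \<D>(1)
      by (metis finite.emptyI range_from_nat_into)
    define U where "U n = (\<Union>i\<le>n. K i)" for n
    have Um: "U n \<in> sets lebesgue" for n unfolding U_def using lm K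
      by (intro sets.finite_UN) (auto intro: fmeasurableD)
    have "(\<lambda>n. measure lebesgue (U n)) \<longlonglongrightarrow> measure lebesgue (\<Union>n. U n)"
    proof (rule Lim_measure_incseq)
      show "range U \<subseteq> sets lebesgue" using Um by auto
      show "incseq U" unfolding U_def incseq_def by fastforce
      have "(\<Union>n. U n) = S" unfolding U_def using US K by auto
      then show "emeasure lebesgue (\<Union>n. U n) \<noteq> \<infinity>" using fmeasurableD2[OF Sm] by simp
    qed
    moreover have "(\<Union>n. U n) = S" unfolding U_def using US K by auto
    ultimately have "(\<lambda>n. measure lebesgue (U n)) \<longlonglongrightarrow> measure lebesgue S" by simp
    then have "eventually (\<lambda>n. measure lebesgue (U n) > measure lebesgue S - e) sequentially"
      by (rule order_tendstoD) (use e in simp)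
    then obtain n where n: "measure lebesgue (U n) > measure lebesgue S - e"
      by (meson eventually_happens trivial_limit_sequentially)
    show ?thesis
      by (rule exI[of _ "K ` {..n}"]) (use n K in \<open>auto simp: U_def\<close>)
  qed
  then obtain \<F> where F: "\<F> \<subseteq> \<D>" "finite \<F>" "\<F> \<noteq> {}" "measure lebesgue S - e \<le> measure lebesgue (\<Union>\<F>)"
    by blast
  moreover have "measure lebesgue (\<Union>\<F>) \<le> (\<Sum>K\<in>\<F>. measure lebesgue K)"
    using measure_UNION_le[of \<F> "\<lambda>K. K" lebesgue] F lm by (auto intro: fmeasurableD)
  ultimately show ?thesis using that[OF fam[OF F(1,2)] F(3)] sub by auto
qed

lemma brunn_minkowski_open:
  fixes A B C :: "'a::euclidean_space set"
  assumes A: "open A" "bounded A" and B: "open B" "bounded B" and C: "C \<in> lmeasurable"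
    and mid: "\<And>x y. x \<in> A \<Longrightarrow> y \<in> B \<Longrightarrow> (1/2) *\<^sub>R (x + y) \<in> C"
  shows "measure lebesgue A * measure lebesgue B \<le> (measure lebesgue C)\<^sup>2"
proof (cases "A = {} \<or> B = {}")
  case False
  have *: "(measure lebesgue A - e) * (measure lebesgue B - e) \<le> (measure lebesgue C)\<^sup>2"
    if e: "e > 0" "e \<le> measure lebesgue A" "e \<le> measure lebesgue B" for e
  proof -
    obtain F where F: "box_family F (\<lambda>K. K)" "F \<noteq> {}" "\<Union>F \<subseteq> A"
      "measure lebesgue A - e \<le> (\<Sum>K\<in>F. measure lebesgue K)"
      using box_family_approx[OF A _ e(1)] False by metis
    obtain G where G: "box_family G (\<lambda>K. K)" "G \<noteq> {}" "\<Union>G \<subseteq> B"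
      "measure lebesgue B - e \<le> (\<Sum>K\<in>G. measure lebesgue K)"
      using box_family_approx[OF B _ e(1)] False by metis
    have "(measure lebesgue A - e) * (measure lebesgue B - e)
        \<le> (\<Sum>K\<in>F. measure lebesgue K) * (\<Sum>K\<in>G. measure lebesgue K)"
      using F(4) G(4) e by (intro mult_mono) (auto intro: sum_nonneg)
    also have "\<dots> \<le> (measure lebesgue C)\<^sup>2"
      by (rule brunn_minkowski_box_family[OF F(1) G(1) F(2) G(2) C]) (use F(3) G(3) mid in blast)
    finally show ?thesis .
  qed
  have pos: "measure lebesgue A > 0" "measure lebesgue B > 0"
    using A B False open_not_negligible[of A] open_not_negligible[of B]
    by (metis lmeasurable_open negligible_iff_measure zero_less_measure_iff)+
  have lim: "((\<lambda>e. (measure lebesgue A - e) * (measure lebesgue B - e)) \<longlongrightarrow> (measure lebesgue A - 0) * (measure lebesgue B - 0)) (at_right 0)"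
    by (intro tendsto_intros)
  have "(measure lebesgue A - 0) * (measure lebesgue B - 0) \<le> (measure lebesgue C)\<^sup>2"
  proof (rule tendsto_upperbound[OF lim])
    show "eventually (\<lambda>e. (measure lebesgue A - e) * (measure lebesgue B - e) \<le> (measure lebesgue C)\<^sup>2) (at_right 0)"
      unfolding eventually_at_right_field
      by (rule exI[of _ "min (measure lebesgue A) (measure lebesgue B)"]) (use pos * in auto)
  qed simp
  then show ?thesis by simp
qed auto

lemma brunn_minkowski_convex:
  fixes A B C :: "'a::euclidean_space set"
  assumes A: "convex A" "bounded A" and B: "convex B" "bounded B" and C: "C \<in> lmeasurable"
    and mid: "\<And>x y. x \<in> A \<Longrightarrow> y \<in> B \<Longrightarrow> (1/2) *\<^sub>R (x + y) \<in> C"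
  shows "measure lebesgue A * measure lebesgue B \<le> (measure lebesgue C)\<^sup>2"
proof -
  have int: "measure lebesgue S = measure lebesgue (interior S)" if "convex S" "bounded S" for S :: "'a set"
    using measure_interior[OF that(2) negligible_convex_frontier[OF that(1)]] by simp
  show ?thesis unfolding int[OF A] int[OF B]
    by (rule brunn_minkowski_open[OF _ _ _ _ C])
      (use A B mid interior_subset in \<open>auto intro: bounded_subset[OF _ interior_subset]\<close>)
qed

section \<open>Volumes under linear maps and in shrinking corners\<close>

lemma measure_shear_cbox:
  fixes m n :: "'d::finite"
  assumes mn: "m \<noteq> n"
  shows "measure lebesgue ((\<lambda>x::real^'d. \<chi> i. if i = m then x$m + x$n else x$i) ` cbox a b) = measure lebesgue (cbox a b)"
proof (cases "cbox a b = {}")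
  case False
  let ?h = "\<lambda>x::real^'d. \<chi> i. if i = m then x$m + x$n else x$i"
  \<comment> \<open>This translation puts the lower corner at height 0 in direction
    \<open>n\<close>, as \<open>measure_shear_interval\<close> demands. By linearity the shear turns
    it into another translation.\<close>
  define t where "t = axis n (- (a $ n))"
  have ht: "?h (t + x) = ?h t + ?h x" for x
    by (simp add: vec_eq_iff)
  have "measure lebesgue (?h ` cbox a b) = measure lebesgue ((+) (?h t) ` ?h ` cbox a b)"
    by (rule measure_translation[symmetric])
  also have "(+) (?h t) ` ?h ` cbox a b = ?h ` (+) t ` cbox a b"
    unfolding image_image ht ..
  also have "\<dots> = ?h ` cbox (t + a) (t + b)" by (simp add: cbox_translation)
  also have "measure lebesgue (?h ` cbox (t + a) (t + b)) = measure lebesgue (cbox (t + a) (t + b))"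
  proof (rule measure_shear_interval[OF mn])
    show "cbox (t + a) (t + b) \<noteq> {}" using False by (metis cbox_translation image_is_empty)
    show "0 \<le> (t + a) $ n" by (simp add: t_def)
  qed
  also have "\<dots> = measure lebesgue (cbox a b)"
    unfolding cbox_translation by (rule measure_translation)
  finally show ?thesis .
qed simp

lemma image_measure_scales_if_cbox:
  fixes f :: "'a::euclidean_space \<Rightarrow> 'a"
  assumes lin: "linear f" and k: "k \<ge> 0"
    and box: "\<And>a b. measure lebesgue (f ` cbox a b) = k * measure lebesgue (cbox a b)"
  shows "\<exists>\<kappa>\<ge>0. \<forall>S\<in>lmeasurable. f ` S \<in> lmeasurable \<and> measure lebesgue (f ` S) = \<kappa> * measure lebesgue S"
proof (intro exI[of _ k] conjI ballI k)
  fix S :: "'a set" assume S: "S \<in> lmeasurable"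
  note * = measure_linear_sufficient[OF lin S box]
  from * show "f ` S \<in> lmeasurable" by (rule conjunct1)
  from * show "measure lebesgue (f ` S) = k * measure lebesgue S" by simp
qed

text \<open>The library states the change-of-variables formula for linear maps only for index types
  of class \<open>wellorder\<close>, because it evaluates the scaling factor as a determinant; the existence of
  a factor needs no order.\<close>

lemma linear_image_measure_scales:
  fixes f :: "real^'d \<Rightarrow> real^'d"
  assumes "linear f"
  shows "\<exists>\<kappa>\<ge>0. \<forall>S\<in>lmeasurable. f ` S \<in> lmeasurable \<and> measure lebesgue (f ` S) = \<kappa> * measure lebesgue S"
  using assms
proof (rule induct_linear_elementary)
  fix f g :: "real^'d \<Rightarrow> real^'d"
  assume "\<exists>\<kappa>\<ge>0. \<forall>S\<in>lmeasurable. f ` S \<in> lmeasurable \<and> measure lebesgue (f ` S) = \<kappa> * measure lebesgue S"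
  then obtain k where k: "k \<ge> 0" and f: "\<And>S. S \<in> lmeasurable \<Longrightarrow> f ` S \<in> lmeasurable"
      "\<And>S. S \<in> lmeasurable \<Longrightarrow> measure lebesgue (f ` S) = k * measure lebesgue S"
    by auto
  assume "\<exists>\<kappa>\<ge>0. \<forall>S\<in>lmeasurable. g ` S \<in> lmeasurable \<and> measure lebesgue (g ` S) = \<kappa> * measure lebesgue S"
  then obtain l where l: "l \<ge> 0" and g: "\<And>S. S \<in> lmeasurable \<Longrightarrow> g ` S \<in> lmeasurable"
      "\<And>S. S \<in> lmeasurable \<Longrightarrow> measure lebesgue (g ` S) = l * measure lebesgue S"
    by auto
  show "\<exists>\<kappa>\<ge>0. \<forall>S\<in>lmeasurable. (f \<circ> g) ` S \<in> lmeasurable \<and> measure lebesgue ((f \<circ> g) ` S) = \<kappa> * measure lebesgue S"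
  proof (intro exI[of _ "k * l"] conjI ballI)
    fix S :: "(real^'d) set" assume S: "S \<in> lmeasurable"
    show "(f \<circ> g) ` S \<in> lmeasurable" unfolding image_comp[symmetric] by (intro f g S)
    show "measure lebesgue ((f \<circ> g) ` S) = k * l * measure lebesgue S"
      unfolding image_comp[symmetric] f(2)[OF g(1)[OF S]] g(2)[OF S] by simp
  qed (use k l in simp)
next
  fix f :: "real^'d \<Rightarrow> real^'d" and i
  assume f: "linear f" "\<And>x. f x $ i = 0"
  have "\<not> surj f"
  proof
    assume "surj f"
    then obtain x where "f x = axis i 1" by (metis surjD)
    then show False using f(2)[of x] by simp
  qed
  then have "negligible (f ` S)" for S
    using negligible_linear_singular_image[OF f(1)] linear_inj_imp_surj[OF f(1)] by blast
  then show "\<exists>\<kappa>\<ge>0. \<forall>S\<in>lmeasurable. f ` S \<in> lmeasurable \<and> measure lebesgue (f ` S) = \<kappa> * measure lebesgue S"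
    by (intro exI[of _ 0]) (auto simp: negligible_iff_measure)
next
  fix c :: "'d \<Rightarrow> real"
  show "\<exists>\<kappa>\<ge>0. \<forall>S\<in>lmeasurable. (\<lambda>x. \<chi> i. c i * x $ i) ` S \<in> lmeasurable
      \<and> measure lebesgue ((\<lambda>x. \<chi> i. c i * x $ i) ` S) = \<kappa> * measure lebesgue S"
    by (intro exI[of _ "\<bar>prod c UNIV\<bar>"]) (simp add: measurable_stretch measure_stretch)
next
  fix m n :: 'd assume "m \<noteq> n"
  let ?h = "\<lambda>x::real^'d. \<chi> i. x $ Transposition.transpose m n i"
  have lin: "linear ?h"
    by (rule linearI) (simp_all add: plus_vec_def scaleR_vec_def)
  have "measure lebesgue (?h ` cbox a b) = 1 * measure lebesgue (cbox a b)" for a b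
  proof -
    have inv: "?h (?h x) = x" for x by (simp add: vec_eq_iff)
    have "?h ` cbox a b = cbox (?h a) (?h b)"
    proof (intro equalityI subsetI)
      fix x assume "x \<in> cbox (?h a) (?h b)"
      then have "?h x \<in> cbox a b" unfolding mem_box_cart by (metis transpose_involutory vec_lambda_beta)
      then show "x \<in> ?h ` cbox a b" using inv[of x] by (metis imageI)
    qed (auto simp: mem_box_cart)
    moreover have "measure lebesgue (cbox (?h a) (?h b)) = measure lebesgue (cbox a b)"
    proof -
      have e: "cbox (?h a) (?h b) = {} \<longleftrightarrow> cbox a b = {}"
        unfolding interval_eq_empty_cart vec_lambda_beta by (metis transpose_involutory)
      have "(\<Prod>i\<in>UNIV. ?h b $ i - ?h a $ i) = (\<Prod>i\<in>UNIV. b $ i - a $ i)"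
        using prod.permute[OF permutes_swap_id, of m UNIV n "\<lambda>i. b $ i - a $ i"] by (simp add: o_def)
      then show ?thesis using e by (simp add: content_cbox_if_cart)
    qed
    ultimately show ?thesis by simp
  qed
  then show "\<exists>\<kappa>\<ge>0. \<forall>S\<in>lmeasurable. ?h ` S \<in> lmeasurable \<and> measure lebesgue (?h ` S) = \<kappa> * measure lebesgue S"
    by (intro image_measure_scales_if_cbox[OF lin, of 1]) auto
next
  fix m n :: 'd assume mn: "m \<noteq> n"
  let ?h = "\<lambda>x::real^'d. \<chi> i. if i = m then x$m + x$n else x$i"
  have lin: "linear ?h"
    by (rule linearI) (auto simp: algebra_simps plus_vec_def scaleR_vec_def vec_eq_iff)
  show "\<exists>\<kappa>\<ge>0. \<forall>S\<in>lmeasurable. ?h ` S \<in> lmeasurable \<and> measure lebesgue (?h ` S) = \<kappa> * measure lebesgue S"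
  proof (rule image_measure_scales_if_cbox[OF lin, of 1])
    show "measure lebesgue (?h ` cbox a b) = 1 * measure lebesgue (cbox a b)" for a b
      unfolding mult_1 by (rule measure_shear_cbox[OF mn])
  qed simp
qed

lemma linear_inj_image_measure_scales:
  fixes f :: "real^'d \<Rightarrow> real^'d"
  assumes f: "linear f" "inj f"
  obtains \<kappa> where "\<kappa> > 0" "\<And>S. S \<in> lmeasurable \<Longrightarrow> f ` S \<in> lmeasurable"
    "\<And>S. S \<in> lmeasurable \<Longrightarrow> measure lebesgue (f ` S) = \<kappa> * measure lebesgue S"
proof -
  obtain \<kappa> where k: "\<kappa> \<ge> 0"
    "\<And>S. S \<in> lmeasurable \<Longrightarrow> f ` S \<in> lmeasurable \<and> measure lebesgue (f ` S) = \<kappa> * measure lebesgue S"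
    using linear_image_measure_scales[OF f(1)] by blast
  have "open (f ` ball 0 1)"
    using f linear_inj_imp_surj[OF f] by (intro open_surjective_linear_image) auto
  then have "\<not> negligible (f ` ball 0 1)" by (intro open_not_negligible) auto
  then have "measure lebesgue (f ` ball 0 1) \<noteq> 0"
    using k(2)[of "ball 0 1"] by (simp add: negligible_iff_measure lmeasurable_ball)
  then have "\<kappa> \<noteq> 0" using k(2)[of "ball 0 1"] by (auto simp: lmeasurable_ball)
  then show ?thesis using that[of \<kappa>] k by auto
qed

text \<open>The unit ball is mapped onto itself and has positive volume, so the scaling factor is
  1.\<close>

lemma orthogonal_image_measure:
  fixes f :: "real^'d \<Rightarrow> real^'d"
  assumes f: "orthogonal_transformation f" and S: "S \<in> lmeasurable"
  shows "measure lebesgue (f ` S) = measure lebesgue S"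
proof -
  obtain \<kappa> where k: "\<kappa> > 0"
    "\<And>S. S \<in> lmeasurable \<Longrightarrow> measure lebesgue (f ` S) = \<kappa> * measure lebesgue S"
    using linear_inj_image_measure_scales[of f] f orthogonal_transformation_inj orthogonal_transformation_linear
    by metis
  have "f ` ball 0 1 = ball 0 1" using image_orthogonal_transformation_ball[OF f, of 0 1]
    by (simp add: linear_0 orthogonal_transformation_linear[OF f])
  moreover have "measure lebesgue (ball (0::real^'d) 1) > 0"
    by (simp add: content_ball_pos)
  ultimately have "\<kappa> = 1" using k(2)[of "ball 0 1"] by (simp add: lmeasurable_ball)
  then show ?thesis using k(2)[OF S] by simp
qed

text \<open>Dominated convergence of indicator functions: away from the limiting boundary
  hyperplanes, a strict inequality or a violated one persists along the sequence.
  \<open>nondeg\<close> makes these boundaries null; for \<open>q0 k = 0\<close> the boundary is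
  then empty instead of the whole space.\<close>

lemma halfspaces_measure_tendsto:
  fixes q :: "nat \<Rightarrow> 'i \<Rightarrow> 'a::euclidean_space"
  assumes I: "finite I" and B: "closed B"
    and q: "\<And>k. k \<in> I \<Longrightarrow> (\<lambda>m. q m k) \<longlonglongrightarrow> q0 k"
    and g: "\<And>k. k \<in> I \<Longrightarrow> (\<lambda>m. g m k) \<longlonglongrightarrow> g0 k"
    and nondeg: "\<And>k. k \<in> I \<Longrightarrow> q0 k \<noteq> 0 \<or> g0 k \<noteq> 0"
    and bounded: "\<And>m. {y\<in>B. \<forall>k\<in>I. y \<bullet> q m k \<le> g m k} \<subseteq> cball 0 R"
  shows "(\<lambda>m. measure lebesgue {y\<in>B. \<forall>k\<in>I. y \<bullet> q m k \<le> g m k})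
      \<longlonglongrightarrow> measure lebesgue {y\<in>B. \<forall>k\<in>I. y \<bullet> q0 k \<le> g0 k}"
    and "{y\<in>B. \<forall>k\<in>I. y \<bullet> q0 k \<le> g0 k} \<in> lmeasurable"
proof -
  let ?S = "\<lambda>q g. {y\<in>B. \<forall>k\<in>I. y \<bullet> q k \<le> g k}"
  have cl: "closed (?S q g)" for q :: "'i \<Rightarrow> 'a" and g :: "'i \<Rightarrow> real"
  proof -
    have "?S q g = B \<inter> (\<Inter>k\<in>I. {y. y \<bullet> q k \<le> g k})" by auto
    moreover have "closed \<dots>"
      by (intro closed_Int closed_INT B ballI closed_Collect_le continuous_intros)
    ultimately show ?thesis by simp
  qed
  then have meas: "?S q g \<in> sets lebesgue" for q :: "'i \<Rightarrow> 'a" and g :: "'i \<Rightarrow> real" by simp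
  define N where "N = (\<Union>k\<in>I. {y. q0 k \<bullet> y = g0 k})"
  have "negligible N" unfolding N_def
    by (intro negligible_Union finite_imageI I) (use nondeg negligible_hyperplane in blast)
  then have AE: "AE y in lebesgue. y \<notin> N"
    using AE_not_in negligible_iff_null_sets by blast
  have pt: "(\<lambda>m. indicator (?S (q m) (g m)) y :: real) \<longlonglongrightarrow> indicator (?S q0 g0) y" if y: "y \<notin> N" for y
  proof -
    have lim: "(\<lambda>m. g m k - y \<bullet> q m k) \<longlonglongrightarrow> g0 k - y \<bullet> q0 k" if "k \<in> I" for k
      using q[OF that] g[OF that] by (intro tendsto_intros)
    show ?thesis
    proof (cases "y \<in> ?S q0 g0")
      case True
      have "eventually (\<lambda>m. \<forall>k\<in>I. 0 < g m k - y \<bullet> q m k) sequentially"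
      proof (intro eventually_ball_finite I ballI)
        fix k assume k: "k \<in> I"
        then have "y \<bullet> q0 k \<noteq> g0 k" using y unfolding N_def by (auto simp: inner_commute)
        then have "0 < g0 k - y \<bullet> q0 k" using True k by fastforce
        then show "eventually (\<lambda>m. 0 < g m k - y \<bullet> q m k) sequentially"
          using order_tendstoD(1)[OF lim[OF k]] by blast
      qed
      then have "eventually (\<lambda>m. indicator (?S (q m) (g m)) y = (1::real)) sequentially"
        by (rule eventually_mono) (use True in \<open>auto simp: indicator_def intro: less_imp_le\<close>)
      then show ?thesis using True by (simp add: tendsto_eventually)
    next
      case False
      have "eventually (\<lambda>m. y \<notin> ?S (q m) (g m)) sequentially"
      proof (cases "y \<in> B")
        case True
        then obtain k where k: "k \<in> I" "g0 k - y \<bullet> q0 k < 0" using False by force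
        from order_tendstoD(2)[OF lim[OF k(1)] k(2)] show ?thesis
          by (rule eventually_mono) (use k in force)
      qed auto
      then have "eventually (\<lambda>m. indicator (?S (q m) (g m)) y = (0::real)) sequentially"
        by (rule eventually_mono) auto
      then show ?thesis using False by (simp add: tendsto_eventually)
    qed
  qed
  have int: "integrable lebesgue (indicator (cball 0 R :: 'a set) :: 'a \<Rightarrow> real)"
    using lmeasurable_compact[OF compact_cball, of 0 R] by (rule lmeasurable_iff_integrable[THEN iffD1])
  have lim: "AE y in lebesgue. (\<lambda>m. indicator (?S (q m) (g m)) y :: real) \<longlonglongrightarrow> indicator (?S q0 g0) y"
    using AE by (rule AE_mp) (use pt in auto)
  have bd: "AE y in lebesgue. norm (indicator (?S (q m) (g m)) y :: real) \<le> indicator (cball 0 R) y" for m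
    using bounded[of m] by (intro AE_I2) (auto simp: indicator_def)
  have m1: "indicator (?S q g) \<in> borel_measurable lebesgue" for q :: "'i \<Rightarrow> 'a" and g :: "'i \<Rightarrow> real"
    using meas[of q g] by (intro borel_measurable_indicator)
  have "(\<lambda>m. integral\<^sup>L lebesgue (indicator (?S (q m) (g m)) :: 'a \<Rightarrow> real)) \<longlonglongrightarrow> integral\<^sup>L lebesgue (indicator (?S q0 g0))"
    by (rule integral_dominated_convergence[OF m1 m1 int lim bd])
  then show "(\<lambda>m. measure lebesgue (?S (q m) (g m))) \<longlonglongrightarrow> measure lebesgue (?S q0 g0)"
    by simp
  have "integrable lebesgue (indicator (?S q0 g0) :: 'a \<Rightarrow> real)"
    by (rule integrable_dominated_convergence[OF m1 m1 int lim bd])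
  then show "?S q0 g0 \<in> lmeasurable"
    using meas[of q0 g0] by (auto simp: integrable_indicator_iff intro!: fmeasurableI)
qed

text \<open>Supplies coordinates in which the nearly tight constraints of a corner become bounds on
  single coordinates.\<close>

lemma independent_imp_coordinates:
  fixes S :: "(real^'d) set"
  assumes S: "independent S"
  obtains g :: "real^'d \<Rightarrow> real^'d" and \<iota> :: "real^'d \<Rightarrow> 'd"
  where "linear g" "inj g" "surj g" "inj_on \<iota> S" "\<And>x. x \<in> S \<Longrightarrow> g x = axis (\<iota> x) 1"
proof -
  obtain B where B: "S \<subseteq> B" "independent B" "span B = UNIV"
    using maximal_independent_subset_extend[OF subset_UNIV S] by (metis top.extremum_uniqueI)
  have fin: "finite B" using B(2) by (rule finiteI_independent)
  have "card B = dim (span B)"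
    unfolding dim_span using dim_eq_card_independent[OF B(2)] by simp
  also have "\<dots> = DIM(real^'d)" unfolding B(3) by (rule dim_UNIV)
  finally have "card B = CARD('d)" by simp
  then obtain \<iota> where \<iota>: "bij_betw \<iota> B (UNIV :: 'd set)"
    using fin finite_same_card_bij[of B "UNIV :: 'd set"] by auto
  obtain g :: "real^'d \<Rightarrow> real^'d" where g: "linear g" "\<And>x. x \<in> B \<Longrightarrow> g x = axis (\<iota> x) 1"
    using linear_independent_extend[OF B(2), of "\<lambda>x. axis (\<iota> x) 1"] by blast
  have "g ` B = range (\<lambda>k. axis k 1)"
    using g(2) \<iota> unfolding bij_betw_def by (metis (no_types, lifting) image_cong image_image)
  then have "g ` B = Basis" by (auto simp: Basis_vec_def)
  then have "range g = UNIV"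
    using linear_span_image[OF g(1), of B] B(3) by (simp add: span_Basis)
  then show ?thesis
    using that[of g \<iota>] g B(1) \<iota> linear_surjective_imp_injective[OF g(1)]
    by (auto simp: bij_betw_def intro: inj_on_subset)
qed

text \<open>Its volume is a finite difference of the volume of the polar: of first order for a
  singleton \<open>J\<close>, mixed of second order for a pair.\<close>

definition corner :: "nat \<Rightarrow> (nat \<Rightarrow> real^'d) \<Rightarrow> nat set \<Rightarrow> (nat \<Rightarrow> real) \<Rightarrow> (nat \<Rightarrow> real) \<Rightarrow> (real^'d) set"
  where "corner n v J c \<delta> = {x \<in> generalized_polar n v c. \<forall>j\<in>J. c j - \<delta> j \<le> x \<bullet> v j}"

text \<open>Stretching the corner by \<open>1 / \<delta>\<close> in the coordinates \<open>x \<bullet> v j\<close>, \<open>j \<in> J\<close>, makes it converge to the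
  product of a unit cube and the face of the polar on which these constraints are tight. Assumption
  \<open>nondeg\<close> excludes constraints that are parallel to this face and tight on it.\<close>

theorem corner_measure_limit:
  fixes v :: "nat \<Rightarrow> real^'d"
  assumes J: "J \<subseteq> {1..n}" and ind: "independent (v ` J)" and inj: "inj_on v J"
    and nondeg: "\<And>k \<alpha>. k \<in> {1..n} - J \<Longrightarrow> v k = (\<Sum>j\<in>J. \<alpha> j *\<^sub>R v j) \<Longrightarrow> c k \<noteq> (\<Sum>j\<in>J. \<alpha> j * c j)"
    and bounded: "bounded X"
  obtains b where
    "\<And>C \<delta>. (\<And>k. k \<in> {1..n} \<Longrightarrow> (\<lambda>m. C m k) \<longlonglongrightarrow> c k) \<Longrightarrow> (\<And>j. j \<in> J \<Longrightarrow> (\<lambda>m. \<delta> m j) \<longlonglongrightarrow> 0) \<Longrightarrow>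
        (\<And>m j. j \<in> J \<Longrightarrow> 0 < \<delta> m j) \<Longrightarrow> (\<And>m. corner n v J (C m) (\<delta> m) \<subseteq> X) \<Longrightarrow>
        (\<lambda>m. measure lebesgue (corner n v J (C m) (\<delta> m)) / (\<Prod>j\<in>J. \<delta> m j)) \<longlonglongrightarrow> b"
    and "b \<noteq> 0 \<Longrightarrow> \<exists>z. (\<forall>j\<in>J. z \<bullet> v j = c j) \<and> (\<forall>k\<in>{1..n}-J. z \<bullet> v k < c k)"
    and "\<And>z C0 \<delta>0. (\<And>j. j \<in> J \<Longrightarrow> z \<bullet> v j = c j) \<Longrightarrow> (\<And>k. k \<in> {1..n}-J \<Longrightarrow> z \<bullet> v k < c k) \<Longrightarrow>
        (\<And>k. k \<in> {1..n} \<Longrightarrow> (\<lambda>m. C0 m k) \<longlonglongrightarrow> c k) \<Longrightarrow> (\<And>j. j \<in> J \<Longrightarrow> (\<lambda>m. \<delta>0 m j) \<longlonglongrightarrow> 0) \<Longrightarrow>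
        (\<And>m j. j \<in> J \<Longrightarrow> 0 < \<delta>0 m j) \<Longrightarrow> (\<And>m. corner n v J (C0 m) (\<delta>0 m) \<subseteq> X) \<Longrightarrow> b > 0"
proof -
  obtain g :: "real^'d \<Rightarrow> real^'d" and \<iota> where g: "linear g" "inj g" "surj g" and \<iota>: "inj_on \<iota> (v ` J)"
    and gv: "\<And>x. x \<in> v ` J \<Longrightarrow> g x = axis (\<iota> x) 1"
    using independent_imp_coordinates[OF ind] by metis
  define u where "u k = g (v k)" for k
  define ii where "ii j = \<iota> (v j)" for j
  define L where "L = ii ` J"
  define e where "e = inv_into J ii"
  have injii: "inj_on ii J" using \<iota> inj unfolding ii_def by (auto simp: inj_on_def)
  have e: "e (ii j) = j" if "j \<in> J" for j unfolding e_def using injii that by simp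
  have eJ: "e l \<in> J" "ii (e l) = l" if "l \<in> L" for l
    using that e unfolding L_def by auto
  have uJ: "u j = axis (ii j) 1" if "j \<in> J" for j unfolding u_def ii_def using gv that by auto
  have iiL: "ii j \<in> L" if "j \<in> J" for j unfolding L_def using that by auto
  have finJ: "finite J" using J finite_subset by blast
  \<comment> \<open>For x = h y the functional x \<bullet> v j, with j in J, is the coordinate
    \<open>y $ ii j\<close>.\<close>
  define h where "h = adjoint g"
  have hg: "h y \<bullet> v k = y \<bullet> u k" for y k
    using adjoint_works[OF g(1), of "v k" y] unfolding h_def u_def by (simp add: inner_commute)
  have hlin: "linear h" unfolding h_def using adjoint_linear[OF g(1)] .
  have hinj: "inj h"
  proof (rule linear_injective_0[OF hlin, THEN iffD2], intro allI impI)
    fix y assume y: "h y = 0"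
    have "y \<bullet> g x = 0" for x using adjoint_works[OF g(1), of x y] y unfolding h_def by (simp add: inner_commute)
    then have "y \<bullet> y = 0" using g(3) by (metis surjE)
    then show "y = 0" by simp
  qed
  have hsurj: "surj h" using hlin hinj by (metis linear_inj_imp_surj)
  obtain \<kappa> where \<kappa>: "\<kappa> > 0" and meas_h: "\<And>S. S \<in> lmeasurable \<Longrightarrow> measure lebesgue (h ` S) = \<kappa> * measure lebesgue S"
    using linear_inj_image_measure_scales[OF hlin hinj] by metis
  obtain \<beta> where \<beta>: "\<beta> > 0" "\<And>y. \<beta> * norm y \<le> norm (h y)"
    using linear_inj_bounded_below_pos[OF hlin hinj] by blast
  obtain R where R: "\<And>x. x \<in> X \<Longrightarrow> norm x \<le> R" "R > 0" using bounded bounded_pos by metis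

  define B where "B = {z::real^'d. \<forall>j\<in>J. -1 \<le> z $ ii j \<and> z $ ii j \<le> 0}"
  have Bclosed: "closed B"
  proof -
    have "B = (\<Inter>j\<in>J. {z. -1 \<le> z $ ii j} \<inter> {z. z $ ii j \<le> 0})" unfolding B_def by auto
    then show ?thesis by (simp, intro closed_INT ballI closed_Int closed_Collect_le continuous_intros)
  qed
  define I where "I = {1..n} - J"
  have finI: "finite I" unfolding I_def by simp
  \<comment> \<open>Under x = \<open>h (str \<delta> z + s C)\<close> the constraint k outside J
    becomes z \<bullet> \<open>Q \<delta> k\<close> <= \<open>G C k\<close>, while the constraints
    in J become membership of z in the fixed set \<open>B\<close>. At \<delta> = 0 the coordinates
    in \<open>L\<close> disappear from \<open>Q\<close>.\<close>
  define Q where "Q \<delta> k = (\<chi> l. (if l \<in> L then \<delta> (e l) else 1) * u k $ l)" for \<delta> :: "nat \<Rightarrow> real" and k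
  define G where "G C k = C k - (\<Sum>j\<in>J. C j * u k $ ii j)" for C :: "nat \<Rightarrow> real" and k
  define Z where "Z C \<delta> = {z\<in>B. \<forall>k\<in>I. z \<bullet> Q \<delta> k \<le> G C k}" for C \<delta>
  define s where "s C = (\<chi> l. if l \<in> L then C (e l) else (0::real))" for C
  define str where "str \<delta> z = (\<chi> l. (if l \<in> L then \<delta> (e l) else 1) * z $ l)" for \<delta> :: "nat \<Rightarrow> real" and z :: "real^'d"
  have s_in: "s C \<bullet> u k = (\<Sum>j\<in>J. C j * u k $ ii j)" for C k
  proof -
    have "s C \<bullet> u k = (\<Sum>l\<in>UNIV. if l \<in> L then C (e l) * u k $ l else 0)"
      unfolding inner_vec_def s_def by (intro sum.cong) auto
    also have "\<dots> = (\<Sum>l\<in>L. C (e l) * u k $ l)" by (simp add: sum.If_cases)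
    also have "\<dots> = (\<Sum>j\<in>J. C j * u k $ ii j)" unfolding L_def
      by (subst sum.reindex[OF injii]) (simp add: e)
    finally show ?thesis .
  qed
  have str_in: "str \<delta> z \<bullet> w = z \<bullet> (\<chi> l. (if l \<in> L then \<delta> (e l) else 1) * w $ l)" for \<delta> z w
    unfolding str_def inner_vec_def by (intro sum.cong) auto
  have key: "h (str \<delta> z + s C) \<in> corner n v J C \<delta> \<longleftrightarrow> z \<in> Z C \<delta>"
    if \<delta>: "\<And>j. j \<in> J \<Longrightarrow> 0 < \<delta> j" for \<delta> z C
  proof -
    have inJ: "(str \<delta> z + s C) \<bullet> u j = \<delta> j * z $ ii j + C j" if "j \<in> J" for j
      using iiL[OF that] e[OF that] by (simp add: uJ[OF that] inner_axis str_def s_def)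
    have inI: "(str \<delta> z + s C) \<bullet> u k = z \<bullet> Q \<delta> k + (\<Sum>j\<in>J. C j * u k $ ii j)" for k
      unfolding inner_add_left s_in str_in Q_def ..
    have J1: "(C j - \<delta> j \<le> \<delta> j * z $ ii j + C j \<and> \<delta> j * z $ ii j + C j \<le> C j) \<longleftrightarrow> (-1 \<le> z $ ii j \<and> z $ ii j \<le> 0)"
      if "j \<in> J" for j
    proof -
      have "C j - \<delta> j \<le> \<delta> j * z $ ii j + C j \<longleftrightarrow> \<delta> j * (-1) \<le> \<delta> j * z $ ii j" by auto
      moreover have "\<delta> j * z $ ii j + C j \<le> C j \<longleftrightarrow> \<delta> j * z $ ii j \<le> \<delta> j * 0" by auto
      ultimately show ?thesis using \<delta>[OF that] by (simp only: mult_le_cancel_left_pos)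
    qed
    have "h (str \<delta> z + s C) \<in> corner n v J C \<delta> \<longleftrightarrow>
      (\<forall>j\<in>J. C j - \<delta> j \<le> (str \<delta> z + s C) \<bullet> u j \<and> (str \<delta> z + s C) \<bullet> u j \<le> C j) \<and> (\<forall>k\<in>I. (str \<delta> z + s C) \<bullet> u k \<le> C k)"
      unfolding corner_def generalized_polar_def mem_Collect_eq hg I_def using J by blast
    also have "\<dots> \<longleftrightarrow> z \<in> Z C \<delta>"
      unfolding Z_def B_def mem_Collect_eq using inJ J1 inI by (simp add: G_def le_diff_eq)
    finally show ?thesis .
  qed
  have img: "corner n v J C \<delta> = h ` ((\<lambda>y. s C + y) ` (str \<delta> ` Z C \<delta>))" if \<delta>: "\<And>j. j \<in> J \<Longrightarrow> 0 < \<delta> j" for C \<delta>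
  proof (intro equalityI subsetI)
    fix x assume x: "x \<in> corner n v J C \<delta>"
    obtain y where y: "x = h y" using hsurj by auto
    define z where "z = (\<chi> l. (y - s C) $ l / (if l \<in> L then \<delta> (e l) else 1))"
    have "str \<delta> z = y - s C"
      unfolding str_def z_def using \<delta> eJ(1) by (auto simp: vec_eq_iff) (metis less_irrefl)
    then have y': "y = str \<delta> z + s C" by simp
    then have "z \<in> Z C \<delta>" using key[where \<delta>=\<delta>, OF \<delta>] x unfolding y by simp
    then show "x \<in> h ` ((\<lambda>y. s C + y) ` (str \<delta> ` Z C \<delta>))" unfolding y y' by (auto simp: add.commute)
  next
    fix x assume "x \<in> h ` ((\<lambda>y. s C + y) ` (str \<delta> ` Z C \<delta>))"
    then obtain z where "z \<in> Z C \<delta>" "x = h (str \<delta> z + s C)" by (auto simp: add.commute)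
    then show "x \<in> corner n v J C \<delta>" using key[where \<delta>=\<delta>, OF \<delta>] by simp
  qed
  define R' where "R' = real CARD('d) * (R / \<beta> + 1)"
  have Zbd: "Z C \<delta> \<subseteq> cball 0 R'" if \<delta>: "\<And>j. j \<in> J \<Longrightarrow> 0 < \<delta> j" and X: "corner n v J C \<delta> \<subseteq> X" for C \<delta>
  proof
    fix z assume z: "z \<in> Z C \<delta>"
    define y where "y = str \<delta> z + s C"
    have "h y \<in> X" using key[where \<delta>=\<delta>, OF \<delta>] z X unfolding y_def by blast
    then have "\<beta> * norm y \<le> R" using \<beta>(2)[of y] R(1) by (meson order_trans)
    then have ny: "norm y \<le> R / \<beta>" using \<beta>(1) by (simp add: field_simps)
    have "\<bar>z $ l\<bar> \<le> R / \<beta> + 1" for l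
    proof (cases "l \<in> L")
      case True
      then have "-1 \<le> z $ l" "z $ l \<le> 0" using z eJ[OF True] unfolding Z_def B_def by auto
      then show ?thesis using R(2) \<beta>(1) by (smt (verit) divide_pos_pos)
    next
      case False
      then have "z $ l = y $ l" unfolding y_def str_def s_def by simp
      then show ?thesis using component_le_norm_cart[of y l] ny by linarith
    qed
    then have "(\<Sum>l\<in>UNIV. \<bar>z $ l\<bar>) \<le> (\<Sum>l\<in>(UNIV::'d set). R / \<beta> + 1)" by (intro sum_mono) auto
    then show "z \<in> cball 0 R'" using norm_le_l1_cart[of z] unfolding R'_def by (simp add: dist_norm)
  qed
  have Zcl: "closed (Z C \<delta>)" for C \<delta>
  proof -
    have "Z C \<delta> = B \<inter> (\<Inter>k\<in>I. {y. y \<bullet> Q \<delta> k \<le> G C k})" unfolding Z_def by auto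
    moreover have "closed \<dots>"
      by (intro closed_Int closed_INT Bclosed ballI closed_Collect_le continuous_intros)
    ultimately show ?thesis by simp
  qed
  have meas: "measure lebesgue (corner n v J C \<delta>) = \<kappa> * ((\<Prod>j\<in>J. \<delta> j) * measure lebesgue (Z C \<delta>))"
    if \<delta>: "\<And>j. j \<in> J \<Longrightarrow> 0 < \<delta> j" and X: "corner n v J C \<delta> \<subseteq> X" for C \<delta>
  proof -
    have Zm: "Z C \<delta> \<in> lmeasurable"
      using Zcl Zbd[where \<delta>=\<delta>, OF \<delta> X] by (intro lmeasurable_compact) (auto simp: compact_eq_bounded_closed intro: bounded_subset[OF bounded_cball])
    have str: "str \<delta> = (\<lambda>x. \<chi> k. (if k \<in> L then \<delta> (e k) else 1) * x $ k)"
      unfolding str_def by auto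
    have P: "(\<Prod>k\<in>UNIV. if k \<in> L then \<delta> (e k) else 1) = (\<Prod>j\<in>J. \<delta> j)"
    proof -
      have "(\<Prod>k\<in>UNIV. if k \<in> L then \<delta> (e k) else 1) = (\<Prod>l\<in>L. \<delta> (e l))" by (simp add: prod.If_cases)
      also have "\<dots> = (\<Prod>j\<in>J. \<delta> j)" unfolding L_def by (subst prod.reindex[OF injii]) (simp add: e)
      finally show ?thesis .
    qed
    have sm: "str \<delta> ` Z C \<delta> \<in> lmeasurable"
      "measure lebesgue (str \<delta> ` Z C \<delta>) = (\<Prod>j\<in>J. \<delta> j) * measure lebesgue (Z C \<delta>)"
      unfolding str using measurable_stretch[OF Zm] measure_stretch[OF Zm] P prod_pos[of J \<delta>] \<delta>
      by (auto simp: abs_of_pos)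
    have tm: "(\<lambda>y. s C + y) ` (str \<delta> ` Z C \<delta>) \<in> lmeasurable"
      using sm(1) by (rule measurable_translation)
    have "corner n v J C \<delta> = h ` ((\<lambda>y. s C + y) ` (str \<delta> ` Z C \<delta>))"
      by (rule img) (rule \<delta>)
    then have "measure lebesgue (corner n v J C \<delta>) = \<kappa> * measure lebesgue ((\<lambda>y. s C + y) ` (str \<delta> ` Z C \<delta>))"
      using meas_h[OF tm] by metis
    also have "\<dots> = \<kappa> * measure lebesgue (str \<delta> ` Z C \<delta>)" unfolding measure_translation ..
    finally show ?thesis unfolding sm(2) .
  qed
  let ?Z0 = "{z\<in>B. \<forall>k\<in>I. z \<bullet> Q (\<lambda>_. 0) k \<le> G c k}"
  \<comment> \<open>A vanishing \<open>Q\<close> puts \<open>v k\<close> into the span of the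
    \<open>v j\<close> and provides the coefficients; a vanishing \<open>G\<close> then says that k
    is tight on the face. \<open>nondeg\<close> excludes exactly this.\<close>
  have nd: "Q (\<lambda>_. 0) k \<noteq> 0 \<or> G c k \<noteq> 0" if k: "k \<in> I" for k
  proof (rule ccontr)
    assume "\<not> ?thesis"
    then have 0: "Q (\<lambda>_. 0) k = 0" "G c k = 0" by auto
    have off: "u k $ l = 0" if "l \<notin> L" for l
      using arg_cong[OF 0(1), of "\<lambda>w. w $ l"] that unfolding Q_def by simp
    have "u k = (\<Sum>j\<in>J. u k $ ii j *\<^sub>R u j)"
    proof (rule vec_eq_iff[THEN iffD2], rule allI)
      fix l
      have "(\<Sum>j\<in>J. u k $ ii j *\<^sub>R u j) $ l = (\<Sum>j\<in>J. if ii j = l then u k $ l else 0)"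
        unfolding sum_component by (intro sum.cong) (auto simp: uJ axis_def)
      also have "\<dots> = u k $ l"
      proof (cases "l \<in> L")
        case True
        have "(\<Sum>j\<in>J. if ii j = l then u k $ l else 0) = (\<Sum>j\<in>J. if j = e l then u k $ l else 0)"
          using eJ[OF True] e by (intro sum.cong) auto
        then show ?thesis using eJ[OF True] finJ by simp
      next
        case False
        then have "(\<Sum>j\<in>J. if ii j = l then u k $ l else 0) = 0"
          by (intro sum.neutral) (auto simp: off)
        then show ?thesis using off[OF False] by simp
      qed
      finally show "u k $ l = (\<Sum>j\<in>J. u k $ ii j *\<^sub>R u j) $ l" by simp
    qed
    then have "g (v k) = g (\<Sum>j\<in>J. u k $ ii j *\<^sub>R v j)"
      unfolding u_def by (simp add: linear_sum[OF g(1)] linear_cmul[OF g(1)])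
    then have "v k = (\<Sum>j\<in>J. u k $ ii j *\<^sub>R v j)" using g(2) by (simp add: inj_def)
    then have "c k \<noteq> (\<Sum>j\<in>J. u k $ ii j * c j)"
      using nondeg[of k "\<lambda>j. u k $ ii j"] k unfolding I_def by simp
    then show False using 0(2) unfolding G_def by (simp add: mult.commute)
  qed
  define b where "b = \<kappa> * measure lebesgue ?Z0"
  have lim: "(\<lambda>m. measure lebesgue (corner n v J (C m) (\<delta> m)) / (\<Prod>j\<in>J. \<delta> m j)) \<longlonglongrightarrow> b \<and> ?Z0 \<in> lmeasurable"
    if C: "\<And>k. k \<in> {1..n} \<Longrightarrow> (\<lambda>m. C m k) \<longlonglongrightarrow> c k" and \<delta>: "\<And>j. j \<in> J \<Longrightarrow> (\<lambda>m. \<delta> m j) \<longlonglongrightarrow> 0"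
      and pos: "\<And>m j. j \<in> J \<Longrightarrow> 0 < \<delta> m j" and X: "\<And>m. corner n v J (C m) (\<delta> m) \<subseteq> X" for C \<delta>
  proof -
    have q: "(\<lambda>m. Q (\<delta> m) k) \<longlonglongrightarrow> Q (\<lambda>_. 0) k" for k
    proof (rule vec_tendstoI)
      fix l show "(\<lambda>m. Q (\<delta> m) k $ l) \<longlonglongrightarrow> Q (\<lambda>_. 0) k $ l"
        using \<delta> eJ(1) unfolding Q_def by (cases "l \<in> L") (auto intro!: tendsto_mult_left_zero)
    qed
    have G: "(\<lambda>m. G (C m) k) \<longlonglongrightarrow> G c k" if "k \<in> I" for k
      unfolding G_def using that C J unfolding I_def by (intro tendsto_intros) auto
    have bd: "{z\<in>B. \<forall>k\<in>I. z \<bullet> Q (\<delta> m) k \<le> G (C m) k} \<subseteq> cball 0 R'" for m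
      using Zbd[where \<delta>="\<delta> m" and C="C m", OF pos X] unfolding Z_def .
    note T = halfspaces_measure_tendsto[of I B "\<lambda>m. Q (\<delta> m)" "Q (\<lambda>_. 0)" "\<lambda>m. G (C m)" "G c", OF finI Bclosed q G nd bd]
    have "(\<lambda>m. \<kappa> * measure lebesgue (Z (C m) (\<delta> m))) \<longlonglongrightarrow> b"
      unfolding b_def Z_def by (intro tendsto_mult_left T(1))
    moreover have "measure lebesgue (corner n v J (C m) (\<delta> m)) / (\<Prod>j\<in>J. \<delta> m j) = \<kappa> * measure lebesgue (Z (C m) (\<delta> m))" for m
      using meas[where \<delta>="\<delta> m" and C="C m", OF pos X] prod_pos[of J "\<delta> m"] pos by simp
    ultimately show ?thesis using T(2) by simp
  qed
  show ?thesis
  proof (rule that[of b])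
    show "(\<lambda>m. measure lebesgue (corner n v J (C m) (\<delta> m)) / (\<Prod>j\<in>J. \<delta> m j)) \<longlonglongrightarrow> b"
      if "\<And>k. k \<in> {1..n} \<Longrightarrow> (\<lambda>m. C m k) \<longlonglongrightarrow> c k" "\<And>j. j \<in> J \<Longrightarrow> (\<lambda>m. \<delta> m j) \<longlonglongrightarrow> 0"
      "\<And>m j. j \<in> J \<Longrightarrow> 0 < \<delta> m j" "\<And>m. corner n v J (C m) (\<delta> m) \<subseteq> X" for C \<delta>
      using lim[of C \<delta>] that by blast
  next
    assume "b \<noteq> 0"
    then have nz: "measure lebesgue ?Z0 \<noteq> 0" unfolding b_def by simp
    \<comment> \<open>A set of nonzero volume is not covered by these hyperplanes, and a point
      outside them satisfies all remaining constraints strictly.\<close>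
    define N where "N = (\<Union>k\<in>{k\<in>I. Q (\<lambda>_. 0) k \<noteq> 0}. {y. Q (\<lambda>_. 0) k \<bullet> y = G c k})"
    have "negligible N" unfolding N_def
      by (intro negligible_Union finite_imageI) (use finI negligible_hyperplane in auto)
    then have "\<not> ?Z0 \<subseteq> N" using nz negligible_subset negligible_imp_measure0 by blast
    then obtain z where z: "z \<in> ?Z0" "z \<notin> N" by blast
    have zlt: "z \<bullet> Q (\<lambda>_. 0) k < G c k" if k: "k \<in> I" for k
    proof (cases "Q (\<lambda>_. 0) k = 0")
      case True
      then show ?thesis using nd[OF k] z(1) k by fastforce
    next
      case False
      then have "z \<bullet> Q (\<lambda>_. 0) k \<noteq> G c k" using z(2) k unfolding N_def by (auto simp: inner_commute)
      then show ?thesis using z(1) k by fastforce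
    qed
    let ?y = "str (\<lambda>_. 0) z + s c"
    show "\<exists>z. (\<forall>j\<in>J. z \<bullet> v j = c j) \<and> (\<forall>k\<in>{1..n}-J. z \<bullet> v k < c k)"
    proof (intro exI[of _ "h ?y"] conjI ballI)
      fix j assume j: "j \<in> J"
      then show "h ?y \<bullet> v j = c j" unfolding hg
        using iiL[OF j] e[OF j] by (simp add: uJ[OF j] inner_axis str_def s_def)
    next
      fix k assume "k \<in> {1..n} - J"
      then have "k \<in> I" unfolding I_def .
      from zlt[OF this] show "h ?y \<bullet> v k < c k"
        unfolding hg inner_add_left s_in str_in by (simp add: Q_def G_def)
    qed
  next
    fix z C0 \<delta>0
    assume z: "\<And>j. j \<in> J \<Longrightarrow> z \<bullet> v j = c j" "\<And>k. k \<in> {1..n}-J \<Longrightarrow> z \<bullet> v k < c k"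
      and seq: "\<And>k. k \<in> {1..n} \<Longrightarrow> (\<lambda>m. C0 m k) \<longlonglongrightarrow> c k" "\<And>j. j \<in> J \<Longrightarrow> (\<lambda>m. \<delta>0 m j) \<longlonglongrightarrow> 0"
        "\<And>m j. j \<in> J \<Longrightarrow> 0 < \<delta>0 m j" "\<And>m. corner n v J (C0 m) (\<delta>0 m) \<subseteq> X"
    obtain y where y: "z = h y" using hsurj by auto
    \<comment> \<open>With zero widths \<open>str\<close> ignores the coordinates in
      \<open>L\<close>, so they can be moved to the centre of the cube, where the bounds of
      \<open>B\<close> are strict.\<close>
    define w where "w = (\<chi> l. if l \<in> L then -1/2 else y $ l)"
    have yc: "y $ ii j = c j" if "j \<in> J" for j
      using z(1)[OF that] uJ[OF that] unfolding y hg by (simp add: inner_axis)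
    have "str (\<lambda>_. 0) w + s c = y"
      using yc eJ unfolding str_def s_def w_def by (auto simp: vec_eq_iff) metis
    then have wk: "w \<bullet> Q (\<lambda>_. 0) k < G c k" if k: "k \<in> I" for k
    proof -
      have "(str (\<lambda>_. 0) w + s c) \<bullet> u k < c k"
        using z(2) k unfolding I_def \<open>str (\<lambda>_. 0) w + s c = y\<close> y hg by blast
      then show ?thesis unfolding inner_add_left s_in str_in by (simp add: Q_def G_def)
    qed
    let ?O = "(\<Inter>j\<in>J. {z. -1 < z $ ii j} \<inter> {z. z $ ii j < 0}) \<inter> (\<Inter>k\<in>I. {y. y \<bullet> Q (\<lambda>_. 0) k < G c k})"
    have O: "open ?O"
      by (intro open_Int open_INT finJ finI ballI open_Collect_less continuous_intros)
    have "w \<in> ?O" using wk iiL by (auto simp: w_def)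
    then have "\<not> negligible ?O" using open_not_negligible[OF O] by blast
    moreover have "?O \<subseteq> ?Z0" unfolding B_def by (auto intro: less_imp_le)
    ultimately have "\<not> negligible ?Z0" using negligible_subset by blast
    \<comment> \<open>Finite measure of the limit set comes from the limit along one admissible
      sequence, which is why the third claim asks for \<open>C0\<close> and
      \<open>\<delta>0\<close>.\<close>
    moreover have "?Z0 \<in> lmeasurable" using lim[of C0 \<delta>0] seq by blast
    ultimately have "measure lebesgue ?Z0 \<noteq> 0"
      using negligible_iff_measure by blast
    then show "b > 0" unfolding b_def using \<kappa> by (simp add: zero_less_measure_iff)
  qed
qed

section \<open>Strict partial derivatives\<close>

definition near :: "nat \<Rightarrow> (nat \<Rightarrow> real) \<Rightarrow> real \<Rightarrow> (nat \<Rightarrow> real) \<Rightarrow> bool" where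
  "near n c r c' \<longleftrightarrow> (\<forall>k\<in>{1..n}. \<bar>c' k - c k\<bar> < r)"

text \<open>The base point of the difference quotient varies as well. For such derivatives the partial ones
  already add up to a total derivative, without assuming differentiability in a neighborhood.\<close>

definition has_strict_partial ::
    "nat \<Rightarrow> ((nat \<Rightarrow> real) \<Rightarrow> real) \<Rightarrow> (nat \<Rightarrow> real) \<Rightarrow> nat \<Rightarrow> real \<Rightarrow> bool" where
  "has_strict_partial n F c i D \<longleftrightarrow> (\<forall>\<eta>>0. \<exists>r>0. \<forall>c' h. near n c r c' \<longrightarrow> \<bar>h\<bar> < r \<longrightarrow>
      \<bar>F (c'(i := c' i + h)) - F c' - D * h\<bar> \<le> \<eta> * \<bar>h\<bar>)"

lemma near_mono: "near n c r c' \<Longrightarrow> r \<le> s \<Longrightarrow> near n c s c'"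
  unfolding near_def by fastforce

lemma near_refl: "r > 0 \<Longrightarrow> near n c r c"
  unfolding near_def by simp

lemma near_upd: "near n c r c' \<Longrightarrow> \<bar>h\<bar> < s \<Longrightarrow> near n c (r + s) (c'(i := c' i + h))"
  unfolding near_def by (smt (verit) fun_upd_apply)

lemma has_strict_partialD:
  assumes "has_strict_partial n F c i D" "\<eta> > 0"
  obtains r where "r > 0"
    "\<And>c' h. near n c r c' \<Longrightarrow> \<bar>h\<bar> < r \<Longrightarrow> \<bar>F (c'(i := c' i + h)) - F c' - D * h\<bar> \<le> \<eta> * \<bar>h\<bar>"
  using assms unfolding has_strict_partial_def by blast

lemma has_strict_partial_imp_DERIV:
  assumes "has_strict_partial n F c i D"
  shows "((\<lambda>t. F (c(i := t))) has_real_derivative D) (at (c i))"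
  unfolding has_field_derivative_iff LIM_def
proof (intro allI impI)
  fix e :: real assume e: "e > 0"
  then have "e / 2 > 0" by simp
  from has_strict_partialD[OF assms this] obtain r where r: "r > 0"
    "\<And>c' h. near n c r c' \<Longrightarrow> \<bar>h\<bar> < r \<Longrightarrow> \<bar>F (c'(i := c' i + h)) - F c' - D * h\<bar> \<le> e / 2 * \<bar>h\<bar>"
    by metis
  show "\<exists>s>0. \<forall>x. x \<noteq> c i \<and> dist x (c i) < s \<longrightarrow> dist ((F (c(i := x)) - F (c(i := c i))) / (x - c i)) D < e"
  proof (intro exI[of _ r] conjI allI impI r(1))
    fix x assume x: "x \<noteq> c i \<and> dist x (c i) < r"
    define h where "h = x - c i"
    have h: "h \<noteq> 0" "\<bar>h\<bar> < r" "x = c i + h" using x unfolding h_def dist_real_def by auto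
    have "\<bar>F (c(i := c i + h)) - F c - D * h\<bar> \<le> e / 2 * \<bar>h\<bar>"
      using r(2)[OF near_refl[OF r(1)] h(2)] .
    moreover have "(F (c(i := c i + h)) - F c) / h - D = (F (c(i := c i + h)) - F c - D * h) / h"
      using h(1) by (simp add: field_simps)
    ultimately have "\<bar>(F (c(i := c i + h)) - F c) / h - D\<bar> \<le> e / 2"
      using h(1) by (simp add: abs_divide divide_le_eq)
    then show "dist ((F (c(i := x)) - F (c(i := c i))) / (x - c i)) D < e"
      using e unfolding h(3) dist_real_def by simp
  qed
qed

lemma has_strict_partial_imp_partial_deriv:
  "has_strict_partial n F c i D \<Longrightarrow> partial_deriv i F c = D"
  unfolding partial_deriv_def by (intro DERIV_imp_deriv has_strict_partial_imp_DERIV)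

text \<open>Strict derivatives are continuous where they exist: one sufficiently small increment at
  \<open>c'\<close> is compared with both \<open>D\<close> and \<open>D'\<close>.\<close>

lemma has_strict_partial_near:
  assumes D: "has_strict_partial n F c i D" and e: "\<eta> > 0"
  obtains r where "r > 0" "\<And>c' D'. near n c r c' \<Longrightarrow> has_strict_partial n F c' i D' \<Longrightarrow> \<bar>D' - D\<bar> \<le> \<eta>"
proof -
  have "\<eta> / 2 > 0" using e by simp
  from has_strict_partialD[OF D this] obtain r where r: "r > 0"
    "\<And>c' h. near n c r c' \<Longrightarrow> \<bar>h\<bar> < r \<Longrightarrow> \<bar>F (c'(i := c' i + h)) - F c' - D * h\<bar> \<le> \<eta> / 2 * \<bar>h\<bar>"
    by metis
  show ?thesis
  proof (rule that[OF r(1)])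
    fix c' D' assume c': "near n c r c'" and D': "has_strict_partial n F c' i D'"
    have "\<eta> / 2 > 0" using e by simp
    from has_strict_partialD[OF D' this] obtain s where s: "s > 0"
      "\<And>c'' h. near n c' s c'' \<Longrightarrow> \<bar>h\<bar> < s \<Longrightarrow> \<bar>F (c''(i := c'' i + h)) - F c'' - D' * h\<bar> \<le> \<eta> / 2 * \<bar>h\<bar>"
      by metis
    define h where "h = min r s / 2"
    have h: "h > 0" "\<bar>h\<bar> < r" "\<bar>h\<bar> < s" using r(1) s(1) unfolding h_def by auto
    have "\<bar>F (c'(i := c' i + h)) - F c' - D * h\<bar> \<le> \<eta> / 2 * h"
      using r(2)[OF c' h(2)] h(1) by simp
    moreover have "\<bar>F (c'(i := c' i + h)) - F c' - D' * h\<bar> \<le> \<eta> / 2 * h"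
      using s(2)[OF near_refl[OF s(1)] h(3)] h(1) by simp
    moreover have "(D' - D) * h = (F (c'(i := c' i + h)) - F c' - D * h) - (F (c'(i := c' i + h)) - F c' - D' * h)"
      by (simp add: algebra_simps)
    ultimately have "\<bar>(D' - D) * h\<bar> \<le> \<eta> / 2 * h + \<eta> / 2 * h" by linarith
    then have "\<bar>D' - D\<bar> * h \<le> \<eta> * h" using h(1) by (simp add: abs_mult)
    then show "\<bar>D' - D\<bar> \<le> \<eta>" using h(1) by simp
  qed
qed

text \<open>The coordinates change one at a time. Each intermediate point is again an admissible
  base point, which is where strictness enters.\<close>

lemma has_strict_partial_total:
  assumes S: "finite S" and D: "\<And>k. k \<in> S \<Longrightarrow> has_strict_partial n F c k (D k)" and e: "\<eta> > 0"
  obtains r where "r > 0" "\<And>c' g. near n c r c' \<Longrightarrow> (\<And>k. k \<notin> S \<Longrightarrow> g k = 0) \<Longrightarrow> (\<And>k. k \<in> S \<Longrightarrow> \<bar>g k\<bar> < r) \<Longrightarrow>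
     \<bar>F (\<lambda>k. c' k + g k) - F c' - (\<Sum>k\<in>S. D k * g k)\<bar> \<le> \<eta> * (\<Sum>k\<in>S. \<bar>g k\<bar>)"
  using S D
proof (induction S arbitrary: thesis rule: finite_induct)
  case empty
  show ?case by (rule empty(1)[of 1]) (simp_all add: fun_eq_iff)
next
  case (insert i S)
  obtain r where r: "r > 0" "\<And>c' g. near n c r c' \<Longrightarrow> (\<And>k. k \<notin> S \<Longrightarrow> g k = 0) \<Longrightarrow> (\<And>k. k \<in> S \<Longrightarrow> \<bar>g k\<bar> < r) \<Longrightarrow>
     \<bar>F (\<lambda>k. c' k + g k) - F c' - (\<Sum>k\<in>S. D k * g k)\<bar> \<le> \<eta> * (\<Sum>k\<in>S. \<bar>g k\<bar>)"
    using insert.IH insert.prems(2) by blast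
  obtain s where s: "s > 0"
    "\<And>c' h. near n c s c' \<Longrightarrow> \<bar>h\<bar> < s \<Longrightarrow> \<bar>F (c'(i := c' i + h)) - F c' - D i * h\<bar> \<le> \<eta> * \<bar>h\<bar>"
    using has_strict_partialD[OF insert.prems(2)[OF insertI1] e] by metis
  \<comment> \<open>Half, so that the base point is still close enough to \<open>c\<close> after the
    step in coordinate \<open>i\<close>.\<close>
  define q where "q = min r s / 2"
  have q: "q > 0" "q + q \<le> r" "q + q \<le> s" using r(1) s(1) unfolding q_def by auto
  show ?case
  proof (rule insert.prems(1)[OF q(1)])
    fix c' g assume c': "near n c q c'" and g: "\<And>k. k \<notin> insert i S \<Longrightarrow> g k = 0" "\<And>k. k \<in> insert i S \<Longrightarrow> \<bar>g k\<bar> < q"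
    let ?g = "g(i := 0)" and ?c = "c'(i := c' i + g i)"
    have n1: "near n c r ?c" using near_mono[OF near_upd[OF c'] q(2)] g(2) by auto
    have n2: "near n c s c'" using near_mono[OF c', of s] q by auto
    have "\<bar>F (\<lambda>k. ?c k + ?g k) - F ?c - (\<Sum>k\<in>S. D k * ?g k)\<bar> \<le> \<eta> * (\<Sum>k\<in>S. \<bar>?g k\<bar>)"
    proof (rule r(2)[OF n1])
      show "?g k = 0" if "k \<notin> S" for k using g(1) that by auto
      show "\<bar>?g k\<bar> < r" if "k \<in> S" for k using g(2)[of k] that q r(1) by auto
    qed
    moreover have "(\<lambda>k. ?c k + ?g k) = (\<lambda>k. c' k + g k)" by auto
    moreover have "(\<Sum>k\<in>S. D k * ?g k) = (\<Sum>k\<in>S. D k * g k)" "(\<Sum>k\<in>S. \<bar>?g k\<bar>) = (\<Sum>k\<in>S. \<bar>g k\<bar>)"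
      using insert.hyps by (auto intro!: sum.cong)
    ultimately have "\<bar>F (\<lambda>k. c' k + g k) - F ?c - (\<Sum>k\<in>S. D k * g k)\<bar> \<le> \<eta> * (\<Sum>k\<in>S. \<bar>g k\<bar>)" by simp
    moreover have "\<bar>F ?c - F c' - D i * g i\<bar> \<le> \<eta> * \<bar>g i\<bar>"
      using s(2)[OF n2, of "g i"] g(2)[of i] q by auto
    ultimately show "\<bar>F (\<lambda>k. c' k + g k) - F c' - (\<Sum>k\<in>insert i S. D k * g k)\<bar> \<le> \<eta> * (\<Sum>k\<in>insert i S. \<bar>g k\<bar>)"
      using insert.hyps by (simp add: algebra_simps)
  qed
qed

lemma has_strict_partial_total_ex:
  assumes S: "finite S" and D: "\<And>k. k \<in> S \<Longrightarrow> has_strict_partial n F c k (D k)" and e: "\<eta> > 0"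
  shows "\<exists>r>0. \<forall>c' g. near n c r c' \<longrightarrow> (\<forall>k. k \<notin> S \<longrightarrow> g k = 0) \<longrightarrow> (\<forall>k\<in>S. \<bar>g k\<bar> < r) \<longrightarrow>
     \<bar>F (\<lambda>k. c' k + g k) - F c' - (\<Sum>k\<in>S. D k * g k)\<bar> \<le> \<eta> * (\<Sum>k\<in>S. \<bar>g k\<bar>)"
proof (rule has_strict_partial_total[OF S D e], assumption)
  fix r :: real assume "r > 0" and *: "\<And>c' g. near n c r c' \<Longrightarrow> (\<And>k. k \<notin> S \<Longrightarrow> g k = 0) \<Longrightarrow> (\<And>k. k \<in> S \<Longrightarrow> \<bar>g k\<bar> < r) \<Longrightarrow>
     \<bar>F (\<lambda>k. c' k + g k) - F c' - (\<Sum>k\<in>S. D k * g k)\<bar> \<le> \<eta> * (\<Sum>k\<in>S. \<bar>g k\<bar>)"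
  then show ?thesis by (intro exI[of _ r] conjI allI impI) auto
qed

section \<open>The Izmestiev matrix as a Hessian\<close>

text \<open>What the analysis uses of the vertices of a polytope around 0. By \<open>exposed\<close>
  every inequality of the polar is tight on a facet. \<open>inradius\<close> is a lower bound on the
  support function: the hull of the \<open>v k\<close> contains a ball around 0, so the polar is
  bounded.\<close>

locale exposed_configuration =
  fixes n :: nat and v :: "nat \<Rightarrow> real^'d"
  assumes exposed: "i \<in> {1..n} \<Longrightarrow> \<exists>z. z \<bullet> v i = 1 \<and> (\<forall>k\<in>{1..n}-{i}. z \<bullet> v k < 1)"
    and inradius: "\<exists>\<rho>>0. \<forall>x. \<exists>k\<in>{1..n}. \<rho> * norm x \<le> x \<bullet> v k"
begin

definition V :: "(nat \<Rightarrow> real) \<Rightarrow> real" where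
  "V c = measure lebesgue (generalized_polar n v c)"

text \<open>The \<open>i\<close>-th inequality of the polar with right-hand sides \<open>c\<close> is tight on a facet.\<close>

definition has_facet :: "nat \<Rightarrow> (nat \<Rightarrow> real) \<Rightarrow> bool" where
  "has_facet i c \<longleftrightarrow> (\<exists>z. z \<bullet> v i = c i \<and> (\<forall>k\<in>{1..n}-{i}. z \<bullet> v k < c k))"

text \<open>Dual to an edge: the i-th and j-th facets of the polar share a point at which no other
  constraint is tight. Equivalently, \<open>z\<close> supports the hull of the vertices in
  \<open>v i\<close> and \<open>v j\<close> only.\<close>

definition adj :: "nat \<Rightarrow> nat \<Rightarrow> bool" where
  "adj i j \<longleftrightarrow> (\<exists>z. z \<bullet> v i = 1 \<and> z \<bullet> v j = 1 \<and> (\<forall>k\<in>{1..n}-{i,j}. z \<bullet> v k < 1))"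

lemma v_nonzero: "i \<in> {1..n} \<Longrightarrow> v i \<noteq> 0"
  using exposed by fastforce

lemma inj_v: "inj_on v {1..n}"
proof (rule inj_onI)
  fix i j assume ij: "i \<in> {1..n}" "j \<in> {1..n}" "v i = v j"
  show "i = j" using exposed[OF ij(1)] ij by (metis DiffI less_irrefl singletonD)
qed

lemma polar_bounded:
  obtains R where "R \<ge> 0" "\<And>c t. t \<ge> 0 \<Longrightarrow> (\<And>k. k \<in> {1..n} \<Longrightarrow> c k \<le> t) \<Longrightarrow> generalized_polar n v c \<subseteq> cball 0 (R * t)"
proof -
  obtain \<rho> where \<rho>: "\<rho> > 0" "\<And>x. \<exists>k\<in>{1..n}. \<rho> * norm x \<le> x \<bullet> v k" using inradius by blast
  show ?thesis
  proof (rule that[of "1 / \<rho>"])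
    fix c and t :: real assume t: "t \<ge> 0" "\<And>k. k \<in> {1..n} \<Longrightarrow> c k \<le> t"
    show "generalized_polar n v c \<subseteq> cball 0 (1 / \<rho> * t)"
    proof
      fix x assume x: "x \<in> generalized_polar n v c"
      obtain k where k: "k \<in> {1..n}" "\<rho> * norm x \<le> x \<bullet> v k" using \<rho>(2) by blast
      then have "\<rho> * norm x \<le> t" using x t(2)[OF k(1)] unfolding generalized_polar_def by fastforce
      then show "x \<in> cball 0 (1 / \<rho> * t)" using \<rho>(1) by (simp add: field_simps)
    qed
  qed (use \<rho> in simp)
qed

lemma bounded_polar: "bounded (generalized_polar n v c)"
proof -
  obtain R where R: "R \<ge> 0" "\<And>c t. t \<ge> 0 \<Longrightarrow> (\<And>k. k \<in> {1..n} \<Longrightarrow> c k \<le> t) \<Longrightarrow> generalized_polar n v c \<subseteq> cball 0 (R * t)"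
    using polar_bounded by blast
  have "generalized_polar n v c \<subseteq> cball 0 (R * (\<Sum>k\<in>{1..n}. \<bar>c k\<bar>))"
  proof (rule R(2))
    fix k assume k: "k \<in> {1..n}"
    show "c k \<le> (\<Sum>k\<in>{1..n}. \<bar>c k\<bar>)" using member_le_sum[OF k, of "\<lambda>k. \<bar>c k\<bar>"] by force
  qed (simp add: sum_nonneg)
  then show ?thesis by (rule bounded_subset[OF bounded_cball])
qed

lemma closed_polar: "closed (generalized_polar n v c)"
proof -
  have "generalized_polar n v c = (\<Inter>k\<in>{1..n}. {x. x \<bullet> v k \<le> c k})"
    unfolding generalized_polar_def by auto
  then show ?thesis by (simp, intro closed_INT ballI closed_Collect_le continuous_intros)
qed

lemma convex_polar: "convex (generalized_polar n v c)"
proof -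
  have "generalized_polar n v c = (\<Inter>k\<in>{1..n}. {x. v k \<bullet> x \<le> c k})"
    unfolding generalized_polar_def by (auto simp: inner_commute)
  then show ?thesis by (simp, intro convex_INT ballI convex_halfspace_le)
qed

lemma polar_lmeasurable: "generalized_polar n v c \<in> lmeasurable"
  using closed_polar bounded_polar by (intro lmeasurable_compact) (simp add: compact_eq_bounded_closed)

section \<open>Corner volumes as finite differences of the volume\<close>

lemma corner_subset: "corner n v J c \<delta> \<subseteq> generalized_polar n v c"
  unfolding corner_def by auto

lemma closed_corner: "closed (corner n v J c \<delta>)"
proof -
  have "corner n v J c \<delta> = generalized_polar n v c \<inter> (\<Inter>j\<in>J. {x. c j - \<delta> j \<le> x \<bullet> v j})"
    unfolding corner_def by auto
  moreover have "closed \<dots>"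
    by (intro closed_Int closed_polar closed_INT ballI closed_Collect_le continuous_intros)
  ultimately show ?thesis by simp
qed

lemma convex_corner: "convex (corner n v J c \<delta>)"
proof -
  have "corner n v J c \<delta> = generalized_polar n v c \<inter> (\<Inter>j\<in>J. {x. v j \<bullet> x \<ge> c j - \<delta> j})"
    unfolding corner_def by (auto simp: inner_commute)
  moreover have "convex \<dots>"
    by (intro convex_Int convex_polar convex_INT ballI convex_halfspace_ge)
  ultimately show ?thesis by simp
qed

lemma bounded_corner: "bounded (corner n v J c \<delta>)"
  using bounded_polar corner_subset by (rule bounded_subset)

lemma corner_lmeasurable: "corner n v J c \<delta> \<in> lmeasurable"
  using closed_corner bounded_corner by (intro lmeasurable_compact) (simp add: compact_eq_bounded_closed)

lemma V_cong: "(\<And>k. k \<in> {1..n} \<Longrightarrow> c k = c' k) \<Longrightarrow> V c = V c'"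
  unfolding V_def generalized_polar_def by simp

lemma V_nonneg: "V c \<ge> 0" unfolding V_def by simp

lemma corner1_measure:
  assumes j: "j \<in> {1..n}" and d: "\<delta> j \<ge> 0"
  shows "measure lebesgue (corner n v {j} c \<delta>) = V c - V (c(j := c j - \<delta> j))"
proof -
  have "generalized_polar n v c \<inter> {x. x \<bullet> v j \<le> c j - \<delta> j} = generalized_polar n v (c(j := c j - \<delta> j))"
    unfolding generalized_polar_def using j d by (fastforce split: if_splits)
  moreover have "generalized_polar n v c \<inter> {x. x \<bullet> v j \<ge> c j - \<delta> j} = corner n v {j} c \<delta>"
    unfolding corner_def by auto
  ultimately show ?thesis
    using measure_split_hyperplane[OF polar_lmeasurable v_nonzero[OF j], of c "c j - \<delta> j"]
    unfolding V_def by simp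
qed

lemma corner2_measure:
  assumes ij: "i \<in> {1..n}" "j \<in> {1..n}" "i \<noteq> j" and d: "\<delta> i \<ge> 0" "\<delta> j \<ge> 0"
  shows "measure lebesgue (corner n v {i,j} c \<delta>) =
    (V c - V (c(j := c j - \<delta> j))) - (V (c(i := c i - \<delta> i)) - V (c(i := c i - \<delta> i, j := c j - \<delta> j)))"
proof -
  have "corner n v {j} c \<delta> \<inter> {x. x \<bullet> v i \<le> c i - \<delta> i} = corner n v {j} (c(i := c i - \<delta> i)) \<delta>"
    unfolding generalized_polar_def corner_def using ij d by (fastforce split: if_splits)
  moreover have "corner n v {j} c \<delta> \<inter> {x. x \<bullet> v i \<ge> c i - \<delta> i} = corner n v {i,j} c \<delta>"
    unfolding corner_def by auto
  moreover have "measure lebesgue (corner n v {j} (c(i := c i - \<delta> i)) \<delta>) =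
      V (c(i := c i - \<delta> i)) - V (c(i := c i - \<delta> i, j := c j - \<delta> j))"
    using corner1_measure[where \<delta>=\<delta> and j=j and c="c(i := c i - \<delta> i)", OF ij(2) d(2)] ij(3) by simp
  moreover have "measure lebesgue (corner n v {j} c \<delta>) = V c - V (c(j := c j - \<delta> j))"
    by (rule corner1_measure) (rule ij(2), rule d(2))
  ultimately show ?thesis
    using measure_split_hyperplane[OF corner_lmeasurable v_nonzero[OF ij(1)], of "{j}" c \<delta> "c i - \<delta> i"]
    by simp
qed

text \<open>\<open>corner_measure_limit\<close> gives the same limit along all admissible sequences,
  so a failure of the uniform estimate would produce a sequence contradicting it.\<close>

lemma corner_measure_uniform:
  assumes J: "J \<subseteq> {1..n}" and ind: "independent (v ` J)"
    and nondeg: "\<And>k \<alpha>. k \<in> {1..n} - J \<Longrightarrow> v k = (\<Sum>j\<in>J. \<alpha> j *\<^sub>R v j) \<Longrightarrow> c k \<noteq> (\<Sum>j\<in>J. \<alpha> j * c j)"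
  obtains b where "\<And>\<eta>. \<eta> > 0 \<Longrightarrow> \<exists>r>0. \<forall>C \<delta>. near n c r C \<longrightarrow> (\<forall>j\<in>J. 0 < \<delta> j \<and> \<delta> j < r) \<longrightarrow>
        \<bar>measure lebesgue (corner n v J C \<delta>) - b * (\<Prod>j\<in>J. \<delta> j)\<bar> \<le> \<eta> * (\<Prod>j\<in>J. \<delta> j)"
    and "b \<noteq> 0 \<Longrightarrow> \<exists>z. (\<forall>j\<in>J. z \<bullet> v j = c j) \<and> (\<forall>k\<in>{1..n}-J. z \<bullet> v k < c k)"
    and "\<And>z. (\<And>j. j \<in> J \<Longrightarrow> z \<bullet> v j = c j) \<Longrightarrow> (\<And>k. k \<in> {1..n}-J \<Longrightarrow> z \<bullet> v k < c k) \<Longrightarrow> b > 0"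
proof -
  obtain R where R: "R \<ge> 0" "\<And>c t. t \<ge> 0 \<Longrightarrow> (\<And>k. k \<in> {1..n} \<Longrightarrow> c k \<le> t) \<Longrightarrow> generalized_polar n v c \<subseteq> cball 0 (R * t)"
    using polar_bounded by blast
  define t where "t = (\<Sum>k\<in>{1..n}. \<bar>c k\<bar>) + 1"
  define X where "X = cball (0::real^'d) (R * t)"
  have Xn: "corner n v J C \<delta> \<subseteq> X" if "near n c 1 C" for C \<delta>
  proof (rule order_trans[OF corner_subset], unfold X_def, rule R(2))
    show "t \<ge> 0" unfolding t_def by (simp add: sum_nonneg add_nonneg_nonneg)
    fix k assume k: "k \<in> {1..n}"
    have "\<bar>C k - c k\<bar> < 1" using that k unfolding near_def by blast
    moreover have "\<bar>c k\<bar> \<le> (\<Sum>k\<in>{1..n}. \<bar>c k\<bar>)" using member_le_sum[OF k, of "\<lambda>k. \<bar>c k\<bar>"] by force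
    ultimately show "C k \<le> t" unfolding t_def by linarith
  qed
  have inj: "inj_on v J" using inj_v J by (rule inj_on_subset)
  have seq0: "(\<lambda>m. 1 / (real m + 1)) \<longlonglongrightarrow> 0"
    using LIMSEQ_inverse_real_of_nat by (simp add: inverse_eq_divide add.commute)
  have bX: "bounded X" unfolding X_def by simp
  show ?thesis
  proof (rule corner_measure_limit[OF J ind inj nondeg bX], assumption, assumption)
   fix b
   assume b: "\<And>C \<delta>. (\<And>k. k \<in> {1..n} \<Longrightarrow> (\<lambda>m. C m k) \<longlonglongrightarrow> c k) \<Longrightarrow> (\<And>j. j \<in> J \<Longrightarrow> (\<lambda>m. \<delta> m j) \<longlonglongrightarrow> 0) \<Longrightarrow>
        (\<And>m j. j \<in> J \<Longrightarrow> 0 < \<delta> m j) \<Longrightarrow> (\<And>m. corner n v J (C m) (\<delta> m) \<subseteq> X) \<Longrightarrow>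
        (\<lambda>m. measure lebesgue (corner n v J (C m) (\<delta> m)) / (\<Prod>j\<in>J. \<delta> m j)) \<longlonglongrightarrow> b"
    and b1: "b \<noteq> 0 \<Longrightarrow> \<exists>z. (\<forall>j\<in>J. z \<bullet> v j = c j) \<and> (\<forall>k\<in>{1..n}-J. z \<bullet> v k < c k)"
    and b2: "\<And>z C0 \<delta>0. (\<And>j. j \<in> J \<Longrightarrow> z \<bullet> v j = c j) \<Longrightarrow> (\<And>k. k \<in> {1..n}-J \<Longrightarrow> z \<bullet> v k < c k) \<Longrightarrow>
        (\<And>k. k \<in> {1..n} \<Longrightarrow> (\<lambda>m. C0 m k) \<longlonglongrightarrow> c k) \<Longrightarrow> (\<And>j. j \<in> J \<Longrightarrow> (\<lambda>m. \<delta>0 m j) \<longlonglongrightarrow> 0) \<Longrightarrow>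
        (\<And>m j. j \<in> J \<Longrightarrow> 0 < \<delta>0 m j) \<Longrightarrow> (\<And>m. corner n v J (C0 m) (\<delta>0 m) \<subseteq> X) \<Longrightarrow> b > 0"
   show ?thesis
   proof (rule that[of b])
    fix \<eta> :: real assume \<eta>: "\<eta> > 0"
    show "\<exists>r>0. \<forall>C \<delta>. near n c r C \<longrightarrow> (\<forall>j\<in>J. 0 < \<delta> j \<and> \<delta> j < r) \<longrightarrow>
        \<bar>measure lebesgue (corner n v J C \<delta>) - b * (\<Prod>j\<in>J. \<delta> j)\<bar> \<le> \<eta> * (\<Prod>j\<in>J. \<delta> j)"
    proof (rule ccontr)
      assume neg: "\<not> ?thesis"
      have "\<exists>C \<delta>. near n c (1 / (real m + 1)) C \<and> (\<forall>j\<in>J. 0 < \<delta> j \<and> \<delta> j < 1 / (real m + 1)) \<and>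
          \<not> \<bar>measure lebesgue (corner n v J C \<delta>) - b * (\<Prod>j\<in>J. \<delta> j)\<bar> \<le> \<eta> * (\<Prod>j\<in>J. \<delta> j)" for m :: nat
        using neg[unfolded not_ex, rule_format, of "1 / (real m + 1)"] by auto
      then obtain C \<delta> where C: "\<And>m. near n c (1 / (real m + 1)) (C m)"
        and \<delta>: "\<And>m. \<forall>j\<in>J. 0 < \<delta> m j \<and> \<delta> m j < 1 / (real m + 1)"
        and bad: "\<And>m. \<not> \<bar>measure lebesgue (corner n v J (C m) (\<delta> m)) - b * (\<Prod>j\<in>J. \<delta> m j)\<bar> \<le> \<eta> * (\<Prod>j\<in>J. \<delta> m j)"
        by metis
      have lim: "(\<lambda>m. measure lebesgue (corner n v J (C m) (\<delta> m)) / (\<Prod>j\<in>J. \<delta> m j)) \<longlonglongrightarrow> b"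
      proof (rule b)
        fix k assume "k \<in> {1..n}"
        then have "\<bar>C m k - c k\<bar> \<le> 1 / (real m + 1)" for m using C[of m] unfolding near_def by (auto intro: less_imp_le)
        then have "(\<lambda>m. C m k - c k) \<longlonglongrightarrow> 0" by (intro Lim_null_comparison[OF _ seq0]) auto
        then show "(\<lambda>m. C m k) \<longlonglongrightarrow> c k" by (simp add: LIM_zero_iff)
      next
        fix j assume "j \<in> J"
        then have "\<bar>\<delta> m j\<bar> \<le> 1 / (real m + 1)" for m using \<delta>[of m] by (auto intro: less_imp_le)
        then show "(\<lambda>m. \<delta> m j) \<longlonglongrightarrow> 0" by (intro Lim_null_comparison[OF _ seq0]) auto
      next
        fix m show "corner n v J (C m) (\<delta> m) \<subseteq> X"
          by (rule Xn, rule near_mono[OF C]) auto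
      qed (use \<delta> in auto)
      obtain m where m: "\<bar>measure lebesgue (corner n v J (C m) (\<delta> m)) / (\<Prod>j\<in>J. \<delta> m j) - b\<bar> < \<eta>"
        using LIMSEQ_D[OF lim \<eta>] by auto
      have P: "(\<Prod>j\<in>J. \<delta> m j) > 0" using \<delta>[of m] by (intro prod_pos) auto
      have "measure lebesgue (corner n v J (C m) (\<delta> m)) - b * (\<Prod>j\<in>J. \<delta> m j) =
         (measure lebesgue (corner n v J (C m) (\<delta> m)) / (\<Prod>j\<in>J. \<delta> m j) - b) * (\<Prod>j\<in>J. \<delta> m j)"
        using P by (simp add: field_simps)
      then have "\<bar>measure lebesgue (corner n v J (C m) (\<delta> m)) - b * (\<Prod>j\<in>J. \<delta> m j)\<bar> \<le> \<eta> * (\<Prod>j\<in>J. \<delta> m j)"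
        using m P by (simp add: abs_mult)
      then show False using bad by blast
    qed
  next
    fix z assume z: "\<And>j. j \<in> J \<Longrightarrow> z \<bullet> v j = c j" "\<And>k. k \<in> {1..n}-J \<Longrightarrow> z \<bullet> v k < c k"
    show "b > 0"
      by (rule b2[of z "\<lambda>_. c" "\<lambda>m _. 1 / (real m + 1)", OF z]) (use seq0 Xn near_refl in auto)
   qed (rule b1)
  qed
qed

text \<open>The area of the \<open>i\<close>-th facet, divided by the length of \<open>v i\<close>.\<close>

definition A :: "nat \<Rightarrow> (nat \<Rightarrow> real) \<Rightarrow> real" where
  "A i c = partial_deriv i V c"

lemma has_facet_one: "i \<in> {1..n} \<Longrightarrow> has_facet i (\<lambda>_. 1)"
  unfolding has_facet_def using exposed by blast

text \<open>The witness \<open>z\<close> is moved along \<open>p\<close> to meet the new level of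
  the i-th constraint; the slack in the other constraints absorbs the move.\<close>

lemma has_facet_open:
  assumes i: "i \<in> {1..n}" and g: "has_facet i c"
  obtains r where "r > 0" "\<And>c'. near n c r c' \<Longrightarrow> has_facet i c'"
proof -
  obtain z where z: "z \<bullet> v i = c i" "\<And>k. k \<in> {1..n}-{i} \<Longrightarrow> z \<bullet> v k < c k"
    using g unfolding has_facet_def by blast
  define p where "p = (1 / (v i \<bullet> v i)) *\<^sub>R v i"
  have p: "p \<bullet> v i = 1" unfolding p_def using v_nonzero[OF i] by simp
  define N where "N = (\<Sum>k\<in>{1..n}. \<bar>p \<bullet> v k\<bar>) + 1"
  have N: "N \<ge> 1" "\<And>k. k \<in> {1..n} \<Longrightarrow> \<bar>p \<bullet> v k\<bar> \<le> N - 1"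
    unfolding N_def using member_le_sum[of _ "{1..n}" "\<lambda>k. \<bar>p \<bullet> v k\<bar>"] by (auto simp: sum_nonneg)
  define s where "s = Min (insert 1 ((\<lambda>k. c k - z \<bullet> v k) ` ({1..n}-{i})))"
  have s: "s > 0" "\<And>k. k \<in> {1..n}-{i} \<Longrightarrow> s \<le> c k - z \<bullet> v k"
    unfolding s_def using z by auto
  \<comment> \<open>The correction along \<open>p\<close> consumes at most (N - 1) / N of the slack
    \<open>s\<close>, and the change of \<open>c' k\<close> less than the remaining 1 / N.\<close>
  show ?thesis
  proof (rule that[of "s / N"])
    show "s / N > 0" using s N by simp
    fix c' assume c': "near n c (s / N) c'"
    show "has_facet i c'" unfolding has_facet_def
    proof (intro exI[of _ "z + (c' i - c i) *\<^sub>R p"] conjI ballI)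
      show "(z + (c' i - c i) *\<^sub>R p) \<bullet> v i = c' i" using z(1) p by (simp add: inner_add_left)
      fix k assume k: "k \<in> {1..n} - {i}"
      have "\<bar>(c' i - c i) * (p \<bullet> v k)\<bar> \<le> (s / N) * (N - 1)"
        unfolding abs_mult using c' i N k s(1) unfolding near_def by (intro mult_mono) (auto intro: less_imp_le)
      moreover have "\<bar>c' k - c k\<bar> < s / N" using c' k unfolding near_def by blast
      moreover have "(s / N) * (N - 1) = s - s / N" using N(1) by (simp add: field_simps)
      ultimately show "(z + (c' i - c i) *\<^sub>R p) \<bullet> v k < c' k"
        using s(2)[OF k] by (simp add: inner_add_left)
    qed
  qed
qed

text \<open>Lowering \<open>c i\<close> by \<delta> removes a corner of volume about b * \<delta>,
  uniformly in the base point. Raising it is the same step seen from its end point.\<close>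

lemma V_has_strict_partial_pos:
  assumes i: "i \<in> {1..n}" and g: "has_facet i c"
  obtains D where "D > 0" "has_strict_partial n V c i D"
proof -
  obtain z where z: "z \<bullet> v i = c i" "\<And>k. k \<in> {1..n}-{i} \<Longrightarrow> z \<bullet> v k < c k"
    using g unfolding has_facet_def by blast
  have J: "{i} \<subseteq> {1..n}" using i by simp
  have ind: "independent (v ` {i})" using v_nonzero[OF i] by simp
  have nd: "c k \<noteq> (\<Sum>j\<in>{i}. \<alpha> j * c j)" if "k \<in> {1..n} - {i}" "v k = (\<Sum>j\<in>{i}. \<alpha> j *\<^sub>R v j)" for k \<alpha>
    using z(1) z(2)[OF that(1)] that(2) by (auto simp: inner_commute)
  show ?thesis
  proof (rule corner_measure_uniform[where J="{i}" and c=c, OF J ind nd], assumption, assumption)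
    fix b
    assume b: "\<And>\<eta>. \<eta> > 0 \<Longrightarrow> \<exists>r>0. \<forall>C \<delta>. near n c r C \<longrightarrow> (\<forall>j\<in>{i}. 0 < \<delta> j \<and> \<delta> j < r) \<longrightarrow>
        \<bar>measure lebesgue (corner n v {i} C \<delta>) - b * (\<Prod>j\<in>{i}. \<delta> j)\<bar> \<le> \<eta> * (\<Prod>j\<in>{i}. \<delta> j)"
      and b2: "\<And>z. (\<And>j. j \<in> {i} \<Longrightarrow> z \<bullet> v j = c j) \<Longrightarrow> (\<And>k. k \<in> {1..n}-{i} \<Longrightarrow> z \<bullet> v k < c k) \<Longrightarrow> b > 0"
    have bpos: "b > 0" by (rule b2[of z]) (use z in auto)
    have "has_strict_partial n V c i b"
      unfolding has_strict_partial_def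
    proof (intro allI impI)
      fix \<eta> :: real assume "\<eta> > 0"
      from b[OF this] obtain r where r: "r > 0" "\<And>C \<delta>. near n c r C \<Longrightarrow> (\<forall>j\<in>{i}. 0 < \<delta> j \<and> \<delta> j < r) \<Longrightarrow>
        \<bar>measure lebesgue (corner n v {i} C \<delta>) - b * (\<Prod>j\<in>{i}. \<delta> j)\<bar> \<le> \<eta> * (\<Prod>j\<in>{i}. \<delta> j)" by blast
      have *: "\<bar>V C - V (C(i := C i - \<delta>)) - b * \<delta>\<bar> \<le> \<eta> * \<delta>" if "near n c r C" "0 < \<delta>" "\<delta> < r" for C \<delta>
        using r(2)[of C "\<lambda>_. \<delta>"] that corner1_measure[OF i, of "\<lambda>_. \<delta>" C] by simp
      show "\<exists>r>0. \<forall>c' h. near n c r c' \<longrightarrow> \<bar>h\<bar> < r \<longrightarrow> \<bar>V (c'(i := c' i + h)) - V c' - b * h\<bar> \<le> \<eta> * \<bar>h\<bar>"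
      proof (intro exI[of _ "r/2"] conjI allI impI)
        fix c' h assume c': "near n c (r/2) c'" and h: "\<bar>h\<bar> < r/2"
        consider "h = 0" | "h > 0" | "h < 0" by linarith
        then show "\<bar>V (c'(i := c' i + h)) - V c' - b * h\<bar> \<le> \<eta> * \<bar>h\<bar>"
        proof cases
          case 2
          have "near n c r (c'(i := c' i + h))" using near_upd[OF c' h, of i] by simp
          from *[OF this 2] h 2 show ?thesis by simp
        next
          case 3
          have "near n c r c'" using near_mono[OF c'] r(1) by simp
          from *[OF this, of "-h"] h 3 show ?thesis by simp
        qed simp
      qed (use r in simp)
    qed
    with bpos show ?thesis by (rule that)
  qed
qed

lemma V_has_strict_partial: "i \<in> {1..n} \<Longrightarrow> has_facet i c \<Longrightarrow> has_strict_partial n V c i (A i c)"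
  using V_has_strict_partial_pos has_strict_partial_imp_partial_deriv unfolding A_def by metis

lemma A_pos: "i \<in> {1..n} \<Longrightarrow> has_facet i c \<Longrightarrow> A i c > 0"
  using V_has_strict_partial_pos has_strict_partial_imp_partial_deriv unfolding A_def by metis

lemma has_facet_near_one:
  obtains r where "r > 0" "\<And>c i. near n (\<lambda>_. 1) r c \<Longrightarrow> i \<in> {1..n} \<Longrightarrow> has_facet i c"
proof -
  have "\<forall>i\<in>{1..n}. \<exists>r>0. \<forall>c. near n (\<lambda>_. 1) r c \<longrightarrow> has_facet i c"
    using has_facet_open[OF _ has_facet_one] by metis
  then obtain r where r: "\<And>i. i \<in> {1..n} \<Longrightarrow> r i > 0 \<and> (\<forall>c. near n (\<lambda>_. 1) (r i) c \<longrightarrow> has_facet i c)" by metis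
  show ?thesis
  proof (rule that[of "Min (insert 1 (r ` {1..n}))"])
    show "Min (insert 1 (r ` {1..n})) > 0" using r by auto
    fix c i assume c: "near n (\<lambda>_. 1) (Min (insert 1 (r ` {1..n}))) c" and i: "i \<in> {1..n}"
    have "Min (insert 1 (r ` {1..n})) \<le> r i" using i by (intro Min_le) auto
    then have "near n (\<lambda>_. 1) (r i) c" by (rule near_mono[OF c])
    then show "has_facet i c" using r[OF i] by blast
  qed
qed

lemma A_cong:
  assumes "\<And>k. k \<in> {1..n} \<Longrightarrow> c k = c' k" "i \<in> {1..n}"
  shows "A i c = A i c'"
proof -
  have "V (c(i := t)) = V (c'(i := t))" for t by (rule V_cong) (use assms in auto)
  then show ?thesis unfolding A_def partial_deriv_def using assms by simp
qed

section \<open>Behaviour under translation and scaling\<close>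

lemma V_translate: "V (\<lambda>k. c k + a \<bullet> v k) = V c"
proof -
  have "generalized_polar n v (\<lambda>k. c k + a \<bullet> v k) = (+) a ` generalized_polar n v c"
  proof (intro equalityI subsetI)
    fix x assume "x \<in> generalized_polar n v (\<lambda>k. c k + a \<bullet> v k)"
    then have "x - a \<in> generalized_polar n v c" unfolding generalized_polar_def by (fastforce simp: inner_diff_left)
    then show "x \<in> (+) a ` generalized_polar n v c" by (intro image_eqI[of _ _ "x - a"]) auto
  qed (auto simp: generalized_polar_def inner_add_left)
  then show ?thesis unfolding V_def by (simp only: measure_translation)
qed

lemma deriv_shift: "deriv (\<lambda>t::real. f (t - s)) (x + s) = deriv f x"
  unfolding deriv_def using DERIV_shift[of "\<lambda>t. f (t - s)" _ x s] by simp

lemma A_translate: "A i (\<lambda>k. c k + a \<bullet> v k) = A i c"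
proof -
  have "V ((\<lambda>k. c k + a \<bullet> v k)(i := t)) = V (c(i := t - a \<bullet> v i))" for t
  proof -
    have "(\<lambda>k. c k + a \<bullet> v k)(i := t) = (\<lambda>k. (c(i := t - a \<bullet> v i)) k + a \<bullet> v k)" by auto
    then show ?thesis using V_translate[of "c(i := t - a \<bullet> v i)" a] by simp
  qed
  then show ?thesis unfolding A_def partial_deriv_def
    using deriv_shift[of "\<lambda>t. V (c(i := t))" "a \<bullet> v i" "c i"] by simp
qed

lemma V_scale: assumes t: "t > 0" shows "V (\<lambda>k. t * c k) = t ^ CARD('d) * V c"
proof -
  have "generalized_polar n v (\<lambda>k. t * c k) = (\<lambda>x. 0 + t *\<^sub>R x) ` generalized_polar n v c"
  proof (intro equalityI subsetI)
    fix x assume "x \<in> generalized_polar n v (\<lambda>k. t * c k)"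
    then have "(1/t) *\<^sub>R x \<in> generalized_polar n v c" using t unfolding generalized_polar_def by (auto simp: field_simps)
    then show "x \<in> (\<lambda>x. 0 + t *\<^sub>R x) ` generalized_polar n v c"
      by (intro image_eqI[of _ _ "(1/t) *\<^sub>R x"]) (use t in auto)
  qed (use t in \<open>auto simp: generalized_polar_def\<close>)
  then show ?thesis unfolding V_def using t measure_lebesgue_affine[of t 0 "generalized_polar n v c"] by (simp add: add.commute)
qed

text \<open>Facet areas scale with the power d - 1; the extra factor \<open>t\<close> on the left
  keeps the exponent at d.\<close>

lemma A_scale_one:
  assumes t: "t > 0" and i: "i \<in> {1..n}"
  shows "t * A i (\<lambda>_. t) = t ^ CARD('d) * A i (\<lambda>_. 1)"
proof -
  have tt: "t / t = 1" using t by simp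
  have "((\<lambda>s. V ((\<lambda>_. 1)(i := s))) has_real_derivative A i (\<lambda>_. 1)) (at (t / t))"
    unfolding tt using has_strict_partial_imp_DERIV[OF V_has_strict_partial[OF i has_facet_one[OF i]]] .
  then have "((\<lambda>s. V ((\<lambda>_. 1)(i := s / t))) has_real_derivative A i (\<lambda>_. 1) * (1 / t)) (at t)"
    by (rule DERIV_chain2) (use t in \<open>auto intro!: derivative_eq_intros\<close>)
  then have d: "((\<lambda>s. t ^ CARD('d) * V ((\<lambda>_. 1)(i := s / t))) has_real_derivative t ^ CARD('d) * (A i (\<lambda>_. 1) * (1 / t))) (at t)"
    by (rule DERIV_cmult)
  have "t ^ CARD('d) * V ((\<lambda>_. 1)(i := s / t)) = V ((\<lambda>_. t)(i := s))" for s
    unfolding V_scale[OF t, symmetric] using t by (intro arg_cong[of _ _ V]) auto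
  then have "A i (\<lambda>_. t) = t ^ CARD('d) * (A i (\<lambda>_. 1) * (1 / t))"
    using d unfolding A_def partial_deriv_def by (simp add: DERIV_imp_deriv)
  then show ?thesis using t by simp
qed

text \<open>Of three collinear vertices one would lie between the others and could not be exposed. A
  negative coefficient singles out \<open>v i\<close> or \<open>v j\<close> as the middle one, and
  the relation is then solved for it.\<close>

lemma not_collinear:
  assumes "i \<in> {1..n}" "j \<in> {1..n}" "k \<in> {1..n}" "i \<noteq> j" "k \<noteq> i" "k \<noteq> j"
    and "v k = a *\<^sub>R v i + b *\<^sub>R v j"
  shows "a + b \<noteq> 1"
proof
  assume ab: "a + b = 1"
  have *: False if "i \<in> {1..n}" "j \<in> {1..n}" "k \<in> {1..n}" "k \<noteq> i" "k \<noteq> j" "v k = a *\<^sub>R v i + b *\<^sub>R v j" "a + b = 1" "0 \<le> a" "0 \<le> b"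
    for i j k a b
  proof -
    note ij = that(1,2) and k = that(3) and ne = that(4,5)
    obtain z where z: "z \<bullet> v k = 1" "z \<bullet> v i < 1" "z \<bullet> v j < 1" using exposed[OF k] ij ne by blast
    have "a * (z \<bullet> v i) + b * (z \<bullet> v j) = 1" using z(1) that(6) by (simp add: inner_add_right)
    moreover have "a * (z \<bullet> v i) \<le> a * 1" "b * (z \<bullet> v j) \<le> b * 1"
      using z that by (intro mult_left_mono; simp)+
    moreover have "a * (z \<bullet> v i) < a * 1 \<or> b * (z \<bullet> v j) < b * 1"
      using z that by (cases "a = 0") auto
    ultimately show False using that(7) by linarith
  qed
  consider "0 \<le> a" "0 \<le> b" | "a < 0" | "b < 0" by linarith
  then show False
  proof cases
    case 1 then show False using *[of i j k a b] assms ab by blast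
  next
    case 2
    then have b: "b > 1" using ab by simp
    have "b *\<^sub>R v j = v k - a *\<^sub>R v i" using assms(7) by (simp add: algebra_simps)
    then have "(1/b) *\<^sub>R (b *\<^sub>R v j) = (1/b) *\<^sub>R (v k - a *\<^sub>R v i)" by simp
    then have "v j = (1/b) *\<^sub>R v k + (-a/b) *\<^sub>R v i" using b by (simp add: algebra_simps)
    moreover have "1/b + (-a/b) = 1" using b ab by (simp add: field_simps)
    moreover have "0 \<le> 1/b" "0 \<le> -a/b" using b 2 divide_nonneg_pos[of "-a" b] by simp_all
    ultimately show False using *[OF assms(3) assms(1) assms(2)] assms(4,6) by metis
  next
    case 3
    then have a: "a > 1" using ab by simp
    have "a *\<^sub>R v i = v k - b *\<^sub>R v j" using assms(7) by (simp add: algebra_simps)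
    then have "(1/a) *\<^sub>R (a *\<^sub>R v i) = (1/a) *\<^sub>R (v k - b *\<^sub>R v j)" by simp
    then have "v i = (1/a) *\<^sub>R v k + (-b/a) *\<^sub>R v j" using a by (simp add: algebra_simps)
    moreover have "1/a + (-b/a) = 1" using a ab by (simp add: field_simps)
    moreover have "0 \<le> 1/a" "0 \<le> -b/a" using a 3 divide_nonneg_pos[of "-b" a] by simp_all
    ultimately show False using *[OF assms(3) assms(2) assms(1)] assms(4,5) by metis
  qed
qed

text \<open>Independent \<open>v i\<close> and \<open>v j\<close> are a case of the corner with two
  constraints, \<open>not_collinear\<close> being the nondegeneracy. Dependent ones point in
  opposite directions: both constraints cannot be nearly tight at once, the corner is empty, and
  \<open>b\<close> is 0.\<close>

lemma second_difference:
  assumes ij: "i \<in> {1..n}" "j \<in> {1..n}" "i \<noteq> j"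
  obtains b where "b \<noteq> 0 \<Longrightarrow> adj i j"
    "\<And>\<eta>. \<eta> > 0 \<Longrightarrow> \<exists>r>0. \<forall>c \<epsilon> \<delta>. near n (\<lambda>_. 1) r c \<longrightarrow> 0 < \<epsilon> \<longrightarrow> \<epsilon> < r \<longrightarrow> 0 < \<delta> \<longrightarrow> \<delta> < r \<longrightarrow>
      \<bar>(V c - V (c(j := c j - \<delta>))) - (V (c(i := c i - \<epsilon>)) - V (c(i := c i - \<epsilon>, j := c j - \<delta>))) - b * (\<epsilon> * \<delta>)\<bar> \<le> \<eta> * (\<epsilon> * \<delta>)"
proof -
  let ?W = "\<lambda>c \<epsilon> \<delta>. (V c - V (c(j := c j - \<delta>))) - (V (c(i := c i - \<epsilon>)) - V (c(i := c i - \<epsilon>, j := c j - \<delta>)))"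
  have W: "?W c \<epsilon> \<delta> = measure lebesgue (corner n v {i,j} c (\<lambda>k. if k = i then \<epsilon> else \<delta>))" if "\<epsilon> > 0" "\<delta> > 0" for c \<epsilon> \<delta>
    using corner2_measure[OF ij, of "\<lambda>k. if k = i then \<epsilon> else \<delta>" c] ij that by simp
  have vij: "v i \<noteq> v j" using inj_v ij by (auto dest: inj_onD)
  show ?thesis
  proof (cases "independent {v i, v j}")
    case True
    have J: "{i,j} \<subseteq> {1..n}" using ij by simp
    have ind: "independent (v ` {i,j})" using True by simp
    have nd: "1 \<noteq> (\<Sum>j\<in>{i,j}. \<alpha> j * 1)" if "k \<in> {1..n} - {i,j}" "v k = (\<Sum>j\<in>{i,j}. \<alpha> j *\<^sub>R v j)" for k \<alpha>
      using not_collinear[of i j k "\<alpha> i" "\<alpha> j"] that ij by auto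
    show ?thesis
    proof (rule corner_measure_uniform[where J="{i,j}" and c="\<lambda>_. 1", OF J ind nd], assumption, assumption)
      fix b
      assume b: "\<And>\<eta>. \<eta> > 0 \<Longrightarrow> \<exists>r>0. \<forall>C \<delta>. near n (\<lambda>_. 1) r C \<longrightarrow> (\<forall>k\<in>{i,j}. 0 < \<delta> k \<and> \<delta> k < r) \<longrightarrow>
          \<bar>measure lebesgue (corner n v {i,j} C \<delta>) - b * (\<Prod>k\<in>{i,j}. \<delta> k)\<bar> \<le> \<eta> * (\<Prod>k\<in>{i,j}. \<delta> k)"
        and b1: "b \<noteq> 0 \<Longrightarrow> \<exists>z. (\<forall>k\<in>{i,j}. z \<bullet> v k = 1) \<and> (\<forall>k\<in>{1..n}-{i,j}. z \<bullet> v k < 1)"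
      show ?thesis
      proof (rule that[of b])
        show "b \<noteq> 0 \<Longrightarrow> adj i j" using b1 unfolding adj_def by auto
        fix \<eta> :: real assume "\<eta> > 0"
        from b[OF this] obtain r where r: "r > 0" "\<And>C \<delta>. near n (\<lambda>_. 1) r C \<Longrightarrow> (\<forall>k\<in>{i,j}. 0 < \<delta> k \<and> \<delta> k < r) \<Longrightarrow>
          \<bar>measure lebesgue (corner n v {i,j} C \<delta>) - b * (\<Prod>k\<in>{i,j}. \<delta> k)\<bar> \<le> \<eta> * (\<Prod>k\<in>{i,j}. \<delta> k)" by blast
        show "\<exists>r>0. \<forall>c \<epsilon> \<delta>. near n (\<lambda>_. 1) r c \<longrightarrow> 0 < \<epsilon> \<longrightarrow> \<epsilon> < r \<longrightarrow> 0 < \<delta> \<longrightarrow> \<delta> < r \<longrightarrow>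
            \<bar>?W c \<epsilon> \<delta> - b * (\<epsilon> * \<delta>)\<bar> \<le> \<eta> * (\<epsilon> * \<delta>)"
        proof (intro exI[of _ r] conjI allI impI r(1))
          fix c \<epsilon> \<delta> assume "near n (\<lambda>_. 1) r c" "0 < \<epsilon>" "\<epsilon> < r" "0 < \<delta>" "\<delta> < r"
          then show "\<bar>?W c \<epsilon> \<delta> - b * (\<epsilon> * \<delta>)\<bar> \<le> \<eta> * (\<epsilon> * \<delta>)"
            unfolding W[OF \<open>0 < \<epsilon>\<close> \<open>0 < \<delta>\<close>] using r(2)[of c "\<lambda>k. if k = i then \<epsilon> else \<delta>"] ij by simp
        qed
      qed
    qed
  next
    case False
    then have "\<not> independent (insert (v j) {v i})" by (simp add: insert_commute)
    then have "v j \<in> span {v i}"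
      using vij v_nonzero[OF ij(1)] by (simp add: independent_insert split: if_splits)
    then obtain \<mu> where \<mu>: "v j = \<mu> *\<^sub>R v i" unfolding span_singleton by blast
    obtain zi where zi: "zi \<bullet> v i = 1" "zi \<bullet> v j < 1" using exposed[OF ij(1)] ij by blast
    obtain zj where zj: "zj \<bullet> v j = 1" "zj \<bullet> v i < 1" using exposed[OF ij(2)] ij by blast
    have "\<mu> < 1" using zi \<mu> by simp
    have "\<mu> \<le> 0"
    proof (rule ccontr)
      assume "\<not> \<mu> \<le> 0"
      then have "\<mu> * (zj \<bullet> v i) < \<mu> * 1" using zj(2) by (intro mult_strict_left_mono) auto
      then show False using zj(1) \<mu> \<open>\<mu> < 1\<close> by simp
    qed
    have empty: "corner n v {i,j} c \<delta> = {}" if c: "near n (\<lambda>_. 1) (1/2) c" and d: "\<delta> i < 1/2" "\<delta> j < 1/2" for c \<delta>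
    proof -
      have "c i - \<delta> i > 0" "c j - \<delta> j > 0"
        using c d ij unfolding near_def by (smt (verit) field_sum_of_halves)+
      then show ?thesis using \<open>\<mu> \<le> 0\<close> unfolding corner_def by (auto simp: \<mu>) (smt (verit) mult_nonpos_nonneg)
    qed
    show ?thesis
    proof (rule that[of 0])
      fix \<eta> :: real assume "\<eta> > 0"
      show "\<exists>r>0. \<forall>c \<epsilon> \<delta>. near n (\<lambda>_. 1) r c \<longrightarrow> 0 < \<epsilon> \<longrightarrow> \<epsilon> < r \<longrightarrow> 0 < \<delta> \<longrightarrow> \<delta> < r \<longrightarrow>
            \<bar>?W c \<epsilon> \<delta> - 0 * (\<epsilon> * \<delta>)\<bar> \<le> \<eta> * (\<epsilon> * \<delta>)"
      proof (intro exI[of _ "1/2"] conjI allI impI)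
        fix c and \<epsilon> \<delta> :: real assume *: "near n (\<lambda>_. 1) (1/2) c" "0 < \<epsilon>" "\<epsilon> < 1/2" "0 < \<delta>" "\<delta> < 1/2"
        show "\<bar>?W c \<epsilon> \<delta> - 0 * (\<epsilon> * \<delta>)\<bar> \<le> \<eta> * (\<epsilon> * \<delta>)"
          unfolding W[OF *(2,4)] using empty[OF *(1), of "\<lambda>k. if k = i then \<epsilon> else \<delta>"] * \<open>\<eta> > 0\<close> by simp
      qed simp
    qed simp
  qed
qed

definition has_second_difference :: "nat \<Rightarrow> nat \<Rightarrow> real \<Rightarrow> bool" where
  "has_second_difference i j b \<longleftrightarrow> (\<forall>\<eta>>0. \<exists>r>0. \<forall>c \<epsilon> \<delta>. near n (\<lambda>_. 1) r c \<longrightarrow> 0 < \<epsilon> \<longrightarrow> \<epsilon> < r \<longrightarrow> 0 < \<delta> \<longrightarrow> \<delta> < r \<longrightarrow>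
      \<bar>(V c - V (c(j := c j - \<delta>))) - (V (c(i := c i - \<epsilon>)) - V (c(i := c i - \<epsilon>, j := c j - \<delta>))) - b * (\<epsilon> * \<delta>)\<bar> \<le> \<eta> * (\<epsilon> * \<delta>))"

text \<open>A mixed difference does not depend on the order of its two steps. The symmetry of
  \<open>M\<close> comes from here rather than from continuity of second derivatives.\<close>

lemma has_second_difference_swap:
  assumes "i \<noteq> j" "has_second_difference i j b" shows "has_second_difference j i b"
proof -
  have "(V c - V (c(i := c i - \<delta>))) - (V (c(j := c j - \<epsilon>)) - V (c(j := c j - \<epsilon>, i := c i - \<delta>)))
     = (V c - V (c(j := c j - \<epsilon>))) - (V (c(i := c i - \<delta>)) - V (c(i := c i - \<delta>, j := c j - \<epsilon>)))" for c \<epsilon> \<delta>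
    using assms(1) by (simp add: fun_upd_twist)
  then show ?thesis using assms(2) unfolding has_second_difference_def by (metis mult.commute)
qed

text \<open>Dividing by \<delta> and letting \<delta> tend to 0 turns the mixed difference into a
  difference of values of \<open>A j\<close>, by the strict partials of \<open>V\<close> at the two
  base points.\<close>

lemma second_difference_imp_A_strict:
  assumes ij: "i \<in> {1..n}" "j \<in> {1..n}" "i \<noteq> j" and sd: "has_second_difference i j b"
  shows "has_strict_partial n (A j) (\<lambda>_. 1) i b"
  unfolding has_strict_partial_def
proof (intro allI impI)
  fix \<eta> :: real assume \<eta>: "\<eta> > 0"
  obtain r where r: "r > 0" "\<And>c \<epsilon> \<delta>. near n (\<lambda>_. 1) r c \<Longrightarrow> 0 < \<epsilon> \<Longrightarrow> \<epsilon> < r \<Longrightarrow> 0 < \<delta> \<Longrightarrow> \<delta> < r \<Longrightarrow>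
      \<bar>(V c - V (c(j := c j - \<delta>))) - (V (c(i := c i - \<epsilon>)) - V (c(i := c i - \<epsilon>, j := c j - \<delta>))) - b * (\<epsilon> * \<delta>)\<bar> \<le> \<eta> * (\<epsilon> * \<delta>)"
    using sd \<eta> unfolding has_second_difference_def by blast
  obtain r0 where r0: "r0 > 0" "\<And>c i. near n (\<lambda>_. 1) r0 c \<Longrightarrow> i \<in> {1..n} \<Longrightarrow> has_facet i c"
    using has_facet_near_one by blast
  define q where "q = min r r0 / 2"
  have q: "q > 0" "q + q \<le> r" "q + q \<le> r0" unfolding q_def using r r0 by auto
  have *: "\<bar>A j c - A j (c(i := c i - \<epsilon>)) - b * \<epsilon>\<bar> \<le> \<eta> * \<epsilon>"
    if c: "near n (\<lambda>_. 1) r c" "near n (\<lambda>_. 1) r0 c" "near n (\<lambda>_. 1) r0 (c(i := c i - \<epsilon>))" and \<epsilon>: "0 < \<epsilon>" "\<epsilon> < r" for c \<epsilon>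
  proof (rule field_le_epsilon)
    fix e :: real assume "e > 0"
    then have e: "e / 2 > 0" by simp
    let ?c = "c(i := c i - \<epsilon>)"
    obtain s where s: "s > 0" "\<And>c' h. near n c s c' \<Longrightarrow> \<bar>h\<bar> < s \<Longrightarrow> \<bar>V (c'(j := c' j + h)) - V c' - A j c * h\<bar> \<le> e/2 * \<bar>h\<bar>"
      using has_strict_partialD[OF V_has_strict_partial[OF ij(2) r0(2)[OF c(2) ij(2)]] e] by metis
    obtain t where t: "t > 0" "\<And>c' h. near n ?c t c' \<Longrightarrow> \<bar>h\<bar> < t \<Longrightarrow> \<bar>V (c'(j := c' j + h)) - V c' - A j ?c * h\<bar> \<le> e/2 * \<bar>h\<bar>"
      using has_strict_partialD[OF V_has_strict_partial[OF ij(2) r0(2)[OF c(3) ij(2)]] e] by metis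
    define \<delta> where "\<delta> = min r (min s t) / 2"
    have \<delta>: "\<delta> > 0" "\<delta> < r" "\<delta> < s" "\<delta> < t" unfolding \<delta>_def using r(1) s(1) t(1) by auto
    have 1: "\<bar>V (c(j := c j - \<delta>)) - V c + A j c * \<delta>\<bar> \<le> e/2 * \<delta>"
      using s(2)[OF near_refl[OF s(1)], of "-\<delta>"] \<delta> by simp
    have 2: "\<bar>V (c(i := c i - \<epsilon>, j := c j - \<delta>)) - V ?c + A j ?c * \<delta>\<bar> \<le> e/2 * \<delta>"
      using t(2)[OF near_refl[OF t(1)], of "-\<delta>"] \<delta> ij(3) by simp
    have 3: "\<bar>(V c - V (c(j := c j - \<delta>))) - (V ?c - V (c(i := c i - \<epsilon>, j := c j - \<delta>))) - b * (\<epsilon> * \<delta>)\<bar> \<le> \<eta> * (\<epsilon> * \<delta>)"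
      by (rule r(2)[OF c(1) \<epsilon> \<delta>(1,2)])
    have "\<bar>A j c * \<delta> - A j ?c * \<delta> - b * (\<epsilon> * \<delta>)\<bar> \<le> \<eta> * (\<epsilon> * \<delta>) + e * \<delta>"
    proof -
      have "\<bar>a1 - a2 - w\<bar> \<le> x + (y + y)"
        if "\<bar>p - q + a1\<bar> \<le> y" "\<bar>p' - q' + a2\<bar> \<le> y" "\<bar>(q - p) - (q' - p') - w\<bar> \<le> x" for a1 a2 w x y p q p' q' :: real
        using that by linarith
      from this[OF 1 2 3] show ?thesis by (simp add: mult.commute)
    qed
    moreover have "A j c * \<delta> - A j ?c * \<delta> - b * (\<epsilon> * \<delta>) = (A j c - A j ?c - b * \<epsilon>) * \<delta>" by (simp add: algebra_simps)
    moreover have "\<eta> * (\<epsilon> * \<delta>) + e * \<delta> = (\<eta> * \<epsilon> + e) * \<delta>" by (simp add: algebra_simps)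
    ultimately have "\<bar>A j c - A j ?c - b * \<epsilon>\<bar> * \<delta> \<le> (\<eta> * \<epsilon> + e) * \<delta>" using \<delta>(1) by (simp add: abs_mult)
    then show "\<bar>A j c - A j ?c - b * \<epsilon>\<bar> \<le> \<eta> * \<epsilon> + e" using \<delta>(1) by simp
  qed
  show "\<exists>r>0. \<forall>c' h. near n (\<lambda>_. 1) r c' \<longrightarrow> \<bar>h\<bar> < r \<longrightarrow> \<bar>A j (c'(i := c' i + h)) - A j c' - b * h\<bar> \<le> \<eta> * \<bar>h\<bar>"
  proof (intro exI[of _ q] conjI allI impI q(1))
    fix c' h assume c': "near n (\<lambda>_. 1) q c'" and h: "\<bar>h\<bar> < q"
    have n1: "near n (\<lambda>_. 1) r c'" "near n (\<lambda>_. 1) r0 c'" using q by (auto intro: near_mono[OF c'])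
    have n2: "near n (\<lambda>_. 1) r (c'(i := c' i + h))" "near n (\<lambda>_. 1) r0 (c'(i := c' i + h))"
      using q by (auto intro: near_mono[OF near_upd[OF c' h]])
    consider "h = 0" | "h > 0" | "h < 0" by linarith
    then show "\<bar>A j (c'(i := c' i + h)) - A j c' - b * h\<bar> \<le> \<eta> * \<bar>h\<bar>"
    proof cases
      case 2
      have "\<bar>A j (c'(i := c' i + h)) - A j ((c'(i := c' i + h))(i := (c'(i := c' i + h)) i - h)) - b * h\<bar> \<le> \<eta> * h"
        by (rule *) (use n1 n2 2 h q in auto)
      then show ?thesis using 2 by simp
    next
      case 3
      have "\<bar>A j c' - A j (c'(i := c' i - (-h))) - b * (-h)\<bar> \<le> \<eta> * (-h)"
        by (rule *) (use n1 n2 3 h q in auto)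
      then show ?thesis using 3 by simp
    qed simp
  qed
qed

text \<open>Raising \<open>c j\<close> by h amounts to a translation by h * a, where a \<bullet> v j
  = 1, together with changes of the other coordinates by - h * (a \<bullet> v k). \<open>A j\<close>
  ignores the translation, so the other partial derivatives determine this one.\<close>

lemma A_diagonal_strict:
  assumes j: "j \<in> {1..n}" and off: "\<And>i. i \<in> {1..n}-{j} \<Longrightarrow> has_strict_partial n (A j) (\<lambda>_. 1) i (b i)"
  shows "\<exists>D. has_strict_partial n (A j) (\<lambda>_. 1) j D"
proof -
  define a where "a = (1 / (v j \<bullet> v j)) *\<^sub>R v j"
  have a: "a \<bullet> v j = 1" unfolding a_def using v_nonzero[OF j] by simp
  define S where "S = {1..n} - {j}"
  define D where "D = - (\<Sum>k\<in>S. b k * (a \<bullet> v k))"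
  define N where "N = (\<Sum>k\<in>S. \<bar>a \<bullet> v k\<bar>) + 1"
  have N: "N \<ge> 1" "\<And>k. k \<in> S \<Longrightarrow> \<bar>a \<bullet> v k\<bar> \<le> N"
    unfolding N_def using member_le_sum[of _ S "\<lambda>k. \<bar>a \<bullet> v k\<bar>"] by (force simp: sum_nonneg S_def)+
  have "has_strict_partial n (A j) (\<lambda>_. 1) j D"
    unfolding has_strict_partial_def
  proof (intro allI impI)
    fix \<eta> :: real assume \<eta>: "\<eta> > 0"
    then have "\<eta> / N > 0" using N by simp
    from has_strict_partial_total_ex[of S n "A j" "\<lambda>_. 1" b, OF _ _ this] off
    obtain r where r: "r > 0" "\<And>c' g. near n (\<lambda>_. 1) r c' \<Longrightarrow> (\<forall>k. k \<notin> S \<longrightarrow> g k = 0) \<Longrightarrow> (\<forall>k\<in>S. \<bar>g k\<bar> < r) \<Longrightarrow>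
     \<bar>A j (\<lambda>k. c' k + g k) - A j c' - (\<Sum>k\<in>S. b k * g k)\<bar> \<le> \<eta> / N * (\<Sum>k\<in>S. \<bar>g k\<bar>)"
      unfolding S_def by auto
    show "\<exists>r>0. \<forall>c' h. near n (\<lambda>_. 1) r c' \<longrightarrow> \<bar>h\<bar> < r \<longrightarrow> \<bar>A j (c'(j := c' j + h)) - A j c' - D * h\<bar> \<le> \<eta> * \<bar>h\<bar>"
    proof (intro exI[of _ "r / N"] conjI allI impI)
      fix c' h assume c': "near n (\<lambda>_. 1) (r / N) c'" and h: "\<bar>h\<bar> < r / N"
      define g where "g k = (if k \<in> S then - h * (a \<bullet> v k) else 0)" for k
      have rN: "r / N \<le> r" using r(1) N(1) by (simp add: divide_le_eq)
      have "A j (c'(j := c' j + h)) = A j (\<lambda>k. (c' k + g k) + (h *\<^sub>R a) \<bullet> v k)"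
        by (rule A_cong[OF _ j]) (auto simp: g_def S_def a)
      also have "\<dots> = A j (\<lambda>k. c' k + g k)" by (rule A_translate)
      finally have eq: "A j (c'(j := c' j + h)) = A j (\<lambda>k. c' k + g k)" .
      have "\<bar>A j (\<lambda>k. c' k + g k) - A j c' - (\<Sum>k\<in>S. b k * g k)\<bar> \<le> \<eta> / N * (\<Sum>k\<in>S. \<bar>g k\<bar>)"
      proof (rule r(2)[OF near_mono[OF c' rN]], simp add: g_def, rule ballI)
        fix k assume k: "k \<in> S"
        have "\<bar>g k\<bar> = \<bar>h\<bar> * \<bar>a \<bullet> v k\<bar>" unfolding g_def using k by (simp add: abs_mult)
        also have "\<dots> \<le> \<bar>h\<bar> * N" using N(2)[OF k] by (intro mult_left_mono) auto
        also have "\<dots> < r" using h N(1) by (simp add: field_simps)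
        finally show "\<bar>g k\<bar> < r" .
      qed
      moreover have "(\<Sum>k\<in>S. b k * g k) = D * h"
        unfolding D_def g_def by (simp add: sum_distrib_right sum_negf) (simp add: mult.assoc mult.commute mult.left_commute)
      moreover have "\<eta> / N * (\<Sum>k\<in>S. \<bar>g k\<bar>) \<le> \<eta> * \<bar>h\<bar>"
      proof -
        have "(\<Sum>k\<in>S. \<bar>g k\<bar>) = \<bar>h\<bar> * (N - 1)" unfolding N_def g_def by (simp add: abs_mult sum_distrib_left)
        also have "\<dots> \<le> \<bar>h\<bar> * N" by (intro mult_left_mono) auto
        finally have "\<eta> / N * (\<Sum>k\<in>S. \<bar>g k\<bar>) \<le> \<eta> / N * (\<bar>h\<bar> * N)"
          using \<eta> N(1) by (intro mult_left_mono) auto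
        then show ?thesis using N(1) by simp
      qed
      ultimately show "\<bar>A j (c'(j := c' j + h)) - A j c' - D * h\<bar> \<le> \<eta> * \<bar>h\<bar>" unfolding eq by linarith
    qed (use r(1) N(1) in simp)
  qed
  then show ?thesis ..
qed

section \<open>The entries of \<open>M\<close>, its kernel and its row sums\<close>

abbreviation M where "M \<equiv> izmestiev_matrix n v"

lemma M_eq: "M i j = partial_deriv i (A j) (\<lambda>_. 1)"
  unfolding izmestiev_matrix_def by (intro arg_cong2[where f="partial_deriv i"] ext) (simp_all add: A_def V_def[abs_def])

lemma M_off_diagonal:
  assumes ij: "i \<in> {1..n}" "j \<in> {1..n}" "i \<noteq> j"
  shows "has_strict_partial n (A j) (\<lambda>_. 1) i (M i j)" "M i j = M j i" "M i j \<noteq> 0 \<Longrightarrow> adj i j"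
proof -
  obtain b where b: "b \<noteq> 0 \<Longrightarrow> adj i j" "has_second_difference i j b"
    using second_difference[OF ij] unfolding has_second_difference_def by metis
  have 1: "has_strict_partial n (A j) (\<lambda>_. 1) i b"
    by (rule second_difference_imp_A_strict[OF ij b(2)])
  have 2: "has_strict_partial n (A i) (\<lambda>_. 1) j b"
    by (rule second_difference_imp_A_strict) (use ij has_second_difference_swap[OF ij(3) b(2)] in auto)
  have Mb: "M i j = b" "M j i = b"
    unfolding M_eq using 1 2 has_strict_partial_imp_partial_deriv by blast+
  show "has_strict_partial n (A j) (\<lambda>_. 1) i (M i j)" "M i j = M j i" "M i j \<noteq> 0 \<Longrightarrow> adj i j"
    using Mb 1 b(1) by simp_all
qed

lemma M_has_strict_partial:
  assumes ij: "i \<in> {1..n}" "j \<in> {1..n}"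
  shows "has_strict_partial n (A j) (\<lambda>_. 1) i (M i j)"
proof (cases "i = j")
  case True
  have "\<exists>D. has_strict_partial n (A j) (\<lambda>_. 1) j D"
    by (rule A_diagonal_strict[OF ij(2), of "\<lambda>i. M i j"]) (use M_off_diagonal(1) ij in auto)
  then show ?thesis using has_strict_partial_imp_partial_deriv M_eq True by metis
qed (use M_off_diagonal(1) ij in blast)

lemma M_sym: "i \<in> {1..n} \<Longrightarrow> j \<in> {1..n} \<Longrightarrow> M i j = M j i"
  using M_off_diagonal(2) by (cases "i = j") auto

lemma directional_derivative:
  assumes D: "\<And>k. k \<in> {1..n} \<Longrightarrow> has_strict_partial n F c k (D k)"
    and cong: "\<And>c c'. (\<And>k. k \<in> {1..n} \<Longrightarrow> c k = c' k) \<Longrightarrow> F c = F c'"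
  shows "((\<lambda>t. F (\<lambda>k. c k + t * g k)) has_real_derivative (\<Sum>k\<in>{1..n}. D k * g k)) (at 0)"
  unfolding has_field_derivative_iff LIM_def
proof (intro allI impI)
  fix e :: real assume e: "e > 0"
  define N where "N = (\<Sum>k\<in>{1..n}. \<bar>g k\<bar>) + 1"
  have N: "N \<ge> 1" "\<And>k. k \<in> {1..n} \<Longrightarrow> \<bar>g k\<bar> \<le> N"
    unfolding N_def using member_le_sum[of _ "{1..n}" "\<lambda>k. \<bar>g k\<bar>"] by (force simp: sum_nonneg)+
  have "e / (2*N) > 0" using e N by simp
  from has_strict_partial_total_ex[of "{1..n}" n F c D, OF _ D this]
  obtain r where r: "r > 0" "\<And>c' g. near n c r c' \<Longrightarrow> (\<forall>k. k \<notin> {1..n} \<longrightarrow> g k = 0) \<Longrightarrow> (\<forall>k\<in>{1..n}. \<bar>g k\<bar> < r) \<Longrightarrow>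
     \<bar>F (\<lambda>k. c' k + g k) - F c' - (\<Sum>k\<in>{1..n}. D k * g k)\<bar> \<le> e / (2*N) * (\<Sum>k\<in>{1..n}. \<bar>g k\<bar>)"
    by auto
  show "\<exists>s>0. \<forall>x. x \<noteq> 0 \<and> dist x 0 < s \<longrightarrow> dist ((F (\<lambda>k. c k + x * g k) - F (\<lambda>k. c k + 0 * g k)) / (x - 0)) (\<Sum>k\<in>{1..n}. D k * g k) < e"
  proof (intro exI[of _ "r / N"] conjI allI impI)
    fix x :: real assume x: "x \<noteq> 0 \<and> dist x 0 < r / N"
    define G where "G k = (if k \<in> {1..n} then x * g k else 0)" for k
    have "\<bar>F (\<lambda>k. c k + G k) - F c - (\<Sum>k\<in>{1..n}. D k * G k)\<bar> \<le> e / (2*N) * (\<Sum>k\<in>{1..n}. \<bar>G k\<bar>)"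
    proof (rule r(2)[OF near_refl[OF r(1)]], simp add: G_def, rule ballI)
      fix k assume k: "k \<in> {1..n}"
      have "\<bar>x\<bar> * \<bar>g k\<bar> \<le> \<bar>x\<bar> * N" using N(2)[OF k] by (intro mult_left_mono) auto
      also have "\<dots> < r" using x N(1) by (simp add: field_simps)
      finally show "\<bar>G k\<bar> < r" unfolding G_def using k by (simp add: abs_mult)
    qed
    moreover have "F (\<lambda>k. c k + G k) = F (\<lambda>k. c k + x * g k)" by (rule cong) (simp add: G_def)
    moreover have "(\<Sum>k\<in>{1..n}. D k * G k) = x * (\<Sum>k\<in>{1..n}. D k * g k)"
      unfolding G_def by (simp add: sum_distrib_left mult.left_commute)
    moreover have "(\<Sum>k\<in>{1..n}. \<bar>G k\<bar>) = \<bar>x\<bar> * (N - 1)"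
      unfolding G_def N_def by (simp add: sum_distrib_left abs_mult)
    ultimately have 1: "\<bar>F (\<lambda>k. c k + x * g k) - F c - x * (\<Sum>k\<in>{1..n}. D k * g k)\<bar> \<le> e / (2*N) * (\<bar>x\<bar> * (N - 1))"
      by simp
    also have "\<dots> \<le> e / (2*N) * (\<bar>x\<bar> * N)" using e N(1) by (intro mult_left_mono) auto
    also have "\<dots> < e * \<bar>x\<bar>" using e N(1) x by simp
    finally have "\<bar>F (\<lambda>k. c k + x * g k) - F c - x * (\<Sum>k\<in>{1..n}. D k * g k)\<bar> / \<bar>x\<bar> < e"
      using x by (simp add: divide_less_eq)
    moreover have "(F (\<lambda>k. c k + x * g k) - F c) / x - (\<Sum>k\<in>{1..n}. D k * g k) = (F (\<lambda>k. c k + x * g k) - F c - x * (\<Sum>k\<in>{1..n}. D k * g k)) / x"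
      using x by (simp add: field_simps)
    ultimately show "dist ((F (\<lambda>k. c k + x * g k) - F (\<lambda>k. c k + 0 * g k)) / (x - 0)) (\<Sum>k\<in>{1..n}. D k * g k) < e"
      by (simp add: dist_real_def abs_divide)
  qed (use r(1) N(1) in simp)
qed

lemma A_directional_derivative:
  assumes j: "j \<in> {1..n}"
  shows "((\<lambda>t. A j (\<lambda>k. 1 + t * f k)) has_real_derivative (\<Sum>k\<in>{1..n}. M k j * f k)) (at 0)"
proof (rule directional_derivative)
  show "has_strict_partial n (A j) (\<lambda>_. 1) k (M k j)" if "k \<in> {1..n}" for k
    using that j by (rule M_has_strict_partial)
  show "A j c = A j c'" if "\<And>k. k \<in> {1..n} \<Longrightarrow> c k = c' k" for c c'
    using that j by (rule A_cong)
qed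

lemma M_kernel:
  assumes j: "j \<in> {1..n}" shows "(\<Sum>k\<in>{1..n}. M k j * (a \<bullet> v k)) = 0"
proof -
  have "((\<lambda>t. A j (\<lambda>k. 1 + t * (a \<bullet> v k))) has_real_derivative (\<Sum>k\<in>{1..n}. M k j * (a \<bullet> v k))) (at 0)"
    using j by (rule A_directional_derivative)
  moreover have "A j (\<lambda>k. 1 + t * (a \<bullet> v k)) = A j (\<lambda>_. 1)" for t
    using A_translate[of j "\<lambda>_. 1" "t *\<^sub>R a"] by simp
  ultimately have "((\<lambda>t. A j (\<lambda>_. 1)) has_real_derivative (\<Sum>k\<in>{1..n}. M k j * (a \<bullet> v k))) (at 0)" by simp
  then show ?thesis using DERIV_unique DERIV_const by blast
qed

text \<open>Euler's relation for facet areas, homogeneous of degree d - 1. Combined with symmetry it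
  makes every kernel vector of \<open>M\<close> orthogonal to the gradient of the volume when d >
  1.\<close>

lemma M_row_sum:
  assumes j: "j \<in> {1..n}" shows "(\<Sum>k\<in>{1..n}. M k j) = (real CARD('d) - 1) * A j (\<lambda>_. 1)"
proof -
  have d1: "((\<lambda>t. A j (\<lambda>k. 1 + t * 1)) has_real_derivative (\<Sum>k\<in>{1..n}. M k j * 1)) (at 0)"
    using j by (rule A_directional_derivative)
  have d2: "((\<lambda>t. (1 + t) ^ (CARD('d) - 1) * A j (\<lambda>_. 1)) has_real_derivative (real CARD('d) - 1) * A j (\<lambda>_. 1)) (at 0)"
    by (auto intro!: derivative_eq_intros simp: of_nat_diff Suc_leI)
  have "((\<lambda>t. A j (\<lambda>k. 1 + t * 1)) has_real_derivative (real CARD('d) - 1) * A j (\<lambda>_. 1)) (at 0)"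
  proof (rule has_field_derivative_transform_within_open[OF d2, of "{-1<..}"])
    fix t :: real assume "t \<in> {-1<..}"
    then have t: "1 + t > 0" by simp
    have "(1 + t) ^ CARD('d) = (1 + t) * (1 + t) ^ (CARD('d) - 1)"
      by (metis power_eq_if zero_less_card_finite less_irrefl)
    then have "(1 + t) * A j (\<lambda>_. 1 + t) = (1 + t) * ((1 + t) ^ (CARD('d) - 1) * A j (\<lambda>_. 1))"
      using A_scale_one[OF t j] by simp
    then show "(1 + t) ^ (CARD('d) - 1) * A j (\<lambda>_. 1) = A j (\<lambda>k. 1 + t * 1)" using t by simp
  qed auto
  then show ?thesis using DERIV_unique[OF d1] by simp
qed

text \<open>By \<open>ker\<close> each facet area changes by o(t), so with \<open>grad\<close> the
  derivative of the volume along the line is o(t); the mean value bound makes the volume change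
  o(t^2). Second derivatives enter at (1,...,1) only.\<close>

lemma V_second_order_stationary:
  assumes ker: "\<And>j. j \<in> {1..n} \<Longrightarrow> (\<Sum>k\<in>{1..n}. M k j * f k) = 0"
    and grad: "(\<Sum>j\<in>{1..n}. A j (\<lambda>_. 1) * f j) = 0" and e: "\<eta> > 0"
  obtains r where "r > 0" "\<And>t. \<bar>t\<bar> < r \<Longrightarrow> \<bar>V (\<lambda>k. 1 + t * f k) - V (\<lambda>_. 1)\<bar> \<le> \<eta> * t\<^sup>2"
proof -
  define N where "N = (\<Sum>k\<in>{1..n}. \<bar>f k\<bar>) + 1"
  have N: "N \<ge> 1" "\<And>k. k \<in> {1..n} \<Longrightarrow> \<bar>f k\<bar> \<le> N"
    unfolding N_def using member_le_sum[of _ "{1..n}" "\<lambda>k. \<bar>f k\<bar>"] by (force simp: sum_nonneg)+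
  obtain r0 where r0: "r0 > 0" "\<And>c i. near n (\<lambda>_. 1) r0 c \<Longrightarrow> i \<in> {1..n} \<Longrightarrow> has_facet i c"
    using has_facet_near_one by blast
  have nr: "near n (\<lambda>_. 1) s (\<lambda>k. 1 + t * f k)" if "\<bar>t\<bar> < s / N" for s t
    unfolding near_def
  proof
    fix k assume k: "k \<in> {1..n}"
    have "\<bar>t\<bar> * \<bar>f k\<bar> \<le> \<bar>t\<bar> * N" using N(2)[OF k] by (intro mult_left_mono) auto
    also have "\<dots> < s" using that N(1) by (simp add: field_simps)
    finally show "\<bar>1 + t * f k - 1\<bar> < s" by (simp add: abs_mult)
  qed
  have der: "((\<lambda>t. V (\<lambda>k. 1 + t * f k)) has_real_derivative (\<Sum>j\<in>{1..n}. A j (\<lambda>k. 1 + t * f k) * f j)) (at t)"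
    if t: "\<bar>t\<bar> < r0 / N" for t
  proof -
    have "((\<lambda>s. V (\<lambda>k. (1 + t * f k) + s * f k)) has_real_derivative (\<Sum>j\<in>{1..n}. A j (\<lambda>k. 1 + t * f k) * f j)) (at 0)"
    proof (rule directional_derivative)
      fix k assume k: "k \<in> {1..n}"
      show "has_strict_partial n V (\<lambda>k. 1 + t * f k) k (A k (\<lambda>k. 1 + t * f k))"
        by (rule V_has_strict_partial[OF k r0(2)[OF nr[OF t] k]])
    qed (rule V_cong)
    then have "((\<lambda>s. V (\<lambda>k. 1 + (s + t) * f k)) has_real_derivative (\<Sum>j\<in>{1..n}. A j (\<lambda>k. 1 + t * f k) * f j)) (at 0)"
      by (simp add: algebra_simps)
    then show ?thesis using DERIV_shift[of "\<lambda>t. V (\<lambda>k. 1 + t * f k)" _ 0 t] by simp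
  qed
  have "\<forall>j\<in>{1..n}. \<exists>r>0. \<forall>t. \<bar>t\<bar> < r \<longrightarrow> \<bar>A j (\<lambda>k. 1 + t * f k) - A j (\<lambda>_. 1)\<bar> \<le> \<eta> / N * \<bar>t\<bar>"
  proof
    fix j assume j: "j \<in> {1..n}"
    have "((\<lambda>t. A j (\<lambda>k. 1 + t * f k)) has_real_derivative (\<Sum>k\<in>{1..n}. M k j * f k)) (at 0)"
      using j by (rule A_directional_derivative)
    then have "((\<lambda>t. A j (\<lambda>k. 1 + t * f k)) has_real_derivative 0) (at 0)" using ker[OF j] by simp
    then have "(\<lambda>t. (A j (\<lambda>k. 1 + t * f k) - A j (\<lambda>_. 1)) / t) \<midarrow>0\<rightarrow> 0"
      unfolding has_field_derivative_iff by simp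
    moreover have "\<eta> / N > 0" using e N by simp
    ultimately obtain r where r: "r > 0" "\<And>t. t \<noteq> 0 \<and> \<bar>t\<bar> < r \<Longrightarrow> \<bar>(A j (\<lambda>k. 1 + t * f k) - A j (\<lambda>_. 1)) / t\<bar> < \<eta> / N"
      using LIM_D[of "\<lambda>t. (A j (\<lambda>k. 1 + t * f k) - A j (\<lambda>_. 1)) / t" 0 0 "\<eta> / N"] by auto
    show "\<exists>r>0. \<forall>t. \<bar>t\<bar> < r \<longrightarrow> \<bar>A j (\<lambda>k. 1 + t * f k) - A j (\<lambda>_. 1)\<bar> \<le> \<eta> / N * \<bar>t\<bar>"
    proof (intro exI[of _ r] conjI allI impI r(1))
      fix t assume t: "\<bar>t\<bar> < r"
      show "\<bar>A j (\<lambda>k. 1 + t * f k) - A j (\<lambda>_. 1)\<bar> \<le> \<eta> / N * \<bar>t\<bar>"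
      proof (cases "t = 0")
        case False
        then have "\<bar>A j (\<lambda>k. 1 + t * f k) - A j (\<lambda>_. 1)\<bar> / \<bar>t\<bar> < \<eta> / N" using r(2)[of t] t by (simp add: abs_divide)
        then show ?thesis using False by (simp add: divide_less_eq less_imp_le)
      qed simp
    qed
  qed
  then obtain r where r: "\<And>j. j \<in> {1..n} \<Longrightarrow> r j > 0 \<and> (\<forall>t. \<bar>t\<bar> < r j \<longrightarrow> \<bar>A j (\<lambda>k. 1 + t * f k) - A j (\<lambda>_. 1)\<bar> \<le> \<eta> / N * \<bar>t\<bar>)"
    by metis
  define q where "q = Min (insert (r0 / N) (r ` {1..n}))"
  have q: "q > 0" "q \<le> r0 / N" "\<And>j. j \<in> {1..n} \<Longrightarrow> q \<le> r j"
  proof -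
    show "q > 0" unfolding q_def using r r0(1) N(1) by auto
    show "q \<le> r0 / N" unfolding q_def by (rule Min_le) auto
    show "q \<le> r j" if "j \<in> {1..n}" for j unfolding q_def by (rule Min_le) (use that in auto)
  qed
  have bd: "\<bar>\<Sum>j\<in>{1..n}. A j (\<lambda>k. 1 + t * f k) * f j\<bar> \<le> \<eta> * \<bar>t\<bar>" if t: "\<bar>t\<bar> < q" for t
  proof -
    have "(\<Sum>j\<in>{1..n}. A j (\<lambda>k. 1 + t * f k) * f j) = (\<Sum>j\<in>{1..n}. (A j (\<lambda>k. 1 + t * f k) - A j (\<lambda>_. 1)) * f j)"
      using grad by (simp add: left_diff_distrib sum_subtractf)
    also have "\<bar>\<dots>\<bar> \<le> (\<Sum>j\<in>{1..n}. \<bar>(A j (\<lambda>k. 1 + t * f k) - A j (\<lambda>_. 1)) * f j\<bar>)" by (rule sum_abs)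
    also have "\<dots> \<le> (\<Sum>j\<in>{1..n}. \<eta> / N * \<bar>t\<bar> * \<bar>f j\<bar>)"
      unfolding abs_mult
    proof (intro sum_mono mult_right_mono)
      fix j assume j: "j \<in> {1..n}"
      show "\<bar>A j (\<lambda>k. 1 + t * f k) - A j (\<lambda>_. 1)\<bar> \<le> \<eta> / N * \<bar>t\<bar>" using r[OF j] q(3)[OF j] t by auto
    qed auto
    also have "\<dots> = \<eta> / N * \<bar>t\<bar> * (N - 1)" unfolding N_def by (simp add: sum_distrib_left)
    also have "\<dots> \<le> \<eta> / N * \<bar>t\<bar> * N" using e N(1) by (intro mult_left_mono) auto
    also have "\<dots> = \<eta> * \<bar>t\<bar>" using N(1) by simp
    finally show ?thesis .
  qed
  show ?thesis
  proof (rule that[OF q(1)])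
    fix t assume t: "\<bar>t\<bar> < q"
    have "\<bar>V (\<lambda>k. 1 + t * f k) - V (\<lambda>k. 1 + 0 * f k)\<bar> \<le> (\<eta> * \<bar>t\<bar>) * \<bar>t - 0\<bar>"
    proof (rule field_differentiable_bound[of "{-\<bar>t\<bar>..\<bar>t\<bar>}" "\<lambda>t. V (\<lambda>k. 1 + t * f k)" "\<lambda>t. \<Sum>j\<in>{1..n}. A j (\<lambda>k. 1 + t * f k) * f j" "\<eta> * \<bar>t\<bar>" t 0, unfolded real_norm_def])
      fix z assume z: "z \<in> {-\<bar>t\<bar>..\<bar>t\<bar>}"
      then have zt: "\<bar>z\<bar> \<le> \<bar>t\<bar>" by auto
      then have zr: "\<bar>z\<bar> < r0 / N" using t q(2) by linarith
      show "((\<lambda>t. V (\<lambda>k. 1 + t * f k)) has_real_derivative (\<Sum>j\<in>{1..n}. A j (\<lambda>k. 1 + z * f k) * f j)) (at z within {-\<bar>t\<bar>..\<bar>t\<bar>})"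
        by (rule has_field_derivative_at_within[OF der[OF zr]])
      have "\<eta> * \<bar>z\<bar> \<le> \<eta> * \<bar>t\<bar>" using e zt by (intro mult_left_mono) auto
      then show "\<bar>\<Sum>j\<in>{1..n}. A j (\<lambda>k. 1 + z * f k) * f j\<bar> \<le> \<eta> * \<bar>t\<bar>" using bd[of z] zt t by linarith
    qed auto
    then show "\<bar>V (\<lambda>k. 1 + t * f k) - V (\<lambda>_. 1)\<bar> \<le> \<eta> * t\<^sup>2" by (simp add: power2_eq_square mult.assoc)
  qed
qed

end

section \<open>Functions that are stationary to second order\<close>

text \<open>The right-hand side is the derivative of the deficit in
  \<open>transport_rigidity\<close>. With p = sqrt (\<alpha> * \<beta>) <= q, the product of p *
  (\<alpha> + \<beta>) - 2 * \<alpha> * \<beta> with its conjugate is \<alpha> * \<beta> * (\<alpha>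
  - \<beta>)^2. The conjugate is at most 4 * \<kappa>'^2, and the final division by 2 * \<beta>
  makes this the 8.\<close>

lemma transport_gain:
  fixes \<alpha> \<beta> q :: real
  assumes k: "0 < \<kappa>" "\<kappa> \<le> \<alpha>" "\<kappa> \<le> \<beta>" "\<alpha> \<le> \<kappa>'" "\<beta> \<le> \<kappa>'" and q: "0 \<le> q" "\<alpha> * \<beta> \<le> q\<^sup>2"
  shows "\<kappa>^3 / (8 * \<kappa>'^2) * (\<alpha>/\<beta> - 1)\<^sup>2 \<le> q * (1 + \<alpha>/\<beta>) / 2 - \<alpha>"
proof -
  have pos: "\<alpha> > 0" "\<beta> > 0" "\<kappa>' > 0" using k by linarith+
  define p where "p = sqrt (\<alpha> * \<beta>)"
  have p: "p > 0" "p\<^sup>2 = \<alpha> * \<beta>" "p \<le> q"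
    using pos q unfolding p_def by (auto intro: real_le_lsqrt)
  have "\<alpha> * \<beta> \<le> \<kappa>' * \<kappa>'" using k pos by (intro mult_mono) auto
  then have "p\<^sup>2 \<le> \<kappa>'\<^sup>2" unfolding p(2) by (simp add: power2_eq_square)
  then have pk: "p \<le> \<kappa>'" using pos by (auto intro: power2_le_imp_le)
  define d where "d = p * (\<alpha> + \<beta>) + 2 * \<alpha> * \<beta>"
  have d: "d > 0" unfolding d_def using p pos by (simp add: add_pos_pos)
  have "p * (\<alpha> + \<beta>) \<le> \<kappa>' * (\<kappa>' + \<kappa>')" using pk p k pos by (intro mult_mono) auto
  moreover have "\<alpha> * \<beta> \<le> \<kappa>' * \<kappa>'" using k pos by (intro mult_mono) auto
  ultimately have dk: "d \<le> 4 * \<kappa>'\<^sup>2" unfolding d_def by (simp add: power2_eq_square)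
  have "(p * (\<alpha> + \<beta>) - 2 * \<alpha> * \<beta>) * d = p\<^sup>2 * (\<alpha> + \<beta>)\<^sup>2 - 4 * (\<alpha> * \<beta>)\<^sup>2"
    unfolding d_def by (simp add: power2_eq_square algebra_simps)
  also have "\<dots> = \<alpha> * \<beta> * (\<alpha> - \<beta>)\<^sup>2" unfolding p(2) by (simp add: power2_eq_square algebra_simps)
  finally have eq: "(p * (\<alpha> + \<beta>) - 2 * \<alpha> * \<beta>) * d = \<alpha> * \<beta> * (\<alpha> - \<beta>)\<^sup>2" .
  have "\<alpha> * \<beta> * (\<alpha> - \<beta>)\<^sup>2 / (4 * \<kappa>'\<^sup>2) \<le> \<alpha> * \<beta> * (\<alpha> - \<beta>)\<^sup>2 / d"
    using dk d pos by (intro divide_left_mono) auto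
  also have "\<dots> = p * (\<alpha> + \<beta>) - 2 * \<alpha> * \<beta>" using eq d by (simp add: field_simps)
  also have "\<dots> \<le> q * (\<alpha> + \<beta>) - 2 * \<alpha> * \<beta>" using p(3) pos by simp
  finally have 1: "\<alpha> * \<beta> * (\<alpha> - \<beta>)\<^sup>2 / (4 * \<kappa>'\<^sup>2) / (2 * \<beta>) \<le> (q * (\<alpha> + \<beta>) - 2 * \<alpha> * \<beta>) / (2 * \<beta>)"
    using pos by (intro divide_right_mono) auto
  have "(q * (\<alpha> + \<beta>) - 2 * \<alpha> * \<beta>) / (2 * \<beta>) = q * (1 + \<alpha>/\<beta>) / 2 - \<alpha>"
    using pos by (simp add: field_simps)
  moreover have "\<alpha> * \<beta> * (\<alpha> - \<beta>)\<^sup>2 / (4 * \<kappa>'\<^sup>2) / (2 * \<beta>) = \<alpha> * \<beta>\<^sup>2 / (8 * \<kappa>'\<^sup>2) * (\<alpha>/\<beta> - 1)\<^sup>2"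
    using pos by (simp add: field_simps power2_eq_square)
  moreover have "\<kappa>^3 / (8 * \<kappa>'\<^sup>2) * (\<alpha>/\<beta> - 1)\<^sup>2 \<le> \<alpha> * \<beta>\<^sup>2 / (8 * \<kappa>'\<^sup>2) * (\<alpha>/\<beta> - 1)\<^sup>2"
  proof -
    have "\<kappa> * \<kappa>\<^sup>2 \<le> \<alpha> * \<beta>\<^sup>2" using k pos by (intro mult_mono power_mono) auto
    then have "\<kappa>^3 \<le> \<alpha> * \<beta>\<^sup>2" by (simp add: power3_eq_cube power2_eq_square mult.assoc)
    then show ?thesis by (intro mult_right_mono divide_right_mono) auto
  qed
  ultimately show ?thesis using 1 by linarith
qed

text \<open>One-dimensional mass transport from the top: \<open>T\<close> matches the mass of \<open>Fm\<close> above \<open>x\<close> with the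
  mass of \<open>Fp\<close> above \<open>T x\<close>. By log-concavity the mass of \<open>F0\<close> above the midpoint exceeds the transported
  mass by at least a multiple of the integral of \<open>(T' - 1)\<^sup>2\<close>.\<close>

lemma transport_rigidity:
  fixes Fm F0 Fp am a0 ap :: "real \<Rightarrow> real"
  assumes dm: "\<And>x. lo < x \<Longrightarrow> x < hi \<Longrightarrow> (Fm has_real_derivative - am x) (at x)"
    and d0: "\<And>x. lo < x \<Longrightarrow> x < hi \<Longrightarrow> (F0 has_real_derivative - a0 x) (at x)"
    and dp: "\<And>x. lo < x \<Longrightarrow> x < hi \<Longrightarrow> (Fp has_real_derivative - ap x) (at x)"
    and \<kappa>: "0 < \<kappa>"
    and bm: "\<And>x. lo < x \<Longrightarrow> x < hi \<Longrightarrow> \<kappa> \<le> am x \<and> am x \<le> \<kappa>'"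
    and bp: "\<And>x. lo < x \<Longrightarrow> x < hi \<Longrightarrow> \<kappa> \<le> ap x \<and> ap x \<le> \<kappa>'"
    and b0: "\<And>x. lo < x \<Longrightarrow> x < hi \<Longrightarrow> 0 \<le> a0 x"
    and lc: "\<And>x y. lo < x \<Longrightarrow> x < hi \<Longrightarrow> lo < y \<Longrightarrow> y < hi \<Longrightarrow> am x * ap y \<le> (a0 ((x + y) / 2))\<^sup>2"
    and um: "lo < um" "um < hi" "Fm um = 0" and up: "lo < up" "up < hi" "Fp up = 0"
    and mid: "F0 ((um + up) / 2) = 0"
    and s: "lo < s" "s < um" and x1: "lo < x1" "x1 \<le> up" "Fm s \<le> Fp x1"
    and bottom: "\<And>y. lo < y \<Longrightarrow> y < hi \<Longrightarrow> Fp y = Fm s \<Longrightarrow> F0 ((s + y) / 2) \<le> Fm s + \<epsilon>"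
    and \<eta>: "0 < \<eta>"
  obtains y where "lo < y" "y < hi" "Fp y = Fm s"
    "\<bar>(y - s) - (up - um)\<bar> \<le> \<epsilon> / (2 * \<eta> * (\<kappa>^3 / (8 * \<kappa>'^2))) + \<eta> / 2 * (um - s)"
proof -
  have decm: "Fm y < Fm x" if "lo < x" "x < y" "y < hi" for x y
    by (rule DERIV_neg_imp_decreasing[OF that(2)]) (use dm bm \<kappa> that in \<open>smt (verit)\<close>)
  have decp: "Fp y < Fp x" if "lo < x" "x < y" "y < hi" for x y
    by (rule DERIV_neg_imp_decreasing[OF that(2)]) (use dp bp \<kappa> that in \<open>smt (verit)\<close>)
  have cm: "continuous_on {s..um} Fm"
    by (rule DERIV_continuous_on[where D="\<lambda>x. - am x"]) (use dm s um in \<open>auto intro: has_field_derivative_at_within\<close>)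
  have cp: "continuous_on {x1..up} Fp"
    by (rule DERIV_continuous_on[where D="\<lambda>x. - ap x"]) (use dp x1 up in \<open>auto intro: has_field_derivative_at_within\<close>)
  have injp: "inj_on Fp {x1..up}"
  proof (rule inj_onI)
    fix x y assume xy: "x \<in> {x1..up}" "y \<in> {x1..up}" "Fp x = Fp y"
    show "x = y" using decp[of x y] decp[of y x] xy x1(1) up(2) by (cases x y rule: linorder_cases) auto
  qed
  define g where "g = the_inv_into {x1..up} Fp"
  have gF: "g (Fp y) = y" if "y \<in> {x1..up}" for y unfolding g_def using injp that by (rule the_inv_into_f_f)
  have img: "Fp ` {x1..up} = {0..Fp x1}"
  proof (intro equalityI subsetI)
    fix p assume "p \<in> Fp ` {x1..up}"
    then obtain y where y: "x1 \<le> y" "y \<le> up" "p = Fp y" by auto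
    have "Fp up \<le> Fp y" using decp[of y up] y x1 up by (cases "y = up") auto
    moreover have "Fp y \<le> Fp x1" using decp[of x1 y] y x1 up by (cases "y = x1") auto
    ultimately show "p \<in> {0..Fp x1}" using y up(3) by simp
  next
    fix p assume p: "p \<in> {0..Fp x1}"
    then obtain y where "x1 \<le> y" "y \<le> up" "Fp y = p"
      using IVT2'[of Fp up p x1] cp x1 up by auto
    then show "p \<in> Fp ` {x1..up}" by auto
  qed
  have Fg: "Fp (g p) = p" "x1 \<le> g p" "g p \<le> up" if "0 \<le> p" "p \<le> Fp x1" for p
  proof -
    have "p \<in> Fp ` {x1..up}" using that unfolding img by simp
    then obtain y where "y \<in> {x1..up}" "p = Fp y" by blast
    then show "Fp (g p) = p" "x1 \<le> g p" "g p \<le> up" using gF by auto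
  qed
  have cg: "continuous_on {0..Fp x1} g"
    using continuous_on_inv[OF cp compact_Icc, of g] gF unfolding img by auto
  have dg: "(g has_real_derivative inverse (- ap (g p))) (at p)" if p: "0 < p" "p < Fp x1" for p
  proof (rule DERIV_inverse_function[where a=0 and b="Fp x1"])
    have *: "lo < g p" "g p < hi" using Fg[of p] p x1 up by auto
    show "(Fp has_real_derivative - ap (g p)) (at (g p))" using dp * by blast
    show "- ap (g p) \<noteq> 0" using bp[OF *] \<kappa> by linarith
    show "isCont g p" using cg p by (intro continuous_on_interior[of "{0..Fp x1}"]) auto
  qed (use p Fg in auto)
  have Fmr: "0 \<le> Fm x" "Fm x \<le> Fm s" "Fm x \<le> Fp x1" if "s \<le> x" "x \<le> um" for x
  proof -
    show "0 \<le> Fm x" using decm[of x um] that s um by (cases "x = um") auto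
    show *: "Fm x \<le> Fm s" using decm[of s x] that s um by (cases "x = s") auto
    show "Fm x \<le> Fp x1" using * x1(3) by linarith
  qed
  define T where "T x = g (Fm x)" for x
  have T: "Fp (T x) = Fm x" "x1 \<le> T x" "T x \<le> up" "lo < T x" "T x < hi" if "s \<le> x" "x \<le> um" for x
    unfolding T_def using Fg[of "Fm x"] Fmr[OF that] x1 up by auto
  have Tum: "T um = up" unfolding T_def using gF[of up] x1(2) um(3) up(3) by auto
  have cT: "continuous_on {s..um} T"
    unfolding T_def by (rule continuous_on_compose2[OF cg cm]) (use Fmr in auto)
  \<comment> \<open>The deficit: 0 at the top \<open>um\<close>, at least -\<epsilon> at
    \<open>s\<close> by \<open>bottom\<close>, and with derivative at least c * (T' - 1)^2 in
    between.\<close>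
  define D where "D x = Fm x - F0 ((x + T x) / 2)" for x
  define c where "c = \<kappa>^3 / (8 * \<kappa>'^2)"
  have "\<kappa>' > 0" using bm[of s] s um \<kappa> by linarith
  then have c: "c > 0" unfolding c_def using \<kappa> by simp
  have midr: "lo < (x + T x) / 2" "(x + T x) / 2 < hi" if "s \<le> x" "x \<le> um" for x
    using T(4,5)[OF that] that s um by auto
  have cF0: "continuous_on {lo<..<hi} F0"
    by (rule DERIV_continuous_on[where D="\<lambda>x. - a0 x"]) (use d0 in \<open>auto intro: has_field_derivative_at_within\<close>)
  have cD: "continuous_on {s..um} D"
    unfolding D_def by (intro continuous_intros cm cT continuous_on_compose2[OF cF0]) (use midr in auto)
  have der: "\<exists>\<rho> D'. (T has_real_derivative \<rho>) (at x) \<and> (D has_real_derivative D') (at x) \<and> c * (\<rho> - 1)\<^sup>2 \<le> D'"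
    if x: "s < x" "x < um" for x
  proof -
    have xr: "s \<le> x" "x \<le> um" "lo < x" "x < hi" using x s um by auto
    define \<rho> where "\<rho> = am x / ap (T x)"
    have Fx: "0 < Fm x" "Fm x < Fp x1" using decm[of x um] decm[of s x] x s um x1 by auto
    have "((\<lambda>x. g (Fm x)) has_real_derivative inverse (- ap (g (Fm x))) * - am x) (at x)"
      by (rule DERIV_chain2[OF dg[OF Fx] dm[OF xr(3,4)]])
    then have dT: "(T has_real_derivative \<rho>) (at x)"
      unfolding T_def[abs_def] \<rho>_def by (simp add: field_simps)
    have "((\<lambda>x. F0 ((x + T x) / 2)) has_real_derivative - a0 ((x + T x) / 2) * ((1 + \<rho>) / 2)) (at x)"
      by (rule DERIV_chain2[where g="\<lambda>x. (x + T x) / 2", OF d0[OF midr[OF xr(1,2)]]]) (auto intro!: derivative_eq_intros dT)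
    then have dD: "(D has_real_derivative - am x - - a0 ((x + T x) / 2) * ((1 + \<rho>) / 2)) (at x)"
      unfolding D_def[abs_def] by (intro DERIV_diff dm[OF xr(3,4)])
    have "\<kappa>^3 / (8 * \<kappa>'^2) * (am x / ap (T x) - 1)\<^sup>2 \<le> a0 ((x + T x) / 2) * (1 + am x / ap (T x)) / 2 - am x"
      using bm[OF xr(3,4)] bp[OF T(4,5)[OF xr(1,2)]] b0[OF midr[OF xr(1,2)]] lc[OF xr(3,4) T(4,5)[OF xr(1,2)]] \<kappa>
      by (intro transport_gain) auto
    then have "c * (\<rho> - 1)\<^sup>2 \<le> - am x - - a0 ((x + T x) / 2) * ((1 + \<rho>) / 2)"
      unfolding c_def \<rho>_def by simp
    then show ?thesis using dT dD by blast
  qed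
  \<comment> \<open>Replaces Cauchy--Schwarz and avoids integrating T'. Young's inequality |\<rho> -
    1| <= (\<rho> - 1)^2 / (2 * \<eta>) + \<eta> / 2 makes the function increasing for both signs
    \<sigma>, and the two signs together give the absolute value.\<close>
  have mono: "D s / (2 * \<eta> * c) + \<eta> / 2 * s + \<sigma> * (T s - s) \<le> D um / (2 * \<eta> * c) + \<eta> / 2 * um + \<sigma> * (T um - um)"
    if \<sigma>: "\<sigma> = 1 \<or> \<sigma> = - 1" for \<sigma> :: real
  proof (rule DERIV_nonneg_imp_increasing_open[of s um "\<lambda>x. D x / (2 * \<eta> * c) + \<eta> / 2 * x + \<sigma> * (T x - x)"])
    show "s \<le> um" using s by simp
    show "continuous_on {s..um} (\<lambda>x. D x / (2 * \<eta> * c) + \<eta> / 2 * x + \<sigma> * (T x - x))"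
      using c \<eta> by (intro continuous_intros cD cT) auto
    fix x assume x: "s < x" "x < um"
    obtain \<rho> D' where r: "(T has_real_derivative \<rho>) (at x)" "(D has_real_derivative D') (at x)" "c * (\<rho> - 1)\<^sup>2 \<le> D'"
      using der[OF x] by blast
    have "((\<lambda>x. D x / (2 * \<eta> * c) + \<eta> / 2 * x + \<sigma> * (T x - x)) has_real_derivative
        D' / (2 * \<eta> * c) + \<eta> / 2 + \<sigma> * (\<rho> - 1)) (at x)"
      using c \<eta> by (auto intro!: derivative_eq_intros r(1,2))
    moreover have "0 \<le> D' / (2 * \<eta> * c) + \<eta> / 2 + \<sigma> * (\<rho> - 1)"
    proof -
      have "0 \<le> ((\<rho> - 1) + \<sigma> * \<eta>)\<^sup>2 / (2 * \<eta>)" using \<eta> by simp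
      also have "\<dots> = (\<rho> - 1)\<^sup>2 / (2 * \<eta>) + \<eta> / 2 + \<sigma> * (\<rho> - 1)"
        using \<eta> \<sigma> by (auto simp: power2_eq_square field_simps)
      also have "(\<rho> - 1)\<^sup>2 / (2 * \<eta>) = c * (\<rho> - 1)\<^sup>2 / (2 * \<eta> * c)" using c by simp
      also have "\<dots> \<le> D' / (2 * \<eta> * c)" using r(3) c \<eta> by (intro divide_right_mono) auto
      finally show ?thesis by simp
    qed
    ultimately show "\<exists>y. ((\<lambda>x. D x / (2 * \<eta> * c) + \<eta> / 2 * x + \<sigma> * (T x - x)) has_real_derivative y) (at x) \<and> 0 \<le> y"
      by blast
  qed
  have Dum: "D um = 0" unfolding D_def Tum using um(3) mid by simp
  have sr: "s \<le> s" "s \<le> um" using s by auto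
  have "F0 ((s + T s) / 2) \<le> Fm s + \<epsilon>" by (rule bottom[OF T(4,5,1)[OF sr]])
  then have "- D s \<le> \<epsilon>" unfolding D_def by simp
  then have "- D s / (2 * \<eta> * c) \<le> \<epsilon> / (2 * \<eta> * c)" using c \<eta> by (intro divide_right_mono) auto
  then have "\<bar>(T s - s) - (up - um)\<bar> \<le> \<epsilon> / (2 * \<eta> * c) + \<eta> / 2 * (um - s)"
  proof -
    have "- (D s / (2 * \<eta> * c)) \<le> \<epsilon> / (2 * \<eta> * c)"
      using \<open>- D s / (2 * \<eta> * c) \<le> \<epsilon> / (2 * \<eta> * c)\<close> by (simp only: minus_divide_left)
    moreover have "D s / (2 * \<eta> * c) + \<eta> / 2 * s + (T s - s) \<le> \<eta> / 2 * um + (up - um)"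
      using mono[of 1] unfolding Dum Tum by simp
    moreover have "D s / (2 * \<eta> * c) + \<eta> / 2 * s - (T s - s) \<le> \<eta> / 2 * um - (up - um)"
      using mono[of "-1"] unfolding Dum Tum by simp
    moreover have "\<eta> / 2 * (um - s) = \<eta> / 2 * um - \<eta> / 2 * s" by (simp add: right_diff_distrib)
    ultimately show ?thesis by linarith
  qed
  then show ?thesis using that[of "T s"] T[OF sr] unfolding c_def by blast
qed

text \<open>Rotating \<open>w\<close> to a coordinate axis places the slab inside a box of width h /
  norm w in that direction and 2 * R in all others.\<close>

lemma slab_measure_le:
  fixes w :: "real^'d"
  assumes w: "w \<noteq> 0" and R: "R \<ge> 0"
  shows "\<exists>C\<ge>0. \<forall>\<alpha> h. h \<ge> 0 \<longrightarrow> measure lebesgue (cball 0 R \<inter> {x. \<alpha> \<le> x \<bullet> w \<and> x \<bullet> w \<le> \<alpha> + h}) \<le> C * h"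
proof -
  obtain k :: 'd where True by blast
  define b where "b = norm w *\<^sub>R axis k (1::real)"
  have nb: "norm w = norm b" unfolding b_def by simp
  obtain f where f: "orthogonal_transformation f" "f w = b"
    using orthogonal_transformation_exists[OF nb] by blast
  define P where "P = (\<Prod>l\<in>UNIV-{k}. 2 * R)"
  have P: "P \<ge> 0" unfolding P_def using R by (intro prod_nonneg) auto
  show ?thesis
  proof (intro exI[of _ "P / norm w"] conjI allI impI)
    show "P / norm w \<ge> 0" using P by simp
    fix \<alpha> h :: real assume h: "h \<ge> 0"
    let ?S = "cball 0 R \<inter> {x. \<alpha> \<le> x \<bullet> w \<and> x \<bullet> w \<le> \<alpha> + h}"
    have "?S = cball 0 R \<inter> ({x. \<alpha> \<le> x \<bullet> w} \<inter> {x. x \<bullet> w \<le> \<alpha> + h})" by auto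
    moreover have "compact \<dots>"
      by (intro compact_Int_closed compact_cball closed_Int closed_Collect_le continuous_intros)
    ultimately have cS: "compact ?S" by simp
    then have S: "?S \<in> lmeasurable" by (rule lmeasurable_compact)
    let ?a = "\<chi> l. if l = k then \<alpha> / norm w else - R" and ?b = "\<chi> l. if l = k then (\<alpha> + h) / norm w else R"
    have wp: "norm w > 0" using w by simp
    have sub: "f ` ?S \<subseteq> cbox ?a ?b"
    proof
      fix y assume "y \<in> f ` ?S"
      then obtain x where x: "y = f x" "norm x \<le> R" "\<alpha> \<le> x \<bullet> w" "x \<bullet> w \<le> \<alpha> + h" by auto
      have "y \<bullet> b = x \<bullet> w" using f x(1) unfolding orthogonal_transformation_def by metis
      then have yk: "y $ k * norm w = x \<bullet> w" unfolding b_def by (simp add: inner_axis mult.commute)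
      have ny: "norm y \<le> R" using x orthogonal_transformation_norm[OF f(1)] by simp
      have "\<alpha> / norm w \<le> y $ k" "y $ k \<le> (\<alpha> + h) / norm w"
        using yk x wp by (simp_all add: divide_le_eq le_divide_eq)
      moreover have "- R \<le> y $ l" "y $ l \<le> R" for l
        using component_le_norm_cart[of y l] ny by linarith+
      ultimately show "y \<in> cbox ?a ?b" by (auto simp: mem_box_cart)
    qed
    have "measure lebesgue ?S = measure lebesgue (f ` ?S)"
      by (rule orthogonal_image_measure[OF f(1) S, symmetric])
    also have "\<dots> \<le> measure lebesgue (cbox ?a ?b)"
    proof (rule measure_mono_fmeasurable[OF sub])
      show "f ` ?S \<in> sets lebesgue"
        using compact_continuous_image[OF linear_continuous_on[OF linear_conv_bounded_linear[THEN iffD1, OF orthogonal_transformation_linear[OF f(1)]]] cS]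
        by (intro fmeasurableD lmeasurable_compact)
    qed simp
    also have "\<dots> = (\<Prod>l\<in>UNIV. ?b $ l - ?a $ l)"
    proof -
      have "?a \<in> cbox ?a ?b" using R h wp by (auto simp: mem_box_cart divide_right_mono)
      then have "cbox ?a ?b \<noteq> {}" by blast
      from content_cbox_cart[OF this] show ?thesis by (simp only: measure_completion sets_lborel borel_closed closed_cbox)
    qed
    also have "\<dots> = (?b $ k - ?a $ k) * (\<Prod>l\<in>UNIV-{k}. ?b $ l - ?a $ l)"
      by (rule prod.remove) auto
    also have "(\<Prod>l\<in>UNIV-{k}. ?b $ l - ?a $ l) = P" unfolding P_def by (intro prod.cong) auto
    also have "?b $ k - ?a $ k = h / norm w" by (simp add: diff_divide_distrib[symmetric])
    finally show "measure lebesgue ?S \<le> P / norm w * h" by (simp add: mult.commute)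
  qed
qed

section \<open>Lipschitz and concavity estimates for volumes and facet areas\<close>

context exposed_configuration
begin

text \<open>Changing one coordinate adds or removes part of a slab inside a fixed ball. The
  coordinates are bounded from above only, so that cuts far below the body are included.\<close>

lemma V_lipschitz:
  assumes T: "T \<ge> 0"
  obtains L where "L \<ge> 0" "\<And>c c'. (\<And>k. k \<in> {1..n} \<Longrightarrow> c k \<le> T \<and> c' k \<le> T) \<Longrightarrow> \<bar>V c - V c'\<bar> \<le> L * (\<Sum>k\<in>{1..n}. \<bar>c k - c' k\<bar>)"
proof -
  obtain R where R: "R \<ge> 0" "\<And>c t. t \<ge> 0 \<Longrightarrow> (\<And>k. k \<in> {1..n} \<Longrightarrow> c k \<le> t) \<Longrightarrow> generalized_polar n v c \<subseteq> cball 0 (R * t)"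
    using polar_bounded by blast
  have RT: "R * T \<ge> 0" using R T by simp
  have "\<forall>j\<in>{1..n}. \<exists>C\<ge>0. \<forall>\<alpha> h. h \<ge> 0 \<longrightarrow> measure lebesgue (cball 0 (R * T) \<inter> {x. \<alpha> \<le> x \<bullet> v j \<and> x \<bullet> v j \<le> \<alpha> + h}) \<le> C * h"
    using slab_measure_le[OF v_nonzero RT] by blast
  from bchoice[OF this] obtain C where C: "\<And>j. j \<in> {1..n} \<Longrightarrow> C j \<ge> 0"
    "\<And>j \<alpha> h. j \<in> {1..n} \<Longrightarrow> h \<ge> 0 \<Longrightarrow> measure lebesgue (cball 0 (R * T) \<inter> {x. \<alpha> \<le> x \<bullet> v j \<and> x \<bullet> v j \<le> \<alpha> + h}) \<le> C j * h"
    by blast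
  define L where "L = (\<Sum>j\<in>{1..n}. C j)"
  have L: "C j \<le> L" if "j \<in> {1..n}" for j unfolding L_def using C(1) that by (intro member_le_sum) auto
  have L0: "L \<ge> 0" unfolding L_def using C(1) by (intro sum_nonneg) auto
  have up: "\<bar>V (c(j := x)) - V (c(j := y))\<bar> \<le> L * (x - y)"
    if c: "\<And>k. k \<in> {1..n} \<Longrightarrow> c k \<le> T" "x \<le> T" "y \<le> x" and j: "j \<in> {1..n}" for c j x y
  proof -
    let ?c = "c(j := x)"
    have "corner n v {j} ?c (\<lambda>_. x - y) \<subseteq> cball 0 (R * T) \<inter> {z. y \<le> z \<bullet> v j \<and> z \<bullet> v j \<le> y + (x - y)}"
    proof -
      have "generalized_polar n v ?c \<subseteq> cball 0 (R * T)" by (rule R(2)[OF T]) (use c in auto)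
      then have "corner n v {j} ?c (\<lambda>_. x - y) \<subseteq> cball 0 (R * T)" using corner_subset by blast
      moreover have "corner n v {j} ?c (\<lambda>_. x - y) \<subseteq> {z. y \<le> z \<bullet> v j \<and> z \<bullet> v j \<le> y + (x - y)}"
        unfolding corner_def generalized_polar_def using j by auto
      ultimately show ?thesis by blast
    qed
    moreover have "cball 0 (R * T) \<inter> {z. y \<le> z \<bullet> v j \<and> z \<bullet> v j \<le> y + (x - y)} \<in> lmeasurable"
    proof -
      have "cball 0 (R * T) \<inter> {z. y \<le> z \<bullet> v j \<and> z \<bullet> v j \<le> y + (x - y)} = cball 0 (R * T) \<inter> ({z. y \<le> z \<bullet> v j} \<inter> {z. z \<bullet> v j \<le> y + (x - y)})" by auto
      moreover have "compact \<dots>"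
        by (intro compact_Int_closed compact_cball closed_Int closed_Collect_le continuous_intros)
      ultimately show ?thesis by (simp add: lmeasurable_compact)
    qed
    ultimately have "measure lebesgue (corner n v {j} ?c (\<lambda>_. x - y)) \<le> measure lebesgue (cball 0 (R * T) \<inter> {z. y \<le> z \<bullet> v j \<and> z \<bullet> v j \<le> y + (x - y)})"
      using fmeasurableD[OF corner_lmeasurable] by (intro measure_mono_fmeasurable)
    also have "\<dots> \<le> C j * (x - y)" using C(2)[OF j, of "x - y" y] c(3) by simp
    also have "\<dots> \<le> L * (x - y)" using L[OF j] c(3) by (intro mult_right_mono) auto
    finally have le: "measure lebesgue (corner n v {j} ?c (\<lambda>_. x - y)) \<le> L * (x - y)" .
    have "measure lebesgue (corner n v {j} ?c (\<lambda>_. x - y)) = V ?c - V (c(j := y))"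
      using corner1_measure[OF j, of "\<lambda>_. x - y" ?c] c(3) by simp
    then show ?thesis using le measure_nonneg[of lebesgue "corner n v {j} ?c (\<lambda>_. x - y)"] by linarith
  qed
  have one: "\<bar>V (c(j := x)) - V (c(j := y))\<bar> \<le> L * \<bar>x - y\<bar>"
    if c: "\<And>k. k \<in> {1..n} \<Longrightarrow> c k \<le> T" "x \<le> T" "y \<le> T" and j: "j \<in> {1..n}" for c j x y
    using up[where c=c and x=x and y=y, OF c(1,2) _ j] up[where c=c and x=y and y=x, OF c(1,3) _ j] by (cases "y \<le> x") (auto simp: abs_minus_commute)
  have ind: "\<bar>V c - V c'\<bar> \<le> L * (\<Sum>k\<in>S. \<bar>c k - c' k\<bar>)"
    if "finite S" "S \<subseteq> {1..n}" "\<And>k. k \<in> {1..n} \<Longrightarrow> c k \<le> T \<and> c' k \<le> T" "\<And>k. k \<in> {1..n} - S \<Longrightarrow> c k = c' k" for S c c'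
    using that
  proof (induction S arbitrary: c rule: finite_induct)
    case empty
    have "V c = V c'" by (rule V_cong) (use empty in auto)
    then show ?case by simp
  next
    case (insert j S)
    have j: "j \<in> {1..n}" using insert by auto
    let ?c = "c(j := c' j)"
    have "\<bar>V ?c - V c'\<bar> \<le> L * (\<Sum>k\<in>S. \<bar>?c k - c' k\<bar>)"
      by (rule insert.IH) (use insert.prems j in auto)
    also have "(\<Sum>k\<in>S. \<bar>?c k - c' k\<bar>) = (\<Sum>k\<in>S. \<bar>c k - c' k\<bar>)"
      using insert.hyps by (intro sum.cong) auto
    finally have 1: "\<bar>V ?c - V c'\<bar> \<le> L * (\<Sum>k\<in>S. \<bar>c k - c' k\<bar>)" .
    have "\<bar>V (c(j := c j)) - V ?c\<bar> \<le> L * \<bar>c j - c' j\<bar>"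
      by (rule one) (use insert.prems j in auto)
    then have 2: "\<bar>V c - V ?c\<bar> \<le> L * \<bar>c j - c' j\<bar>" by simp
    have "\<bar>V c - V c'\<bar> \<le> L * \<bar>c j - c' j\<bar> + L * (\<Sum>k\<in>S. \<bar>c k - c' k\<bar>)"
      using 1 2 by linarith
    also have "\<dots> = L * (\<Sum>k\<in>insert j S. \<bar>c k - c' k\<bar>)" using insert.hyps by (simp add: distrib_left)
    finally show ?case .
  qed
  show ?thesis by (rule that[OF L0]) (rule ind, auto)
qed

lemma V_midpoint:
  assumes c: "\<And>k. k \<in> {1..n} \<Longrightarrow> c k = (c1 k + c2 k) / 2"
  shows "V c1 * V c2 \<le> (V c)\<^sup>2"
  unfolding V_def
proof (rule brunn_minkowski_convex[OF convex_polar bounded_polar convex_polar bounded_polar polar_lmeasurable])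
  fix x y assume "x \<in> generalized_polar n v c1" "y \<in> generalized_polar n v c2"
  then show "(1/2) *\<^sub>R (x + y) \<in> generalized_polar n v c"
    using c unfolding generalized_polar_def by (fastforce simp: inner_add_left)
qed

lemma A_quotient:
  assumes j: "j \<in> {1..n}" and g: "has_facet j c"
  shows "((\<lambda>\<delta>. (V c - V (c(j := c j - \<delta>))) / \<delta>) \<longlongrightarrow> A j c) (at_right 0)"
proof -
  have "(\<lambda>h. (V (c(j := c j + h)) - V c) / h) \<midarrow>0\<rightarrow> A j c"
    using has_strict_partial_imp_DERIV[OF V_has_strict_partial[OF j g]] unfolding DERIV_def by simp
  moreover have "filterlim (\<lambda>x::real. - x) (at 0) (at_right 0)"
    by (auto simp: filterlim_at eventually_at_filter intro!: tendsto_eq_intros)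
  ultimately have "((\<lambda>\<delta>. (V (c(j := c j + (- \<delta>))) - V c) / (- \<delta>)) \<longlongrightarrow> A j c) (at_right 0)"
    by (rule filterlim_compose)
  moreover have "(V (c(j := c j + (- \<delta>))) - V c) / (- \<delta>) = (V c - V (c(j := c j - \<delta>))) / \<delta>" for \<delta>
    by (simp add: minus_divide_left)
  ultimately show ?thesis by simp
qed

text \<open>Brunn--Minkowski for the layers of thickness \<delta> under the j-th facets, divided by
  \<delta>^2, in the limit \<delta> to 0.\<close>

lemma A_midpoint:
  assumes j: "j \<in> {1..n}" and g: "has_facet j c1" "has_facet j c2" "has_facet j c"
    and c: "\<And>k. k \<in> {1..n} \<Longrightarrow> c k = (c1 k + c2 k) / 2"
  shows "A j c1 * A j c2 \<le> (A j c)\<^sup>2"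
proof (rule tendsto_le[of "at_right 0"])
  show "((\<lambda>\<delta>. ((V c - V (c(j := c j - \<delta>))) / \<delta>)\<^sup>2) \<longlongrightarrow> (A j c)\<^sup>2) (at_right 0)"
    by (intro tendsto_power A_quotient j g)
  show "((\<lambda>\<delta>. ((V c1 - V (c1(j := c1 j - \<delta>))) / \<delta>) * ((V c2 - V (c2(j := c2 j - \<delta>))) / \<delta>)) \<longlongrightarrow> A j c1 * A j c2) (at_right 0)"
    by (intro tendsto_mult A_quotient j g)
  show "\<forall>\<^sub>F \<delta> in at_right 0. ((V c1 - V (c1(j := c1 j - \<delta>))) / \<delta>) * ((V c2 - V (c2(j := c2 j - \<delta>))) / \<delta>)
      \<le> ((V c - V (c(j := c j - \<delta>))) / \<delta>)\<^sup>2"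
    using eventually_at_right_less[of 0]
  proof eventually_elim
    fix \<delta> :: real assume d: "0 < \<delta>"
    have *: "measure lebesgue (corner n v {j} c (\<lambda>_. \<delta>)) = V c - V (c(j := c j - \<delta>))" for c
      using corner1_measure[OF j, of "\<lambda>_. \<delta>" c] d by simp
    have "measure lebesgue (corner n v {j} c1 (\<lambda>_. \<delta>)) * measure lebesgue (corner n v {j} c2 (\<lambda>_. \<delta>)) \<le> (measure lebesgue (corner n v {j} c (\<lambda>_. \<delta>)))\<^sup>2"
    proof (rule brunn_minkowski_convex[OF convex_corner bounded_corner convex_corner bounded_corner corner_lmeasurable])
      fix x y assume xy: "x \<in> corner n v {j} c1 (\<lambda>_. \<delta>)" "y \<in> corner n v {j} c2 (\<lambda>_. \<delta>)"
      have "((1/2) *\<^sub>R (x + y)) \<bullet> v k \<le> c k" if "k \<in> {1..n}" for k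
        using xy c[OF that] that unfolding corner_def generalized_polar_def by (fastforce simp: inner_add_left)
      moreover have "c j - \<delta> \<le> ((1/2) *\<^sub>R (x + y)) \<bullet> v j"
        using xy c[OF j] unfolding corner_def by (auto simp: inner_add_left field_simps)
      ultimately show "(1/2) *\<^sub>R (x + y) \<in> corner n v {j} c (\<lambda>_. \<delta>)"
        unfolding corner_def generalized_polar_def by blast
    qed
    then show "((V c1 - V (c1(j := c1 j - \<delta>))) / \<delta>) * ((V c2 - V (c2(j := c2 j - \<delta>))) / \<delta>)
      \<le> ((V c - V (c(j := c j - \<delta>))) / \<delta>)\<^sup>2"
      unfolding * using d by (simp add: power2_eq_square divide_right_mono)
  qed
qed simp

lemma has_facet_between:
  assumes g: "has_facet i (c(i := p))" "has_facet i (c(i := q))" and x: "p \<le> x" "x \<le> q"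
  shows "has_facet i (c(i := x))"
proof (cases "p = q")
  case False
  then have pq: "p < q" using x by simp
  obtain y where y: "y \<bullet> v i = p" "\<And>k. k \<in> {1..n}-{i} \<Longrightarrow> y \<bullet> v k < c k" using g(1) unfolding has_facet_def by auto
  obtain z where z: "z \<bullet> v i = q" "\<And>k. k \<in> {1..n}-{i} \<Longrightarrow> z \<bullet> v k < c k" using g(2) unfolding has_facet_def by auto
  define t where "t = (x - p) / (q - p)"
  have t: "0 \<le> t" "t \<le> 1" using x pq unfolding t_def by auto
  have tq: "t * (q - p) = x - p" unfolding t_def using pq by simp
  show ?thesis unfolding has_facet_def
  proof (intro exI[of _ "(1 - t) *\<^sub>R y + t *\<^sub>R z"] conjI ballI)
    show "((1 - t) *\<^sub>R y + t *\<^sub>R z) \<bullet> v i = (c(i := x)) i"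
      using tq by (simp add: inner_add_left y(1) z(1) algebra_simps)
    fix k assume k: "k \<in> {1..n} - {i}"
    have "(1 - t) * (y \<bullet> v k) + t * (z \<bullet> v k) < c k"
    proof -
      have "(1 - t) * (c k - y \<bullet> v k) + t * (c k - z \<bullet> v k) > 0"
        using y(2)[OF k] z(2)[OF k] t by (cases "t = 0") (auto intro: add_nonneg_pos)
      then show ?thesis by (simp add: algebra_simps)
    qed
    then show "((1 - t) *\<^sub>R y + t *\<^sub>R z) \<bullet> v k < (c(i := x)) k" using k by (simp add: inner_add_left)
  qed
qed (use assms in auto)

text \<open>Around each level of the segment continuity keeps the area within half of its value
  there; finitely many such neighborhoods cover the segment. Hence the factors 1/2 and 3/2 in
  \<open>\<kappa>\<close> and \<open>\<kappa>'\<close>.\<close>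

lemma A_bounds_on_segment:
  fixes f :: "nat \<Rightarrow> real"
  assumes i: "i \<in> {1..n}" and pq: "p \<le> q" and g: "has_facet i ((\<lambda>_. 1)(i := p))" "has_facet i ((\<lambda>_. 1)(i := q))"
  obtains r \<kappa> \<kappa>' where "r > 0" "\<kappa> > 0"
    "\<And>t x. \<bar>t\<bar> < r \<Longrightarrow> p \<le> x \<Longrightarrow> x \<le> q \<Longrightarrow> has_facet i ((\<lambda>k. 1 + t * f k)(i := x)) \<and>
       \<kappa> \<le> A i ((\<lambda>k. 1 + t * f k)(i := x)) \<and> A i ((\<lambda>k. 1 + t * f k)(i := x)) \<le> \<kappa>'"
proof -
  let ?c = "\<lambda>x. (\<lambda>_. 1::real)(i := x)"
  define N where "N = (\<Sum>k\<in>{1..n}. \<bar>f k\<bar>) + 1"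
  have N: "N \<ge> 1" "\<And>k. k \<in> {1..n} \<Longrightarrow> \<bar>f k\<bar> \<le> N"
    unfolding N_def using member_le_sum[of _ "{1..n}" "\<lambda>k. \<bar>f k\<bar>"] by (force simp: sum_nonneg)+
  have gx: "has_facet i (?c x)" if "p \<le> x" "x \<le> q" for x by (rule has_facet_between[OF g that])
  have "\<exists>\<rho>>0. \<forall>c'. near n (?c x) \<rho> c' \<longrightarrow> has_facet i c' \<and> \<bar>A i c' - A i (?c x)\<bar> \<le> A i (?c x) / 2"
    if x: "p \<le> x" "x \<le> q" for x
  proof -
    obtain r where r: "r > 0" "\<And>c'. near n (?c x) r c' \<Longrightarrow> has_facet i c'"
      using has_facet_open[OF i gx[OF x]] by blast
    have "A i (?c x) / 2 > 0" using A_pos[OF i gx[OF x]] by simp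
    from has_strict_partial_near[OF V_has_strict_partial[OF i gx[OF x]] this]
    obtain s where s: "s > 0" "\<And>c' D'. near n (?c x) s c' \<Longrightarrow> has_strict_partial n V c' i D' \<Longrightarrow> \<bar>D' - A i (?c x)\<bar> \<le> A i (?c x) / 2"
      by blast
    show ?thesis
    proof (intro exI[of _ "min r s"] conjI allI impI)
      show "min r s > 0" using r s by simp
      fix c' assume c': "near n (?c x) (min r s) c'"
      show "has_facet i c'" using r(2) near_mono[OF c', of r] by simp
      then show "\<bar>A i c' - A i (?c x)\<bar> \<le> A i (?c x) / 2"
        using s(2)[OF near_mono[OF c', of s] V_has_strict_partial[OF i]] by simp
    qed
  qed
  then obtain \<rho> where \<rho>: "\<And>x. p \<le> x \<Longrightarrow> x \<le> q \<Longrightarrow> \<rho> x > 0 \<and> (\<forall>c'. near n (?c x) (\<rho> x) c' \<longrightarrow> has_facet i c' \<and> \<bar>A i c' - A i (?c x)\<bar> \<le> A i (?c x) / 2)"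
    by metis
  obtain D where D: "D \<subseteq> {p..q}" "finite D" "{p..q} \<subseteq> (\<Union>x\<in>D. ball x (\<rho> x))"
  proof (rule compactE_image[of "{p..q}" "{p..q}" "\<lambda>x. ball x (\<rho> x)"])
    show "{p..q} \<subseteq> (\<Union>x\<in>{p..q}. ball x (\<rho> x))" using \<rho> by force
  qed auto
  have Dne: "D \<noteq> {}" using D(3) pq by auto
  define r where "r = Min (\<rho> ` D) / N"
  define \<kappa> where "\<kappa> = Min ((\<lambda>x. A i (?c x) / 2) ` D)"
  define \<kappa>' where "\<kappa>' = Max ((\<lambda>x. A i (?c x) * 3 / 2) ` D)"
  have ND: "Min (\<rho> ` D) > 0" using D Dne \<rho> by (subst Min_gr_iff) auto
  show ?thesis
  proof (rule that[of r \<kappa> \<kappa>'])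
    show "r > 0" unfolding r_def using ND N(1) by simp
    show "\<kappa> > 0" unfolding \<kappa>_def using D Dne A_pos[OF i gx] by (subst Min_gr_iff) auto
    fix t x assume t: "\<bar>t\<bar> < r" and x: "p \<le> x" "x \<le> q"
    obtain y where y: "y \<in> D" "dist y x < \<rho> y" using D(3) x by auto
    have yr: "p \<le> y" "y \<le> q" using y D(1) by auto
    have "near n (?c y) (\<rho> y) ((\<lambda>k. 1 + t * f k)(i := x))"
      unfolding near_def
    proof
      fix k assume k: "k \<in> {1..n}"
      have "\<bar>t\<bar> * \<bar>f k\<bar> \<le> \<bar>t\<bar> * N" using N(2)[OF k] by (intro mult_left_mono) auto
      also have "\<dots> < Min (\<rho> ` D)" using t N(1) unfolding r_def by (simp add: field_simps)
      also have "\<dots> \<le> \<rho> y" using D(2) y(1) by (intro Min_le) auto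
      finally show "\<bar>((\<lambda>k. 1 + t * f k)(i := x)) k - (?c y) k\<bar> < \<rho> y"
        using y(2) by (auto simp: abs_mult dist_real_def abs_minus_commute)
    qed
    then have *: "has_facet i ((\<lambda>k. 1 + t * f k)(i := x))" "\<bar>A i ((\<lambda>k. 1 + t * f k)(i := x)) - A i (?c y)\<bar> \<le> A i (?c y) / 2"
      using \<rho>[OF yr] by blast+
    have "\<kappa> \<le> A i (?c y) / 2" unfolding \<kappa>_def using D(2) y(1) by (intro Min_le) auto
    moreover have "A i (?c y) * 3 / 2 \<le> \<kappa>'" unfolding \<kappa>'_def using D(2) y(1) by (intro Max_ge) auto
    ultimately show "has_facet i ((\<lambda>k. 1 + t * f k)(i := x)) \<and>
       \<kappa> \<le> A i ((\<lambda>k. 1 + t * f k)(i := x)) \<and> A i ((\<lambda>k. 1 + t * f k)(i := x)) \<le> \<kappa>'"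
      using * by linarith
  qed
qed

end

text \<open>Fubini for the set of pairs (x, s) with x in \<open>K\<close> and g x <= s <= U.\<close>

lemma layer_cake:
  fixes K :: "'a::euclidean_space set" and g :: "'a \<Rightarrow> real"
  assumes K: "compact K" and g: "continuous_on UNIV g" and U: "\<And>x. x \<in> K \<Longrightarrow> \<bar>g x\<bar> \<le> U"
  shows "((\<lambda>s. measure lebesgue (K \<inter> {x. g x \<le> s})) has_integral (LINT x|lborel. indicator K x * (U - g x))) {-U..U}"
proof -
  have gm[measurable]: "g \<in> borel_measurable borel" using g by (rule borel_measurable_continuous_onI)
  have Km[measurable]: "K \<in> sets borel" using K compact_imp_closed borel_closed by blast
  have fin: "emeasure lborel K < \<infinity>" using K emeasure_compact_finite by blast
  let ?f = "\<lambda>(x, s). indicator K x * indicator {x. g x \<le> s} x * indicator {-U..U} s :: real"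
  have fm[measurable]: "(\<lambda>(x, s). indicator K x * indicator {y. g y \<le> s} x * indicator {-U..U} s :: real) \<in> borel_measurable (lborel \<Otimes>\<^sub>M lborel)"
  proof -
    have "(\<lambda>z. indicator K (fst z) * indicator {z. g (fst z) \<le> snd z} z * indicator {-U..U} (snd z) :: real) \<in> borel_measurable (lborel \<Otimes>\<^sub>M lborel)"
      by measurable
    moreover have "(\<lambda>(x, s). indicator K x * indicator {y. g y \<le> s} x * indicator {-U..U} s :: real) =
      (\<lambda>z. indicator K (fst z) * indicator {z. g (fst z) \<le> snd z} z * indicator {-U..U} (snd z))"
      by (auto simp: fun_eq_iff indicator_def)
    ultimately show ?thesis by simp
  qed
  have bound: "integrable (lborel \<Otimes>\<^sub>M lborel) (\<lambda>(x, s). indicator K x * indicator {-U..U} s :: real)"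
  proof -
    have "(\<lambda>(x, s). indicator K x * indicator {-U..U} s :: real) = indicator (K \<times> {-U..U})"
      by (auto simp: fun_eq_iff indicator_def)
    moreover have "emeasure (lborel \<Otimes>\<^sub>M lborel) (K \<times> {-U..U}) = emeasure lborel K * emeasure lborel {-U..U}"
      by (rule lborel.emeasure_pair_measure_Times) auto
    moreover have "emeasure lborel K * emeasure lborel {-U..U} < \<infinity>"
      using fin by (simp add: ennreal_mult_less_top emeasure_lborel_Icc_eq)
    ultimately show ?thesis by (simp add: integrable_indicator_iff)
  qed
  have int: "integrable (lborel \<Otimes>\<^sub>M lborel) (\<lambda>(x, s). indicator K x * indicator {y. g y \<le> s} x * indicator {-U..U} s :: real)"
    by (rule Bochner_Integration.integrable_bound[OF bound fm]) (auto simp: indicator_def)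
  have in1: "(LINT s|lborel. indicator K x * indicator {y. g y \<le> s} x * indicator {-U..U} s :: real) = indicator K x * (U - g x)" for x
  proof (cases "x \<in> K")
    case True
    then have gx: "- U \<le> g x" "g x \<le> U" using U[OF True] by auto
    have "(LINT s|lborel. indicator K x * indicator {y. g y \<le> s} x * indicator {-U..U} s :: real) = (LINT s|lborel. indicator {g x..U} s)"
      by (rule Bochner_Integration.integral_cong) (use gx True in \<open>auto simp: indicator_def\<close>)
    then show ?thesis using gx True by simp
  qed simp
  have in2: "(LINT x|lborel. indicator K x * indicator {y. g y \<le> s} x * indicator {-U..U} s :: real) = indicator {-U..U} s * measure lebesgue (K \<inter> {x. g x \<le> s})" for s
  proof -
    have m: "K \<inter> {x. g x \<le> s} \<in> sets borel" by measurable
    have "(LINT x|lborel. indicator K x * indicator {y. g y \<le> s} x * indicator {-U..U} s :: real) = (LINT x|lborel. indicator {-U..U} s * indicator (K \<inter> {x. g x \<le> s}) x)"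
      by (rule Bochner_Integration.integral_cong) (auto simp: indicator_def)
    also have "\<dots> = indicator {-U..U} s * measure lborel (K \<inter> {x. g x \<le> s})"
      using m by simp
    finally show ?thesis using m by (simp add: measure_completion)
  qed
  have i2: "integrable lborel (\<lambda>s. indicator {-U..U} s * measure lebesgue (K \<inter> {x. g x \<le> s}))"
    using lborel_pair.integrable_snd[OF int] unfolding in2 .
  have "(LINT x|lborel. indicator K x * (U - g x)) = (LINT s|lborel. indicator {-U..U} s * measure lebesgue (K \<inter> {x. g x \<le> s}))"
    using lborel_pair.Fubini_integral[OF int] unfolding in1 in2 by (rule sym)
  moreover have "((\<lambda>s. measure lebesgue (K \<inter> {x. g x \<le> s})) has_integral (LINT s|lborel. indicator {-U..U} s * measure lebesgue (K \<inter> {x. g x \<le> s}))) {-U..U}"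
  proof -
    have "(\<lambda>s. indicator {-U..U} s * measure lebesgue (K \<inter> {x. g x \<le> s})) =
        (\<lambda>s. if s \<in> {-U..U} then measure lebesgue (K \<inter> {x. g x \<le> s}) else 0)"
      by (auto simp: fun_eq_iff indicator_def)
    then show ?thesis
      using has_integral_integral_lborel[OF i2]
      by (simp only: has_integral_restrict_UNIV)
  qed
  ultimately show "((\<lambda>s. measure lebesgue (K \<inter> {x. g x \<le> s})) has_integral (LINT x|lborel. indicator K x * (U - g x))) {-U..U}"
    by simp
qed

section \<open>Comparison of the sections of the bodies at t and -t\<close>

context exposed_configuration
begin

text \<open>The parts of the two bodies cut off at level \<open>s\<close>, shifted by \<open>2 t f\<^sub>i\<close> for one of them, have the same
  volume up to \<open>o(t)\<close>; this is where \<open>transport_rigidity\<close> enters.\<close>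

lemma shifted_section_volume:
  fixes f :: "nat \<Rightarrow> real"
  assumes second: "\<And>\<eta>. \<eta> > 0 \<Longrightarrow> \<exists>r>0. \<forall>t. \<bar>t\<bar> < r \<longrightarrow> \<bar>V (\<lambda>k. 1 + t * f k) - V (\<lambda>_. 1)\<bar> \<le> \<eta> * t\<^sup>2"
    and i: "i \<in> {1..n}" and s: "s < 1" "has_facet i ((\<lambda>_. 1)(i := s))" and \<tau>: "\<tau> > 0"
  shows "\<exists>r>0. \<forall>t. 0 < t \<longrightarrow> t < r \<longrightarrow>
    \<bar>V ((\<lambda>k. 1 + t * f k)(i := s + 2 * t * f i)) - V ((\<lambda>k. 1 + (- t) * f k)(i := s))\<bar> \<le> \<tau> * t"
proof -
  define cc where "cc t = (\<lambda>k. 1 + t * f k)" for t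
  define N where "N = (\<Sum>k\<in>{1..n}. \<bar>f k\<bar>) + 1"
  have N: "N \<ge> 1" "\<And>k. k \<in> {1..n} \<Longrightarrow> \<bar>f k\<bar> \<le> N"
    unfolding N_def using member_le_sum[of _ "{1..n}" "\<lambda>k. \<bar>f k\<bar>"] by (force simp: sum_nonneg)+
  obtain ra where ra: "ra > 0" "\<And>c'. near n ((\<lambda>_. 1)(i := s)) ra c' \<Longrightarrow> has_facet i c'"
    using has_facet_open[OF i s(2)] by blast
  obtain rb where rb: "rb > 0" "\<And>c'. near n (\<lambda>_. 1) rb c' \<Longrightarrow> has_facet i c'"
    using has_facet_open[OF i has_facet_one[OF i]] by blast
  define p where "p = s - ra / 2"
  define q where "q = 1 + rb / 2"
  have pq: "p < s" "s < q" "1 < q" "p < q" unfolding p_def q_def using ra(1) rb(1) s(1) by auto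
  have gp: "has_facet i ((\<lambda>_. 1)(i := p))" by (rule ra(2)) (use ra(1) in \<open>auto simp: near_def p_def\<close>)
  have gq: "has_facet i ((\<lambda>_. 1)(i := q))" by (rule rb(2)) (use rb(1) in \<open>auto simp: near_def q_def\<close>)
  obtain r1 \<kappa> \<kappa>' where r1: "r1 > 0" "\<kappa> > 0"
    "\<And>t x. \<bar>t\<bar> < r1 \<Longrightarrow> p \<le> x \<Longrightarrow> x \<le> q \<Longrightarrow> has_facet i ((cc t)(i := x)) \<and> \<kappa> \<le> A i ((cc t)(i := x)) \<and> A i ((cc t)(i := x)) \<le> \<kappa>'"
    using A_bounds_on_segment[OF i less_imp_le[OF pq(4)] gp gq, of f] unfolding cc_def by metis
  \<comment> \<open>An upper bound for all right-hand sides that occur, so that one Lipschitz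
    constant serves throughout.\<close>
  define TT where "TT = 1 + N + \<bar>s\<bar> + 2 * N + \<bar>q\<bar>"
  have TT0: "TT \<ge> 0" unfolding TT_def using N(1) by simp
  obtain L where L: "L \<ge> 0" "\<And>c c'. (\<And>k. k \<in> {1..n} \<Longrightarrow> c k \<le> TT \<and> c' k \<le> TT) \<Longrightarrow> \<bar>V c - V c'\<bar> \<le> L * (\<Sum>k\<in>{1..n}. \<bar>c k - c' k\<bar>)"
    using V_lipschitz[OF TT0] by blast
  \<comment> \<open>The volume of the body at \<open>t\<close> below level x in direction
    \<open>v i\<close>. The mass above that level is V (cc t) - H t x, with derivative - a t
    x.\<close>
  define H where "H t x = V ((cc t)(i := x))" for t x
  define a where "a t x = A i ((cc t)(i := x))" for t x
  have ccT: "cc t k \<le> TT" if "\<bar>t\<bar> \<le> 1" "k \<in> {1..n}" for t k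
  proof -
    have "t * f k \<le> \<bar>t\<bar> * \<bar>f k\<bar>" by (metis abs_ge_self abs_mult)
    also have "\<dots> \<le> 1 * N" using that N by (intro mult_mono) auto
    finally show ?thesis unfolding cc_def TT_def using N(1) by simp
  qed
  have Hx: "\<bar>H t x - H t y\<bar> \<le> L * \<bar>x - y\<bar>" if "\<bar>t\<bar> \<le> 1" "x \<le> TT" "y \<le> TT" for t x y
  proof -
    have "\<bar>H t x - H t y\<bar> \<le> L * (\<Sum>k\<in>{1..n}. \<bar>((cc t)(i := x)) k - ((cc t)(i := y)) k\<bar>)"
      unfolding H_def by (rule L(2)) (use that ccT in auto)
    also have "(\<Sum>k\<in>{1..n}. \<bar>((cc t)(i := x)) k - ((cc t)(i := y)) k\<bar>) = (\<Sum>k\<in>{1..n}. if k = i then \<bar>x - y\<bar> else 0)"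
      by (intro sum.cong) auto
    finally show ?thesis using i by simp
  qed
  have Ht: "\<bar>V (cc t) - V (cc 0)\<bar> \<le> L * (N * \<bar>t\<bar>)" "x \<le> TT \<Longrightarrow> \<bar>H t x - H 0 x\<bar> \<le> L * (N * \<bar>t\<bar>)" if t: "\<bar>t\<bar> \<le> 1" for t x
  proof -
    have *: "(\<Sum>k\<in>{1..n}. \<bar>cc t k - cc 0 k\<bar>) \<le> N * \<bar>t\<bar>"
    proof -
      have "(\<Sum>k\<in>{1..n}. \<bar>cc t k - cc 0 k\<bar>) = \<bar>t\<bar> * (N - 1)"
        unfolding cc_def N_def by (simp add: abs_mult sum_distrib_left)
      also have "\<dots> \<le> \<bar>t\<bar> * N" by (intro mult_left_mono) auto
      finally show ?thesis by (simp add: mult.commute)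
    qed
    have "\<bar>V (cc t) - V (cc 0)\<bar> \<le> L * (\<Sum>k\<in>{1..n}. \<bar>cc t k - cc 0 k\<bar>)"
      by (rule L(2)) (use t ccT in auto)
    also have "\<dots> \<le> L * (N * \<bar>t\<bar>)" using * L(1) by (intro mult_left_mono)
    finally show "\<bar>V (cc t) - V (cc 0)\<bar> \<le> L * (N * \<bar>t\<bar>)" .
    assume x: "x \<le> TT"
    have "\<bar>H t x - H 0 x\<bar> \<le> L * (\<Sum>k\<in>{1..n}. \<bar>((cc t)(i := x)) k - ((cc 0)(i := x)) k\<bar>)"
      unfolding H_def by (rule L(2)) (use t x ccT in auto)
    also have "\<dots> \<le> L * (\<Sum>k\<in>{1..n}. \<bar>cc t k - cc 0 k\<bar>)"
      by (intro mult_left_mono sum_mono L(1)) auto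
    also have "\<dots> \<le> L * (N * \<bar>t\<bar>)" using * L(1) by (intro mult_left_mono)
    finally show "\<bar>H t x - H 0 x\<bar> \<le> L * (N * \<bar>t\<bar>)" .
  qed
  have dH: "((\<lambda>x. H t x) has_real_derivative a t x) (at x)" if "\<bar>t\<bar> < r1" "p \<le> x" "x \<le> q" for t x
    using has_strict_partial_imp_DERIV[OF V_has_strict_partial[OF i conjunct1[OF r1(3)[OF that]]]]
    unfolding H_def a_def by simp
  \<comment> \<open>A level below \<open>s\<close> with strictly more mass above it. For small t
    this reserve keeps the transported level inside the range (p, q) in which areas are
    controlled.\<close>
  define x1 where "x1 = (p + s) / 2"
  have x1: "p < x1" "x1 < s" unfolding x1_def using pq by auto
  have gap: "H 0 x1 < H 0 s"
  proof (rule DERIV_pos_imp_increasing[OF x1(2)])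
    fix x assume x: "x1 \<le> x" "x \<le> s"
    then have xr: "p \<le> x" "x \<le> q" using x1 pq by linarith+
    have r0: "\<bar>0::real\<bar> < r1" using r1(1) by simp
    have "a 0 x > 0" using r1(2) r1(3)[OF r0 xr] unfolding a_def by linarith
    then show "\<exists>y. (H 0 has_real_derivative y) (at x) \<and> 0 < y" using dH[OF r0 xr] by blast
  qed
  \<comment> \<open>Constants chosen backwards from the goal. A shift error \<theta>0 * t costs L *
    \<theta>0 * t in volume, and the unequal total volumes cost another \<theta>0 * t, together
    \<tau> * t. With \<eta> = \<theta> * t in \<open>transport_rigidity\<close>, the choices of
    \<open>\<theta>\<close> and \<open>e\<close> bound each of the two error terms there by
    \<theta>0 * t / 2.\<close>
  define \<theta>0 where "\<theta>0 = \<tau> / (L + 1)"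
  have \<theta>0: "\<theta>0 > 0" "\<theta>0 * (L + 1) = \<tau>" unfolding \<theta>0_def using \<tau> L(1) by auto
  define cst where "cst = \<kappa>^3 / (8 * \<kappa>'\<^sup>2)"
  have "\<kappa>' > 0" using r1(2) r1(3)[of 0 s] r1(1) pq by auto
  then have cst: "cst > 0" unfolding cst_def using r1(2) by simp
  define \<theta> where "\<theta> = \<theta>0 / (q - p)"
  have \<theta>: "\<theta> > 0" "\<theta> * (q - p) = \<theta>0" unfolding \<theta>_def using \<theta>0(1) pq by auto
  define e where "e = \<theta>0 * \<theta> * cst"
  have e: "e > 0" unfolding e_def using \<theta>0 \<theta> cst by simp
  obtain r2 where r2: "r2 > 0" "\<And>t. \<bar>t\<bar> < r2 \<Longrightarrow> \<bar>V (cc t) - V (\<lambda>_. 1)\<bar> \<le> e * t\<^sup>2"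
    using second[OF e] unfolding cc_def by blast
  have cc0: "cc 0 = (\<lambda>_. 1)" unfolding cc_def by simp
  define g0 where "g0 = H 0 s - H 0 x1"
  have g0: "g0 > 0" using gap unfolding g0_def by simp
  define r where "r = min (min 1 (min r1 r2)) (min (min ((1 - s) / N) ((q - 1) / N)) (min (g0 / (4 * (L + 1) * N)) (\<theta>0 / (2 * e))))"
  have pos: "(0::real) < 1" "0 < (1 - s) / N" "0 < (q - 1) / N" "0 < g0 / (4 * (L + 1) * N)" "0 < \<theta>0 / (2 * e)"
    using N(1) s(1) pq g0 L(1) \<theta>0(1) e by (auto intro!: divide_pos_pos mult_pos_pos)
  have r: "r > 0" "r \<le> 1" "r \<le> r1" "r \<le> r2" "r \<le> (1 - s) / N" "r \<le> (q - 1) / N" "r \<le> g0 / (4 * (L + 1) * N)" "r \<le> \<theta>0 / (2 * e)"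
  proof -
    show "r > 0" unfolding r_def min_less_iff_conj using pos r1(1) r2(1) by blast
  qed (simp_all only: r_def min_le_iff_disj order_refl simp_thms)
  show ?thesis
  proof (intro exI[of _ r] conjI allI impI r(1))
    fix t :: real assume t: "0 < t" "t < r"
    have tt: "\<bar>t\<bar> \<le> 1" "\<bar>-t\<bar> \<le> 1" "\<bar>t\<bar> < r1" "\<bar>-t\<bar> < r1" "\<bar>t\<bar> < r2" "\<bar>-t\<bar> < r2" "\<bar>0::real\<bar> < r1"
      using t r r1(1) by auto
    have tf: "\<bar>t * f i\<bar> < 1 - s" "\<bar>t * f i\<bar> < q - 1"
    proof -
      have "\<bar>t * f i\<bar> \<le> t * N" using t N(2)[OF i] by (simp add: abs_mult)
      moreover have "t * N < r * N" using t N(1) by simp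
      moreover have "r * N \<le> 1 - s" "r * N \<le> q - 1" using r(5,6) N(1) by (simp_all add: le_divide_eq)
      ultimately show "\<bar>t * f i\<bar> < 1 - s" "\<bar>t * f i\<bar> < q - 1" by linarith+
    qed
    let ?um = "1 + (-t) * f i" and ?up = "1 + t * f i"
    have um: "s < ?um" "?um < q" and up: "s < ?up" "?up < q" using tf by (auto simp: abs_less_iff)
    have top: "H t (1 + t * f i) = V (cc t)" for t unfolding H_def by (intro arg_cong[of _ _ V]) (auto simp: cc_def)
    have small: "4 * (L * (N * t)) \<le> g0"
    proof -
      have X: "4 * (L + 1) * N > 0" using L(1) N(1) by (intro mult_pos_pos) auto
      then have "r * (4 * (L + 1) * N) \<le> g0" using r(7) by (simp only: pos_le_divide_eq)
      moreover have "t * (4 * (L + 1) * N) \<le> r * (4 * (L + 1) * N)"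
        using t(2) X by (intro mult_right_mono) auto
      ultimately have "t * (4 * (L + 1) * N) \<le> g0" by linarith
      moreover have "4 * (L * (N * t)) \<le> t * (4 * (L + 1) * N)" using t(1) N(1) by (simp add: algebra_simps)
      ultimately show ?thesis by linarith
    qed
    have TTb: "x1 \<le> TT" "s \<le> TT" "s + 2 * t * f i \<le> TT" "\<And>y. y < q \<Longrightarrow> y \<le> TT"
    proof -
      have "2 * t * f i \<le> 2 * N"
      proof -
        have "t * f i \<le> \<bar>t\<bar> * \<bar>f i\<bar>" by (metis abs_ge_self abs_mult)
        also have "\<dots> \<le> 1 * N" using tt N(2)[OF i] by (intro mult_mono) auto
        finally show ?thesis by simp
      qed
      then show "s + 2 * t * f i \<le> TT" "s \<le> TT" unfolding TT_def using N(1) by auto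
      then show "x1 \<le> TT" using x1 by simp
      show "y \<le> TT" if "y < q" for y using that unfolding TT_def using N(1) by simp
    qed
    define \<epsilon> where "\<epsilon> = e * t\<^sup>2"
    have Vpm: "\<bar>V (cc t) - V (\<lambda>_. 1)\<bar> \<le> \<epsilon>" "\<bar>V (cc (-t)) - V (\<lambda>_. 1)\<bar> \<le> \<epsilon>"
      unfolding \<epsilon>_def using r2(2)[OF tt(5)] r2(2)[OF tt(6)] by simp_all
    have \<eta>: "\<theta> * t > 0" using \<theta>(1) t(1) by simp
    have midc: "((cc 0)(i := (x + y) / 2)) k = (((cc (-t))(i := x)) k + ((cc t)(i := y)) k) / 2" for x y k
      unfolding cc_def by auto
    \<comment> \<open>The three masses are those above a level in the bodies at -t, 0 and t. The top
      levels \<open>?um\<close> and \<open>?up\<close> are the heights of the i-th facets; their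
      midpoint is 1, the height of the i-th facet at 0.\<close>
    obtain y where y: "p < y" "y < q" "V (cc t) - H t y = V (cc (-t)) - H (-t) s"
      "\<bar>(y - s) - (?up - ?um)\<bar> \<le> \<epsilon> / (2 * (\<theta> * t) * cst) + \<theta> * t / 2 * (?um - s)"
      unfolding cst_def
    proof (rule transport_rigidity[of p q "\<lambda>x. V (cc (-t)) - H (-t) x" "a (-t)" "\<lambda>x. V (cc 0) - H 0 x" "a 0"
          "\<lambda>x. V (cc t) - H t x" "a t" \<kappa> \<kappa>' ?um ?up s x1 \<epsilon> "\<theta> * t"])
      fix x assume x: "p < x" "x < q"
      show "((\<lambda>x. V (cc (-t)) - H (-t) x) has_real_derivative - a (-t) x) (at x)"
        "((\<lambda>x. V (cc 0) - H 0 x) has_real_derivative - a 0 x) (at x)"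
        "((\<lambda>x. V (cc t) - H t x) has_real_derivative - a t x) (at x)"
        using dH[of "-t" x] dH[of 0 x] dH[of t x] tt x by (auto intro!: derivative_eq_intros)
      show "\<kappa> \<le> a (-t) x \<and> a (-t) x \<le> \<kappa>'" "\<kappa> \<le> a t x \<and> a t x \<le> \<kappa>'" "0 \<le> a 0 x"
        using r1(3)[OF tt(3), of x] r1(3)[OF tt(4), of x] r1(3)[OF tt(7), of x] r1(2) x unfolding a_def by auto
    next
      fix x y assume x: "p < x" "x < q" and y: "p < y" "y < q"
      show "a (-t) x * a t y \<le> (a 0 ((x + y) / 2))\<^sup>2"
        unfolding a_def
      proof (rule A_midpoint[OF i])
        show "has_facet i ((cc (-t))(i := x))" using r1(3)[OF tt(4)] x by auto
        show "has_facet i ((cc t)(i := y))" using r1(3)[OF tt(3)] y by auto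
        show "has_facet i ((cc 0)(i := (x + y) / 2))" using r1(3)[OF tt(7)] x y by auto
      qed (rule midc)
    next
      show "V (cc (-t)) - H (-t) ?um = 0" using top[of "-t"] by simp
      show "V (cc t) - H t ?up = 0" using top[of t] by simp
      show "V (cc 0) - H 0 ((?um + ?up) / 2) = 0" using top[of 0] by simp
      have "\<bar>H (-t) s - H 0 s\<bar> \<le> L * (N * t)" "\<bar>H t x1 - H 0 x1\<bar> \<le> L * (N * t)"
        "\<bar>V (cc t) - V (cc 0)\<bar> \<le> L * (N * t)" "\<bar>V (cc (-t)) - V (cc 0)\<bar> \<le> L * (N * t)"
        using Ht(2)[OF tt(2) TTb(2)] Ht(2)[OF tt(1) TTb(1)] Ht(1)[OF tt(1)] Ht(1)[OF tt(2)] t(1) by simp_all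
      then show "V (cc (-t)) - H (-t) s \<le> V (cc t) - H t x1" using small g0_def by linarith
    next
      fix y assume y: "p < y" "y < q" "V (cc t) - H t y = V (cc (-t)) - H (-t) s"
      have nn: "0 \<le> H (-t) s" "0 \<le> H t y" "0 \<le> H 0 ((s + y) / 2)" unfolding H_def by (rule V_nonneg)+
      have le: "H (-t) s * H t y \<le> (H 0 ((s + y) / 2))\<^sup>2"
        unfolding H_def by (rule V_midpoint, rule midc)
      \<comment> \<open>A lower bound for the volumes below the levels \<open>s\<close> and
        \<open>y\<close>: equal masses lie above them, and the totals differ from the middle one by
        at most \<epsilon>. Brunn--Minkowski passes the bound on to the midpoint level.\<close>
      define w where "w = V (\<lambda>_. 1) - \<epsilon> - (V (cc (-t)) - H (-t) s)"
      have w: "w \<le> H (-t) s" "w \<le> H t y" using Vpm y(3) unfolding w_def by linarith+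
      have "w \<le> H 0 ((s + y) / 2)"
      proof (cases "w \<le> 0")
        case False
        then have "w * w \<le> H (-t) s * H t y" using w nn by (intro mult_mono) auto
        then have "w\<^sup>2 \<le> (H 0 ((s + y) / 2))\<^sup>2" using le by (simp add: power2_eq_square)
        then show ?thesis using nn(3) by (rule power2_le_imp_le)
      qed (use nn in linarith)
      then show "V (cc 0) - H 0 ((s + y) / 2) \<le> V (cc (-t)) - H (-t) s + \<epsilon>" unfolding w_def cc0 by linarith
    qed (use pq um up x1 r1(2) \<eta> in auto)
    have bound: "\<bar>(y - s) - 2 * t * f i\<bar> \<le> \<theta>0 * t"
    proof -
      have "\<epsilon> / (2 * (\<theta> * t) * cst) = \<theta>0 * t / 2"
        unfolding \<epsilon>_def e_def using \<theta>(1) t(1) cst by (simp add: power2_eq_square)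
      moreover have "\<theta> * t / 2 * (?um - s) \<le> \<theta> * t / 2 * (q - p)"
        using \<theta>(1) t(1) um pq by (intro mult_left_mono) auto
      moreover have "\<theta> * t / 2 * (q - p) = \<theta>0 * t / 2" unfolding \<theta>(2)[symmetric] by simp
      moreover have up_um: "?up - ?um = 2 * t * f i" by simp
      ultimately show ?thesis using y(4) unfolding up_um by linarith
    qed
    have 1: "\<bar>H t (s + 2 * t * f i) - H t y\<bar> \<le> L * (\<theta>0 * t)"
    proof -
      have "\<bar>H t (s + 2 * t * f i) - H t y\<bar> \<le> L * \<bar>s + 2 * t * f i - y\<bar>"
        by (rule Hx[OF tt(1) TTb(3) TTb(4)[OF y(2)]])
      also have "\<dots> \<le> L * (\<theta>0 * t)" using bound L(1) by (intro mult_left_mono) auto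
      finally show ?thesis .
    qed
    have "\<epsilon> + \<epsilon> \<le> \<theta>0 * t"
    proof -
      have "r * (2 * e) \<le> \<theta>0" using r(8) e by (simp add: pos_le_divide_eq)
      moreover have "t * (2 * e) \<le> r * (2 * e)" using t(2) e by (intro mult_right_mono) auto
      ultimately have "t * (2 * e) \<le> \<theta>0" by (rule order_trans[rotated])
      then have "2 * e * t \<le> \<theta>0" by (simp add: ac_simps)
      then have "2 * e * t * t \<le> \<theta>0 * t" using t(1) by (intro mult_right_mono) auto
      then show ?thesis unfolding \<epsilon>_def by (simp add: power2_eq_square)
    qed
    then have 2: "\<bar>H t y - H (-t) s\<bar> \<le> \<theta>0 * t" using y(3) Vpm by linarith
    have "\<bar>H t (s + 2 * t * f i) - H (-t) s\<bar> \<le> \<theta>0 * (L + 1) * t"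
      using 1 2 by (simp add: algebra_simps)
    then show "\<bar>V ((\<lambda>k. 1 + t * f k)(i := s + 2 * t * f i)) - V ((\<lambda>k. 1 + (- t) * f k)(i := s))\<bar> \<le> \<tau> * t"
      unfolding \<theta>0(2) H_def cc_def .
  qed
qed

section \<open>From matching sections to a linear function\<close>

lemma V_one_pos: "V (\<lambda>_. 1) > 0"
proof -
  obtain i where i: "i \<in> {1..n}" using inradius by blast
  have d: "((\<lambda>t. V ((\<lambda>_. 1)(i := t))) has_real_derivative A i (\<lambda>_. 1)) (at 1)"
    using has_strict_partial_imp_DERIV[OF V_has_strict_partial[OF i has_facet_one[OF i]]] by simp
  obtain r where r: "r > 0" "\<And>h. h > 0 \<Longrightarrow> h < r \<Longrightarrow> V ((\<lambda>_. 1)(i := 1 - h)) < V ((\<lambda>_. 1)(i := 1))"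
    using DERIV_pos_inc_left[OF d A_pos[OF i has_facet_one[OF i]]] by blast
  have "V ((\<lambda>_. 1)(i := 1 - r/2)) < V ((\<lambda>_. 1)(i := 1))" using r by simp
  moreover have "(\<lambda>_. 1::real)(i := 1) = (\<lambda>_. 1)" by auto
  ultimately show ?thesis using V_nonneg[of "(\<lambda>_. 1)(i := 1 - r/2)"] by simp
qed

lemma polar_Int_halfspace:
  assumes "i \<in> {1..n}"
  shows "generalized_polar n v c \<inter> {x. x \<bullet> v i \<le> s} = generalized_polar n v (c(i := min (c i) s))"
  using assms unfolding generalized_polar_def by (auto split: if_splits)

text \<open>\<open>inradius\<close> bounds the norm of a vector by its products with the
  \<open>v k\<close>, so convergence of all these products makes \<open>b\<close> a Cauchy
  sequence.\<close>

lemma convergent_functional: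
  assumes lim: "\<And>i. i \<in> {1..n} \<Longrightarrow> (\<lambda>m. b m \<bullet> v i) \<longlonglongrightarrow> f i"
  shows "\<exists>b. \<forall>i\<in>{1..n}. f i = b \<bullet> v i"
proof -
  obtain \<rho> where \<rho>: "\<rho> > 0" "\<And>x. \<exists>k\<in>{1..n}. \<rho> * norm x \<le> x \<bullet> v k" using inradius by blast
  have "Cauchy b"
  proof (rule CauchyI)
    fix e :: real assume e: "e > 0"
    have "\<exists>M. \<forall>m\<ge>M. \<bar>b m \<bullet> v i - f i\<bar> < \<rho> * e / 2" if "i \<in> {1..n}" for i
      using LIMSEQ_D[OF lim[OF that], of "\<rho> * e / 2"] \<rho>(1) e by simp
    then obtain M where M: "\<And>i m. i \<in> {1..n} \<Longrightarrow> m \<ge> M i \<Longrightarrow> \<bar>b m \<bullet> v i - f i\<bar> < \<rho> * e / 2" by metis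
    have "norm (b m - b l) < e" if ml: "m \<ge> Max (M ` {1..n})" "l \<ge> Max (M ` {1..n})" for m l
    proof -
      obtain k where k: "k \<in> {1..n}" "\<rho> * norm (b m - b l) \<le> (b m - b l) \<bullet> v k" using \<rho>(2) by blast
      have "M k \<le> Max (M ` {1..n})" using k(1) by (intro Max_ge) auto
      then have "\<bar>b m \<bullet> v k - f k\<bar> < \<rho> * e / 2" "\<bar>b l \<bullet> v k - f k\<bar> < \<rho> * e / 2"
        using M[OF k(1)] ml by auto
      then have "\<rho> * norm (b m - b l) < \<rho> * e" using k(2) unfolding inner_diff_left by linarith
      then show ?thesis using \<rho>(1) by simp
    qed
    then show "\<exists>M. \<forall>m\<ge>M. \<forall>l\<ge>M. norm (b m - b l) < e" by blast
  qed
  then obtain b0 where b0: "b \<longlonglongrightarrow> b0" using Cauchy_convergent convergent_def by blast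
  show ?thesis
  proof (intro exI[of _ b0] ballI)
    fix i assume i: "i \<in> {1..n}"
    have "(\<lambda>m. b m \<bullet> v i) \<longlonglongrightarrow> b0 \<bullet> v i" using b0 by (intro tendsto_intros)
    then show "f i = b0 \<bullet> v i" using lim[OF i] LIMSEQ_unique by blast
  qed
qed

lemma moment_integrable:
  assumes "compact K"
  shows "integrable lborel (\<lambda>x::real^'d. indicator K x *\<^sub>R x)"
  using borel_integrable_compact[OF assms continuous_on_id] by simp

lemma layer_integral_eq:
  fixes K :: "(real^'d) set"
  assumes K: "compact K"
  shows "(LINT x|lborel. indicator K x * (U - (x \<bullet> w - \<beta>))) = (U + \<beta>) * measure lebesgue K - (LINT x|lborel. indicator K x *\<^sub>R x) \<bullet> w"
proof -
  have Kb: "K \<in> sets borel" using K compact_imp_closed borel_closed by blast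
  have i1: "integrable lborel (indicator K :: real^'d \<Rightarrow> real)"
    using emeasure_compact_finite[OF K] Kb by (simp add: integrable_indicator_iff less_top)
  have i2: "integrable lborel (\<lambda>x. (indicator K x *\<^sub>R x) \<bullet> w)"
    using moment_integrable[OF K] by (rule integrable_inner_left[rotated])
  have "(LINT x|lborel. indicator K x * (U - (x \<bullet> w - \<beta>))) = (LINT x|lborel. (U + \<beta>) * indicator K x - (indicator K x *\<^sub>R x) \<bullet> w)"
    by (rule Bochner_Integration.integral_cong) (auto simp: algebra_simps)
  also have "\<dots> = (U + \<beta>) * measure lborel K - (LINT x|lborel. indicator K x *\<^sub>R x) \<bullet> w"
  proof -
    have "(LINT x|lborel. (indicator K x *\<^sub>R x) \<bullet> w) = (LINT x|lborel. indicator K x *\<^sub>R x) \<bullet> w"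
      by (rule integral_inner_left) (rule moment_integrable[OF K])
    moreover have "(LINT x|lborel. (U + \<beta>) * indicator K x - (indicator K x *\<^sub>R x) \<bullet> w)
        = (LINT x|lborel. (U + \<beta>) * indicator K x) - (LINT x|lborel. (indicator K x *\<^sub>R x) \<bullet> w)"
      by (rule Bochner_Integration.integral_diff) (use i1 i2 in auto)
    ultimately show ?thesis using Kb by simp
  qed
  finally show ?thesis using Kb by (simp add: measure_completion)
qed

text \<open>Section volumes of the body at -t and of the shifted body at t agree up to o(t) at
  almost every level. Integrated over all levels, they are expressed by volume and first moment; the
  shift contributes 2 * t * f i * V (cc t). Dividing by 2 * t shows that the difference quotient of
  the moment, paired with \<open>v i\<close>, tends to f i * V (\<lambda>_. 1).\<close>

theorem second_order_stationary_imp_linear: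
  fixes f :: "nat \<Rightarrow> real"
  assumes second: "\<And>\<eta>. \<eta> > 0 \<Longrightarrow> \<exists>r>0. \<forall>t. \<bar>t\<bar> < r \<longrightarrow> \<bar>V (\<lambda>k. 1 + t * f k) - V (\<lambda>_. 1)\<bar> \<le> \<eta> * t\<^sup>2"
  shows "\<exists>b. \<forall>i\<in>{1..n}. f i = b \<bullet> v i"
proof -
  define cc where "cc t = (\<lambda>k. 1 + t * f k)" for t
  define K where "K t = generalized_polar n v (cc t)" for t
  define N where "N = (\<Sum>k\<in>{1..n}. \<bar>f k\<bar>) + 1"
  have N: "N \<ge> 1" "\<And>k. k \<in> {1..n} \<Longrightarrow> \<bar>f k\<bar> \<le> N"
    unfolding N_def using member_le_sum[of _ "{1..n}" "\<lambda>k. \<bar>f k\<bar>"] by (force simp: sum_nonneg)+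
  have tfN: "\<bar>t * f k\<bar> \<le> \<bar>t\<bar> * N" if "k \<in> {1..n}" for t k
    unfolding abs_mult using N(2)[OF that] by (intro mult_left_mono) auto
  have ccN: "cc t k \<le> 1 + \<bar>t\<bar> * N" if "k \<in> {1..n}" for t k
    using tfN[OF that, of t] unfolding cc_def by linarith
  obtain R where R: "R \<ge> 0" "\<And>c t. t \<ge> 0 \<Longrightarrow> (\<And>k. k \<in> {1..n} \<Longrightarrow> c k \<le> t) \<Longrightarrow> generalized_polar n v c \<subseteq> cball 0 (R * t)"
    using polar_bounded by blast
  have KR: "norm x \<le> R * (1 + N)" if "x \<in> K t" "\<bar>t\<bar> \<le> 1" for x t
  proof -
    have "cc t k \<le> 1 + N" if "k \<in> {1..n}" for k
      using ccN[OF that, of t] mult_right_mono[OF \<open>\<bar>t\<bar> \<le> 1\<close>, of N] N(1) by linarith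
    then have "K t \<subseteq> cball 0 (R * (1 + N))" unfolding K_def by (intro R(2)) (use N in auto)
    then show ?thesis using that(1) by auto
  qed
  have Kc: "compact (K t)" for t
    unfolding K_def using closed_polar bounded_polar by (simp add: compact_eq_bounded_closed)
  have VK: "V (cc t) = measure lebesgue (K t)" for t unfolding V_def K_def ..
  define I where "I t = (LINT x|lborel. indicator (K t) x *\<^sub>R x)" for t
  \<comment> \<open>One sequence of parameters t suffices: the limit of \<open>\<beta>\<close> along
    it is the vector sought, and dominated convergence is a statement about sequences.\<close>
  define e where "e m = 1 / (real m + 1)" for m :: nat
  have e: "e m > 0" "e m \<le> 1" "e \<longlonglongrightarrow> 0" for m
    using LIMSEQ_inverse_real_of_nat unfolding e_def by (simp_all add: inverse_eq_divide add.commute)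
  have ev: "eventually (\<lambda>m. P (e m)) sequentially" if "r > 0" "\<And>t. 0 < t \<Longrightarrow> t < r \<Longrightarrow> P t" for P and r :: real
    using order_tendstoD(2)[OF e(3) that(1)] by (rule eventually_mono) (use that(2) e(1) in blast)
  have Vpm: "\<exists>r>0. \<forall>t. 0 < t \<longrightarrow> t < r \<longrightarrow> \<bar>V (cc t) - V (cc (-t))\<bar> \<le> \<tau> * t" if \<tau>: "\<tau> > 0" for \<tau>
  proof -
    obtain r where r: "r > 0" "\<And>t. \<bar>t\<bar> < r \<Longrightarrow> \<bar>V (cc t) - V (\<lambda>_. 1)\<bar> \<le> 1 * t\<^sup>2"
      using second[of 1] unfolding cc_def by auto
    show ?thesis
    proof (intro exI[of _ "min r (\<tau> / 2)"] conjI allI impI)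
      fix t assume t: "0 < t" "t < min r (\<tau> / 2)"
      have "\<bar>V (cc t) - V (cc (-t))\<bar> \<le> 2 * t\<^sup>2" using r(2)[of t] r(2)[of "-t"] t by simp
      also have "\<dots> = (2 * t) * t" by (simp add: power2_eq_square)
      also have "\<dots> \<le> \<tau> * t" using t by (intro mult_right_mono) auto
      finally show "\<bar>V (cc t) - V (cc (-t))\<bar> \<le> \<tau> * t" .
    qed (use r \<tau> in simp)
  qed
  have to0: "(\<lambda>m. G (e m) / (2 * e m)) \<longlonglongrightarrow> 0" if G: "\<And>\<tau>. \<tau> > 0 \<Longrightarrow> \<exists>r>0. \<forall>t. 0 < t \<longrightarrow> t < r \<longrightarrow> \<bar>G t\<bar> \<le> \<tau> * t" for G :: "real \<Rightarrow> real"
  proof (rule tendstoI)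
    fix \<epsilon> :: real assume \<epsilon>: "\<epsilon> > 0"
    obtain r where r: "r > 0" "\<And>t. 0 < t \<Longrightarrow> t < r \<Longrightarrow> \<bar>G t\<bar> \<le> \<epsilon> * t" using G[OF \<epsilon>] by blast
    show "eventually (\<lambda>m. dist (G (e m) / (2 * e m)) 0 < \<epsilon>) sequentially"
    proof (rule ev[OF r(1)])
      fix t assume t: "0 < t" "t < r"
      have "\<bar>G t\<bar> / (2 * t) \<le> \<epsilon> / 2" using r(2)[OF t] t by (simp add: divide_le_eq)
      then show "dist (G t / (2 * t)) 0 < \<epsilon>" using t \<epsilon> by (simp add: abs_divide)
    qed
  qed
  \<comment> \<open>The symmetric difference quotient of the first moment over the volume. Since the
    volume is stationary, this approximates the derivative of the barycenter up to a
    translation-free normalization.\<close>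
  define \<beta> where "\<beta> m = (1 / V (\<lambda>_. 1)) *\<^sub>R ((1 / (2 * e m)) *\<^sub>R (I (e m) - I (- e m)))" for m
  have cc0: "cc 0 = (\<lambda>_. 1)" unfolding cc_def by simp
  have Vlim: "(\<lambda>m. V (cc (e m))) \<longlonglongrightarrow> V (\<lambda>_. 1)"
  proof (rule LIM_zero_cancel, rule tendstoI)
    fix \<epsilon> :: real assume \<epsilon>: "\<epsilon> > 0"
    obtain r where r: "r > 0" "\<And>t. \<bar>t\<bar> < r \<Longrightarrow> \<bar>V (cc t) - V (\<lambda>_. 1)\<bar> \<le> 1 * t\<^sup>2"
      using second[of 1] unfolding cc_def by auto
    show "eventually (\<lambda>m. dist (V (cc (e m)) - V (\<lambda>_. 1)) 0 < \<epsilon>) sequentially"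
    proof (rule ev[of "min r (min 1 \<epsilon>)"])
      fix t assume t: "0 < t" "t < min r (min 1 \<epsilon>)"
      have "t * t \<le> 1 * t" using t by (intro mult_right_mono) auto
      moreover have "\<bar>V (cc t) - V (\<lambda>_. 1)\<bar> \<le> t * t" using r(2)[of t] t by (simp add: power2_eq_square)
      moreover have "t < \<epsilon>" using t by simp
      ultimately show "dist (V (cc t) - V (\<lambda>_. 1)) 0 < \<epsilon>" unfolding dist_real_def by linarith
    qed (use r \<epsilon> in simp)
  qed
  have "(\<lambda>m. \<beta> m \<bullet> v i) \<longlonglongrightarrow> f i" if i: "i \<in> {1..n}" for i
  proof -
    define U where "U = R * (1 + N) * norm (v i) + 2 * N"
    define G where "G t s = measure lebesgue (K t \<inter> {x. x \<bullet> v i - 2 * t * f i \<le> s})" for t s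
    define G' where "G' t s = measure lebesgue (K (-t) \<inter> {x. x \<bullet> v i - 0 \<le> s})" for t s
    have Ub: "\<bar>x \<bullet> v i\<bar> \<le> U - 2 * N" if "x \<in> K t" "\<bar>t\<bar> \<le> 1" for x t
    proof -
      have "\<bar>x \<bullet> v i\<bar> \<le> norm x * norm (v i)" by (rule Cauchy_Schwarz_ineq2)
      also have "\<dots> \<le> R * (1 + N) * norm (v i)" using KR[OF that] by (intro mult_right_mono) auto
      finally show ?thesis unfolding U_def by simp
    qed
    have G_int: "(G t has_integral (U + 2 * t * f i) * V (cc t) - I t \<bullet> v i) {-U..U}" if t: "\<bar>t\<bar> \<le> 1" for t
    proof -
      have "((\<lambda>s. measure lebesgue (K t \<inter> {x. x \<bullet> v i - 2 * t * f i \<le> s})) has_integral (LINT x|lborel. indicator (K t) x * (U - (x \<bullet> v i - 2 * t * f i)))) {-U..U}"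
      proof (rule layer_cake[OF Kc])
        show "continuous_on UNIV (\<lambda>x. x \<bullet> v i - 2 * t * f i)" by (intro continuous_intros)
        fix x assume "x \<in> K t"
        then have "\<bar>x \<bullet> v i\<bar> \<le> U - 2 * N" using Ub t by blast
        moreover have "\<bar>t * f i\<bar> \<le> N" using tfN[OF i, of t] mult_right_mono[OF t, of N] N(1) by linarith
        ultimately show "\<bar>x \<bullet> v i - 2 * t * f i\<bar> \<le> U" by linarith
      qed
      then show ?thesis unfolding layer_integral_eq[OF Kc] G_def[abs_def] VK I_def .
    qed
    have G'_int: "(G' t has_integral (U + 0) * V (cc (-t)) - I (-t) \<bullet> v i) {-U..U}" if t: "\<bar>t\<bar> \<le> 1" for t
    proof -
      have "((\<lambda>s. measure lebesgue (K (-t) \<inter> {x. x \<bullet> v i - 0 \<le> s})) has_integral (LINT x|lborel. indicator (K (-t)) x * (U - (x \<bullet> v i - 0)))) {-U..U}"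
      proof (rule layer_cake[OF Kc])
        show "continuous_on UNIV (\<lambda>x. x \<bullet> v i - 0)" by (intro continuous_intros)
        fix x assume "x \<in> K (-t)"
        then have "\<bar>x \<bullet> v i\<bar> \<le> U - 2 * N" using Ub[of x "-t"] t by simp
        then show "\<bar>x \<bullet> v i - 0\<bar> \<le> U" using N(1) by linarith
      qed
      then show ?thesis unfolding layer_integral_eq[OF Kc] G'_def[abs_def] VK I_def .
    qed
    have GV: "G t s = V ((cc t)(i := min (1 + t * f i) (s + 2 * t * f i)))" for t s
    proof -
      have "{x. x \<bullet> v i - 2 * t * f i \<le> s} = {x. x \<bullet> v i \<le> s + 2 * t * f i}" by auto
      then show ?thesis unfolding G_def K_def V_def polar_Int_halfspace[OF i, symmetric] by (simp add: polar_Int_halfspace[OF i] cc_def)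
    qed
    have G'V: "G' t s = V ((cc (-t))(i := min (1 + (-t) * f i) s))" for t s
      unfolding G'_def K_def V_def by (simp add: polar_Int_halfspace[OF i] cc_def)
    have TT0: "2 + N \<ge> 0" using N(1) by simp
    obtain L where L: "L \<ge> 0" "\<And>c c'. (\<And>k. k \<in> {1..n} \<Longrightarrow> c k \<le> 2 + N \<and> c' k \<le> 2 + N) \<Longrightarrow> \<bar>V c - V c'\<bar> \<le> L * (\<Sum>k\<in>{1..n}. \<bar>c k - c' k\<bar>)"
      using V_lipschitz[OF TT0] by blast
    have bound: "\<bar>G t s - G' t s\<bar> \<le> L * (real n * (2 * N)) * t" if t: "0 < t" "t \<le> 1" for t s
    proof -
      have tN: "\<bar>t * f k\<bar> \<le> t * N" "\<bar>t * f k\<bar> \<le> N" if "k \<in> {1..n}" for k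
      proof -
        show 1: "\<bar>t * f k\<bar> \<le> t * N" using tfN[OF that, of t] t by simp
        have "t * N \<le> 1 * N" using t(2) N(1) by (intro mult_right_mono) auto
        then show "\<bar>t * f k\<bar> \<le> N" using 1 by linarith
      qed
      let ?c = "(cc t)(i := min (1 + t * f i) (s + 2 * t * f i))" and ?c' = "(cc (-t))(i := min (1 + (-t) * f i) s)"
      have "\<bar>V ?c - V ?c'\<bar> \<le> L * (\<Sum>k\<in>{1..n}. \<bar>?c k - ?c' k\<bar>)"
      proof (rule L(2))
        fix k assume k: "k \<in> {1..n}"
        show "?c k \<le> 2 + N \<and> ?c' k \<le> 2 + N"
        proof -
          have a: "1 + t * f k \<le> 2 + N" "1 + (-t) * f k \<le> 2 + N" using tN(2)[OF k] by linarith+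
          then show ?thesis by (cases "k = i") (auto simp: cc_def intro: min.coboundedI1)
        qed
      qed
      also have "\<dots> \<le> L * (\<Sum>k\<in>{1..n}. 2 * N * t)"
      proof (intro mult_left_mono sum_mono L(1))
        fix k assume k: "k \<in> {1..n}"
        show "\<bar>?c k - ?c' k\<bar> \<le> 2 * N * t"
        proof (cases "k = i")
          case True
          have "\<bar>min (1 + t * f i) (s + 2 * t * f i) - min (1 + (-t) * f i) s\<bar> \<le> 2 * \<bar>t * f i\<bar>"
            by linarith
          also have "\<dots> \<le> 2 * N * t" using tN(1)[OF i] by (simp add: mult.commute)
          finally show ?thesis using True by simp
        next
          case False
          have "\<bar>?c k - ?c' k\<bar> = 2 * \<bar>t * f k\<bar>" using False unfolding cc_def by simp
          also have "\<dots> \<le> 2 * N * t" using tN(1)[OF k] by (simp add: mult.commute)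
          finally show ?thesis .
        qed
      qed
      also have "(\<Sum>k\<in>{1..n}. 2 * N * t) = real n * (2 * N) * t" by simp
      finally show ?thesis unfolding GV G'V by (simp only: mult.assoc)
    qed
    obtain xb where xb: "xb \<in> K 0" "\<And>x. x \<in> K 0 \<Longrightarrow> xb \<bullet> v i \<le> x \<bullet> v i"
    proof -
      have "0 \<in> K 0" unfolding K_def cc0 generalized_polar_def by simp
      then have "K 0 \<noteq> {}" by blast
      moreover have "continuous_on (K 0) (\<lambda>x. x \<bullet> v i)" by (intro continuous_intros)
      ultimately have "\<exists>x\<in>K 0. \<forall>y\<in>K 0. x \<bullet> v i \<le> y \<bullet> v i" by (rule continuous_attains_inf[OF Kc])
      then show ?thesis using that by blast
    qed
    \<comment> \<open>The lowest level of the body at 0. The levels \<open>l\<close> and 1 are the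
      only ones at which no pointwise limit is claimed; \<open>Q\<close> is set to 0 there.\<close>
    define l where "l = xb \<bullet> v i"
    have l0: "l \<le> 0"
    proof -
      have "0 \<in> K 0" unfolding K_def cc0 generalized_polar_def by simp
      from xb(2)[OF this] show ?thesis unfolding l_def by simp
    qed
    \<comment> \<open>For small t, both sections are empty below \<open>l\<close> and both are the
      whole bodies above 1. In between \<open>shifted_section_volume\<close> applies.\<close>
    have pt: "\<exists>r>0. \<forall>t. 0 < t \<longrightarrow> t < r \<longrightarrow> \<bar>G t s - G' t s\<bar> \<le> \<tau> * t" if s: "s \<noteq> l" "s \<noteq> 1" and \<tau>: "\<tau> > 0" for s \<tau>
    proof -
      consider "s < l" | "l < s" "s < 1" | "1 < s" using s by linarith
      then show ?thesis
      proof cases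
        case 1
        define r where "r = min 1 ((l - s) / (2 * N + N * \<bar>l\<bar>))"
        have den: "2 * N + N * \<bar>l\<bar> > 0" using N(1) by (simp add: add_pos_nonneg)
        show ?thesis
        proof (intro exI[of _ r] conjI allI impI)
          show "r > 0" unfolding r_def using 1 den by simp
          fix t assume t: "0 < t" "t < r"
          have "t < (l - s) / (2 * N + N * \<bar>l\<bar>)" using t unfolding r_def by simp
          then have tl: "t * (2 * N + N * \<bar>l\<bar>) < l - s" using den by (simp only: pos_less_divide_eq)
          have low: "x \<bullet> v i > s + 2 * t * N" if x: "x \<in> K \<sigma>" and \<sigma>: "\<bar>\<sigma>\<bar> = t" for x \<sigma>
          proof -
            \<comment> \<open>Division by \<open>d\<close> carries the bodies at t and -t into the
              body at 0, so their lowest levels are at least l * d.\<close>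
            define d where "d = 1 + t * N"
            have d: "d > 0" unfolding d_def using t N(1) by (simp add: add_pos_pos)
            have "(1/d) *\<^sub>R x \<in> K 0" unfolding K_def cc0 generalized_polar_def mem_Collect_eq
            proof
              fix k assume k: "k \<in> {1..n}"
              have "x \<bullet> v k \<le> cc \<sigma> k" using x k unfolding K_def generalized_polar_def by blast
              then have "x \<bullet> v k \<le> d" using ccN[OF k, of \<sigma>] unfolding d_def \<sigma> by linarith
              then show "(1/d) *\<^sub>R x \<bullet> v k \<le> 1" using d by simp
            qed
            then have "l \<le> (x \<bullet> v i) / d" using xb(2) unfolding l_def by force
            then have "l * d \<le> x \<bullet> v i" using d by (simp add: le_divide_eq)
            moreover have "l * d = l - t * (N * \<bar>l\<bar>)" unfolding d_def using l0 by (simp add: algebra_simps)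
            moreover have "t * (2 * N + N * \<bar>l\<bar>) = 2 * t * N + t * (N * \<bar>l\<bar>)" by (simp add: algebra_simps)
            ultimately show ?thesis using tl by linarith
          qed
          have tN: "\<bar>t * f i\<bar> \<le> t * N" using tfN[OF i, of t] t by simp
          have "K t \<inter> {x. x \<bullet> v i - 2 * t * f i \<le> s} = {}"
          proof (rule ccontr)
            assume "\<not> ?thesis"
            then obtain x where x: "x \<in> K t" "x \<bullet> v i - 2 * t * f i \<le> s" by blast
            have "x \<bullet> v i > s + 2 * t * N" by (rule low[OF x(1)]) (use t in simp)
            then show False using x(2) tN by (simp add: abs_le_iff mult.assoc)
          qed
          moreover have "K (-t) \<inter> {x. x \<bullet> v i - 0 \<le> s} = {}"
          proof (rule ccontr)
            assume "\<not> ?thesis"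
            then obtain x where x: "x \<in> K (-t)" "x \<bullet> v i \<le> s" by auto
            have "x \<bullet> v i > s + 2 * t * N" by (rule low[OF x(1)]) (use t in simp)
            then show False using x(2) tN t N(1) by (smt (verit) mult_nonneg_nonneg)
          qed
          ultimately have "G t s = 0" "G' t s = 0" unfolding G_def G'_def by simp_all
          then show "\<bar>G t s - G' t s\<bar> \<le> \<tau> * t" using \<tau> t by simp
        qed
      next
        case 2
        have "has_facet i ((\<lambda>_. 1)(i := s))"
        proof -
          obtain z where z: "z \<bullet> v i = 1" "\<And>k. k \<in> {1..n} - {i} \<Longrightarrow> z \<bullet> v k < 1" using exposed[OF i] by blast
          \<comment> \<open>The point at level \<open>s\<close> on the segment from the lowest point
            \<open>xb\<close> to the facet point \<open>z\<close>. Its positive weight on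
            \<open>z\<close> makes all other inequalities strict.\<close>
          define \<mu> where "\<mu> = (s - l) / (1 - l)"
          have \<mu>: "0 < \<mu>" "\<mu> < 1" "\<mu> * (1 - l) = s - l" unfolding \<mu>_def using 2 by auto
          show ?thesis unfolding has_facet_def
          proof (intro exI[of _ "\<mu> *\<^sub>R z + (1 - \<mu>) *\<^sub>R xb"] conjI ballI)
            show "(\<mu> *\<^sub>R z + (1 - \<mu>) *\<^sub>R xb) \<bullet> v i = ((\<lambda>_. 1)(i := s)) i"
              using \<mu>(3) by (simp add: inner_add_left z(1) l_def[symmetric] algebra_simps)
            fix k assume k: "k \<in> {1..n} - {i}"
            have "xb \<bullet> v k \<le> 1" using xb(1) k unfolding K_def cc0 generalized_polar_def by blast
            then have "(1 - \<mu>) * (xb \<bullet> v k) \<le> (1 - \<mu>) * 1" using \<mu> by (intro mult_left_mono) auto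
            moreover have "\<mu> * (z \<bullet> v k) < \<mu> * 1" using z(2)[OF k] \<mu> by (intro mult_strict_left_mono) auto
            ultimately show "(\<mu> *\<^sub>R z + (1 - \<mu>) *\<^sub>R xb) \<bullet> v k < ((\<lambda>_. 1)(i := s)) k"
              using k by (simp add: inner_add_left)
          qed
        qed
        from shifted_section_volume[OF second i 2(2) this \<tau>]
        obtain r where r: "r > 0" "\<And>t. 0 < t \<Longrightarrow> t < r \<Longrightarrow> \<bar>V ((cc t)(i := s + 2 * t * f i)) - V ((cc (-t))(i := s))\<bar> \<le> \<tau> * t"
          unfolding cc_def by blast
        show ?thesis
        proof (intro exI[of _ "min r ((1 - s) / N)"] conjI allI impI)
          show "min r ((1 - s) / N) > 0" using r(1) 2 N(1) by simp
          fix t assume t: "0 < t" "t < min r ((1 - s) / N)"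
          have "t * N < 1 - s" using t N(1) by (simp add: pos_less_divide_eq)
          then have "\<bar>t * f i\<bar> < 1 - s" using tfN[OF i, of t] t by simp
          then have "min (1 + t * f i) (s + 2 * t * f i) = s + 2 * t * f i" "min (1 + (-t) * f i) s = s"
            by linarith+
          then show "\<bar>G t s - G' t s\<bar> \<le> \<tau> * t" unfolding GV G'V using r(2)[of t] t by simp
        qed
      next
        case 3
        obtain r where r: "r > 0" "\<And>t. 0 < t \<Longrightarrow> t < r \<Longrightarrow> \<bar>V (cc t) - V (cc (-t))\<bar> \<le> \<tau> * t" using Vpm[OF \<tau>] by blast
        show ?thesis
        proof (intro exI[of _ "min r ((s - 1) / N)"] conjI allI impI)
          show "min r ((s - 1) / N) > 0" using r(1) 3 N(1) by simp
          fix t assume t: "0 < t" "t < min r ((s - 1) / N)"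
          have "t * N < s - 1" using t N(1) by (simp add: pos_less_divide_eq)
          then have "\<bar>t * f i\<bar> < s - 1" using tfN[OF i, of t] t by simp
          then have mins: "min (1 + t * f i) (s + 2 * t * f i) = 1 + t * f i" "min (1 + (-t) * f i) s = 1 + (-t) * f i"
            by linarith+
          have same: "(cc \<sigma>)(i := 1 + \<sigma> * f i) = cc \<sigma>" for \<sigma> unfolding cc_def by auto
          show "\<bar>G t s - G' t s\<bar> \<le> \<tau> * t" unfolding GV G'V mins same by (rule r(2)) (use t in auto)
        qed
      qed
    qed
    define Q where "Q m s = (if s \<in> {l, 1} then 0 else (G (e m) s - G' (e m) s) / (2 * e m))" for m s
    define q where "q m = (((U + 2 * e m * f i) * V (cc (e m)) - I (e m) \<bullet> v i) - ((U + 0) * V (cc (- e m)) - I (- e m) \<bullet> v i)) / (2 * e m)" for m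
    have Q_int: "(Q m has_integral q m) {-U..U}" for m
    proof (rule has_integral_spike_finite[of "{l, 1}"])
      have "\<bar>e m\<bar> \<le> 1" using e(1)[of m] e(2)[of m] by simp
      from has_integral_diff[OF G_int[OF this] G'_int[OF this]]
      show "((\<lambda>s. (G (e m) s - G' (e m) s) / (2 * e m)) has_integral q m) {-U..U}"
        unfolding q_def by (rule has_integral_divide)
    qed (auto simp: Q_def)
    have "(\<lambda>m. integral {-U..U} (Q m)) \<longlonglongrightarrow> integral {-U..U} (\<lambda>_. 0)"
    proof (rule dominated_convergence(2))
      show "Q m integrable_on {-U..U}" for m using Q_int by blast
      show "(\<lambda>_. L * (real n * (2 * N)) / 2) integrable_on {-U..U}" by (rule integrable_const_ivl)
      show "norm (Q m s) \<le> L * (real n * (2 * N)) / 2" for m s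
      proof -
        have X: "L * (real n * (2 * N)) \<ge> 0" using L(1) N(1) by (intro mult_nonneg_nonneg) auto
        have "\<bar>G (e m) s - G' (e m) s\<bar> / (2 * e m) \<le> L * (real n * (2 * N)) / 2"
          using bound[OF e(1) e(2), of m s] e(1)[of m] by (simp add: divide_le_eq ac_simps)
        then show ?thesis using X e(1)[of m] unfolding Q_def by (auto simp: abs_divide ac_simps)
      qed
      show "(\<lambda>m. Q m s) \<longlonglongrightarrow> 0" for s
      proof (cases "s \<in> {l, 1}")
        case False
        then show ?thesis unfolding Q_def using to0[of "\<lambda>t. G t s - G' t s"] pt by simp
      qed (simp add: Q_def)
    qed
    moreover have "integral {-U..U} (Q m) = q m" for m using Q_int by (rule integral_unique)
    ultimately have q0: "q \<longlonglongrightarrow> 0" by simp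
    have Vd: "(\<lambda>m. (V (cc (e m)) - V (cc (- e m))) / (2 * e m)) \<longlonglongrightarrow> 0"
      using to0[of "\<lambda>t. V (cc t) - V (cc (- t))"] Vpm by simp
    have qe: "V (\<lambda>_. 1) * (\<beta> m \<bullet> v i) = U * ((V (cc (e m)) - V (cc (- e m))) / (2 * e m)) + f i * V (cc (e m)) - q m" for m
    proof -
      have "V (\<lambda>_. 1) * (\<beta> m \<bullet> v i) = (I (e m) \<bullet> v i - I (- e m) \<bullet> v i) / (2 * e m)"
        unfolding \<beta>_def using V_one_pos by (simp add: inner_diff_left)
      moreover have "(i1 - i2) / (2 * \<epsilon>) = U * ((x - y) / (2 * \<epsilon>)) + a * x - (((U + 2 * \<epsilon> * a) * x - i1) - ((U + 0) * y - i2)) / (2 * \<epsilon>)"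
        if "\<epsilon> > 0" for a x y i1 i2 \<epsilon> :: real
        using that by (simp add: field_simps)
      ultimately show ?thesis unfolding q_def using e(1)[of m] by presburger
    qed
    have "(\<lambda>m. V (\<lambda>_. 1) * (\<beta> m \<bullet> v i)) \<longlonglongrightarrow> U * 0 + f i * V (\<lambda>_. 1) - 0"
      unfolding qe by (intro tendsto_intros Vd Vlim q0)
    then have "(\<lambda>m. V (\<lambda>_. 1) * (\<beta> m \<bullet> v i) / V (\<lambda>_. 1)) \<longlonglongrightarrow> (U * 0 + f i * V (\<lambda>_. 1) - 0) / V (\<lambda>_. 1)"
      by (rule tendsto_divide) (use V_one_pos in auto)
    then show ?thesis using V_one_pos by simp
  qed
  then show ?thesis by (rule convergent_functional)
qed

section \<open>Permutations induced by orthogonal maps\<close>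

lemma eq_zero_if_orthogonal:
  assumes "\<And>k. k \<in> {1..n} \<Longrightarrow> y \<bullet> v k = 0" shows "y = 0"
proof -
  obtain \<rho> k where "\<rho> > 0" "k \<in> {1..n}" "\<rho> * norm y \<le> y \<bullet> v k" using inradius by blast
  then show ?thesis using assms[of k] by (simp add: mult_le_0_iff)
qed

text \<open>A vertex that is not maximal for \<open>y\<close> has an improving edge: maximise \<open>p \<bullet> v k / (1 - z \<bullet> v k)\<close>
  for a direction \<open>p\<close> near \<open>y\<close> that makes the maximiser unique.\<close>

lemma adj_in_direction:
  assumes i: "i \<in> {1..n}" and yi: "y \<bullet> v i = 0" and y0: "y \<noteq> 0"
  shows "\<exists>k\<in>{1..n}-{i}. adj i k \<and> y \<bullet> v k > 0"
proof -
  obtain z where z: "z \<bullet> v i = 1" "\<And>k. k \<in> {1..n}-{i} \<Longrightarrow> z \<bullet> v k < 1" using exposed[OF i] by blast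
  define rest where "rest = {1..n} - {i}"
  define w where "w k = 1 - z \<bullet> v k" for k
  have w: "w k > 0" if "k \<in> rest" for k using z(2) that unfolding rest_def w_def by simp
  \<comment> \<open>Up to a multiple of \<open>v i\<close> this is the direction from
    \<open>v i\<close> to \<open>v k\<close>, scaled to the vertex figure cut out by
    \<open>z\<close>. For p orthogonal to \<open>v i\<close> the quotient to be maximised is p
    \<bullet> u k.\<close>
  define u where "u k = (1 / w k) *\<^sub>R v k" for k
  have vu: "x \<bullet> v k = w k * (x \<bullet> u k)" if "k \<in> rest" for x k using w[OF that] unfolding u_def by simp
  obtain \<rho> k0 where "\<rho> > 0" "k0 \<in> {1..n}" "\<rho> * norm y \<le> y \<bullet> v k0" using inradius by blast
  then have k0: "k0 \<in> {1..n}" "y \<bullet> v k0 > 0" using y0 by (auto intro: less_le_trans[of _ "\<rho> * norm y"])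
  then have k0rest: "k0 \<in> rest" using yi unfolding rest_def by auto
  define m where "m = Max ((\<lambda>k. y \<bullet> u k) ` rest)"
  have finO: "finite rest" unfolding rest_def by simp
  have mle: "y \<bullet> u k \<le> m" if "k \<in> rest" for k unfolding m_def using finO that by (intro Max_ge) auto
  have "y \<bullet> u k0 > 0" using k0(2) vu[OF k0rest, of y] w[OF k0rest] by (simp add: zero_less_mult_iff)
  then have m0: "m > 0" using mle[OF k0rest] by linarith
  define S where "S = {k\<in>rest. y \<bullet> u k = m}"
  have "m \<in> (\<lambda>k. y \<bullet> u k) ` rest" unfolding m_def using finO k0rest by (intro Max_in) auto
  then have Sne: "S \<noteq> {}" unfolding S_def by auto
  have finS: "finite S" unfolding S_def using finO by simp
  \<comment> \<open>The part orthogonal to \<open>v i\<close>, so that a perturbation along it keeps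
    the direction orthogonal to \<open>v i\<close>.\<close>
  define q where "q k = u k - ((u k \<bullet> v i) / (v i \<bullet> v i)) *\<^sub>R v i" for k
  have qi: "q k \<bullet> v i = 0" for k unfolding q_def using v_nonzero[OF i] by (simp add: inner_diff_left)
  have qu: "q k \<bullet> u j = q k \<bullet> q j" for k j
  proof -
    have "q k \<bullet> q j = q k \<bullet> u j - ((u j \<bullet> v i) / (v i \<bullet> v i)) * (q k \<bullet> v i)"
      unfolding q_def[of j] by (simp add: inner_diff_right)
    then show ?thesis using qi by simp
  qed
  \<comment> \<open>Equal projections would put \<open>v i\<close>, \<open>v j\<close> and
    \<open>v k\<close> on one line.\<close>
  have qinj: "q k \<noteq> q j" if "k \<in> rest" "j \<in> rest" "k \<noteq> j" for k j
  proof
    assume "q k = q j"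
    define b where "b = (u k \<bullet> v i) / (v i \<bullet> v i) - (u j \<bullet> v i) / (v i \<bullet> v i)"
    have ub: "u k = u j + b *\<^sub>R v i" using \<open>q k = q j\<close> unfolding q_def b_def by (simp add: algebra_simps)
    have "z \<bullet> u k = 1 / w k - 1" "z \<bullet> u j = 1 / w j - 1"
      using w[OF that(1)] w[OF that(2)] unfolding u_def w_def by (simp_all add: field_simps)
    then have b: "b = 1 / w k - 1 / w j" using arg_cong[OF ub, of "\<lambda>x. z \<bullet> x"] z(1) by (simp add: inner_add_right)
    have "v k = w k *\<^sub>R u k" using w[OF that(1)] unfolding u_def by simp
    also have "\<dots> = (w k * b) *\<^sub>R v i + (w k / w j) *\<^sub>R v j" by (subst ub) (simp add: u_def algebra_simps)
    finally have "v k = (w k * b) *\<^sub>R v i + (w k / w j) *\<^sub>R v j" .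
    moreover have "w k * b + w k / w j = 1" unfolding b using w[OF that(1)] w[OF that(2)] by (simp add: field_simps)
    ultimately show False using not_collinear[OF i, of j k "w k * b" "w k / w j"] that unfolding rest_def by auto
  qed
  \<comment> \<open>Among the maximisers of y a longest \<open>q k\<close> breaks the tie: a
    different vector of at most the same length has a smaller inner product with it.\<close>
  obtain k where k: "k \<in> S" "\<And>j. j \<in> S \<Longrightarrow> norm (q j) \<le> norm (q k)"
  proof -
    have "Max ((\<lambda>j. norm (q j)) ` S) \<in> (\<lambda>j. norm (q j)) ` S" using finS Sne by (intro Max_in) auto
    then obtain k where "k \<in> S" "norm (q k) = Max ((\<lambda>j. norm (q j)) ` S)" by auto
    moreover have "norm (q j) \<le> Max ((\<lambda>j. norm (q j)) ` S)" if "j \<in> S" for j using finS that by (intro Max_ge) auto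
    ultimately show ?thesis using that by metis
  qed
  have kO: "k \<in> rest" "y \<bullet> u k = m" using k(1) unfolding S_def by auto
  have qlt: "q k \<bullet> q j < q k \<bullet> q k" if j: "j \<in> S" "j \<noteq> k" for j
  proof -
    have "j \<in> rest" using j unfolding S_def by auto
    then have "q k - q j \<noteq> 0" using qinj[OF kO(1)] j by auto
    then have "0 < (q k - q j) \<bullet> (q k - q j)" by simp
    also have "\<dots> = q k \<bullet> q k + q j \<bullet> q j - 2 * (q k \<bullet> q j)" by (simp add: inner_diff_left inner_diff_right inner_commute)
    also have "q j \<bullet> q j \<le> q k \<bullet> q k" using k(2)[OF j(1)] by (simp add: norm_le)
    finally show ?thesis by simp
  qed
  define \<gamma> where "\<gamma> = Min (insert 1 ((\<lambda>j. m - y \<bullet> u j) ` (rest - S)))"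
  have "y \<bullet> u j < m" if "j \<in> rest - S" for j
    using mle[of j] that unfolding S_def by (simp add: less_le)
  then have \<gamma>0: "\<gamma> > 0" unfolding \<gamma>_def using finO by (subst Min_gr_iff) auto
  have \<gamma>: "\<gamma> \<le> m - y \<bullet> u j" if "j \<in> rest - S" for j unfolding \<gamma>_def using finO that by (intro Min_le) auto
  define B where "B = (\<Sum>j\<in>rest. \<bar>q k \<bullet> q j - q k \<bullet> q k\<bar>) + 1"
  have B: "B \<ge> 1" "\<And>j. j \<in> rest \<Longrightarrow> \<bar>q k \<bullet> q j - q k \<bullet> q k\<bar> \<le> B"
    unfolding B_def using member_le_sum[of _ rest "\<lambda>j. \<bar>q k \<bullet> q j - q k \<bullet> q k\<bar>"] finO by (force simp: sum_nonneg)+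
  \<comment> \<open>Small enough that the perturbation cannot close the gap \<gamma> between the
    maximisers and the other vertices.\<close>
  define \<epsilon> where "\<epsilon> = \<gamma> / (2 * B)"
  have \<epsilon>: "\<epsilon> > 0" "\<epsilon> * B < \<gamma>" unfolding \<epsilon>_def using \<gamma>0 B(1) by (auto simp: field_simps)
  define p where "p = y + \<epsilon> *\<^sub>R q k"
  have pu: "p \<bullet> u j = y \<bullet> u j + \<epsilon> * (q k \<bullet> q j)" for j unfolding p_def by (simp add: inner_add_left qu)
  have plt: "p \<bullet> u j < p \<bullet> u k" if j: "j \<in> rest" "j \<noteq> k" for j
  proof (cases "j \<in> S")
    case True
    then have "y \<bullet> u j = m" unfolding S_def by simp
    then show ?thesis using mult_strict_left_mono[OF qlt[OF True j(2)] \<epsilon>(1)] unfolding pu kO(2) by simp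
  next
    case False
    have "\<epsilon> * (q k \<bullet> q j - q k \<bullet> q k) \<le> \<epsilon> * B" using B(2)[OF j(1)] \<epsilon>(1) by (intro mult_left_mono) auto
    then show ?thesis using \<gamma>[of j] False j \<epsilon>(2) unfolding pu kO(2) by (simp add: right_diff_distrib)
  qed
  have ppos: "p \<bullet> u k > 0" unfolding pu kO(2) using m0 \<epsilon>(1) by (simp add: add_pos_nonneg)
  have pi: "p \<bullet> v i = 0" unfolding p_def using yi qi by (simp add: inner_add_left)
  \<comment> \<open>Moving from \<open>z\<close> along \<open>p\<close>, the constraint k is the
    unique first one to become tight.\<close>
  have "adj i k" unfolding adj_def
  proof (intro exI[of _ "z + (1 / (p \<bullet> u k)) *\<^sub>R p"] conjI ballI)
    show "(z + (1 / (p \<bullet> u k)) *\<^sub>R p) \<bullet> v i = 1" using z(1) pi by (simp add: inner_add_left)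
    show "(z + (1 / (p \<bullet> u k)) *\<^sub>R p) \<bullet> v k = 1"
      using ppos by (simp add: inner_add_left vu[OF kO(1), of p]) (simp add: w_def)
    fix j assume "j \<in> {1..n} - {i, k}"
    then have j: "j \<in> rest" "j \<noteq> k" unfolding rest_def by auto
    have "(1 / (p \<bullet> u k)) * (p \<bullet> v j) = w j * ((p \<bullet> u j) / (p \<bullet> u k))" by (simp add: vu[OF j(1), of p])
    also have "\<dots> < w j * 1" using plt[OF j] ppos w[OF j(1)] by (intro mult_strict_left_mono) auto
    finally show "(z + (1 / (p \<bullet> u k)) *\<^sub>R p) \<bullet> v j < 1" by (simp add: inner_add_left w_def)
  qed
  moreover have "y \<bullet> v k > 0" using vu[OF kO(1), of y] kO(2) m0 w[OF kO(1)] by simp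
  ultimately show ?thesis using kO(1) unfolding rest_def by blast
qed

text \<open>The vector \<open>adjoint T (T (v i)) - v i\<close> is orthogonal to \<open>v i\<close>
  and to all neighbours of \<open>v i\<close>. By \<open>adj_in_direction\<close> a nonzero vector
  orthogonal to \<open>v i\<close> has a positive product with some neighbour, so this one
  vanishes.\<close>

lemma linear_orthogonal_if_edges:
  fixes T :: "real^'d \<Rightarrow> real^'d"
  assumes T: "linear T" and vert: "\<And>i. i \<in> {1..n} \<Longrightarrow> T (v i) \<bullet> T (v i) = v i \<bullet> v i"
    and edge: "\<And>i j. i \<in> {1..n} \<Longrightarrow> j \<in> {1..n} \<Longrightarrow> i \<noteq> j \<Longrightarrow> adj i j \<Longrightarrow> T (v i) \<bullet> T (v j) = v i \<bullet> v j"
  shows "orthogonal_transformation T"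
proof -
  have adj: "adjoint T x \<bullet> y = x \<bullet> T y" for x y
    using adjoint_works[OF T, of y x] by (simp add: inner_commute)
  have fix_v: "adjoint T (T (v i)) - v i = 0" if i: "i \<in> {1..n}" for i
  proof (rule ccontr)
    let ?y = "adjoint T (T (v i)) - v i"
    have yk: "?y \<bullet> v k = T (v i) \<bullet> T (v k) - v i \<bullet> v k" for k by (simp add: inner_diff_left adj)
    assume "?y \<noteq> 0"
    moreover have "?y \<bullet> v i = 0" unfolding yk using vert[OF i] by simp
    ultimately obtain k where "k \<in> {1..n}-{i}" "adj i k" "?y \<bullet> v k > 0" using adj_in_direction[OF i] by blast
    then show False unfolding yk using edge[OF i, of k] by auto
  qed
  have "T x \<bullet> T w = x \<bullet> w" for x w
  proof -
    have "adjoint T (T x) - x = 0"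
    proof (rule eq_zero_if_orthogonal)
      fix k assume k: "k \<in> {1..n}"
      have "(adjoint T (T x) - x) \<bullet> v k = T x \<bullet> T (v k) - x \<bullet> v k" by (simp add: inner_diff_left adj)
      also have "\<dots> = (adjoint T (T (v k)) - v k) \<bullet> x"
        unfolding inner_diff_left adj inner_commute[of "T x"] inner_commute[of x] ..
      finally show "(adjoint T (T x) - x) \<bullet> v k = 0" using fix_v[OF k] by simp
    qed
    then have "adjoint T (T x) = x" by simp
    then show ?thesis using adj[of "T x" w] by simp
  qed
  then show ?thesis using T unfolding orthogonal_transformation_def by blast
qed

text \<open>For d = 1 the row sums of \<open>M\<close> vanish and yield no gradient condition.
  Directly: \<sigma> either fixes every vertex or, as vertices and their images have equal length,
  exchanges two opposite ones, and there are no others.\<close>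

lemma permuted_functional_dim1:
  assumes d: "CARD('d) = 1" and \<sigma>: "\<sigma> permutes {1..n}"
    and vert: "\<And>i. i \<in> {1..n} \<Longrightarrow> v (\<sigma> i) \<bullet> v (\<sigma> i) = v i \<bullet> v i"
  shows "\<exists>b. \<forall>i\<in>{1..n}. a \<bullet> v (\<sigma> i) = b \<bullet> v i"
proof (cases "\<forall>i\<in>{1..n}. v (\<sigma> i) = v i")
  case True
  then show ?thesis by (intro exI[of _ a]) simp
next
  case False
  obtain k :: 'd where k: "UNIV = {k}" using d by (auto simp: card_1_singleton_iff)
  have inn: "x \<bullet> y = x $ k * y $ k" for x y :: "real^'d" unfolding inner_vec_def k by simp
  have veq: "x = y \<longleftrightarrow> x $ k = y $ k" for x y :: "real^'d" using k by (auto simp: vec_eq_iff)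
  obtain i where i: "i \<in> {1..n}" "v (\<sigma> i) \<noteq> v i" using False by blast
  have \<sigma>in: "\<sigma> j \<in> {1..n}" if "j \<in> {1..n}" for j using permutes_in_image[OF \<sigma>] that by blast
  have "(v (\<sigma> i) $ k)\<^sup>2 = (v i $ k)\<^sup>2" using vert[OF i(1)] unfolding inn by (simp add: power2_eq_square)
  then have neg: "v (\<sigma> i) $ k = - (v i $ k)" using i(2) unfolding veq power2_eq_iff by blast
  have vi: "v i $ k \<noteq> 0" using v_nonzero[OF i(1)] veq[of "v i" 0] by simp
  have only: "j = i \<or> j = \<sigma> i" if j: "j \<in> {1..n}" for j
  proof (rule ccontr)
    assume nj: "\<not> ?thesis"
    \<comment> \<open>A third vertex would lie on the line through \<open>v i\<close> and its
      negative, with these coordinates.\<close>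
    define t where "t = v j $ k / v i $ k"
    have "v j = ((1 + t) / 2) *\<^sub>R v i + ((1 - t) / 2) *\<^sub>R v (\<sigma> i)"
      unfolding veq using vi by (simp add: neg t_def field_simps)
    moreover have "i \<noteq> \<sigma> i" using i(2) by auto
    ultimately show False
      using not_collinear[OF i(1) \<sigma>in[OF i(1)] j, of "(1 + t) / 2" "(1 - t) / 2"] nj by (auto simp: field_simps)
  qed
  have inv: "\<sigma> (\<sigma> i) = i"
    using only[OF \<sigma>in[OF \<sigma>in[OF i(1)]]] permutes_inj[OF \<sigma>] i(2) by (metis injD)
  have "v (\<sigma> j) $ k = - (v j $ k)" if j: "j \<in> {1..n}" for j
    using only[OF j] neg inv by auto
  then show ?thesis by (intro exI[of _ "- a"]) (simp add: inn)
qed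

theorem permutation_realised:
  assumes \<sigma>: "\<sigma> permutes {1..n}"
    and MM: "\<And>i j. i \<in> {1..n} \<Longrightarrow> j \<in> {1..n} \<Longrightarrow> M (\<sigma> i) (\<sigma> j) = M i j"
    and vert: "\<And>i. i \<in> {1..n} \<Longrightarrow> v (\<sigma> i) \<bullet> v (\<sigma> i) = v i \<bullet> v i"
    and edge: "\<And>i j. i \<in> {1..n} \<Longrightarrow> j \<in> {1..n} \<Longrightarrow> i \<noteq> j \<Longrightarrow> adj i j \<Longrightarrow> v (\<sigma> i) \<bullet> v (\<sigma> j) = v i \<bullet> v j"
  obtains T where "orthogonal_transformation T" "\<And>i. i \<in> {1..n} \<Longrightarrow> T (v i) = v (\<sigma> i)"
proof -
  have lin: "\<exists>b. \<forall>i\<in>{1..n}. a \<bullet> v (\<sigma> i) = b \<bullet> v i" for a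
  proof (cases "CARD('d) = 1")
    case True
    then show ?thesis using permuted_functional_dim1 \<sigma> vert by blast
  next
    case False
    have ker: "(\<Sum>k\<in>{1..n}. M k j * (a \<bullet> v (\<sigma> k))) = 0" if j: "j \<in> {1..n}" for j
    proof -
      have \<sigma>j: "\<sigma> j \<in> {1..n}" using permutes_in_image[OF \<sigma>] j by blast
      have "(\<Sum>k\<in>{1..n}. M k j * (a \<bullet> v (\<sigma> k))) = (\<Sum>k\<in>{1..n}. M (\<sigma> k) (\<sigma> j) * (a \<bullet> v (\<sigma> k)))"
        using MM j by (intro sum.cong) auto
      also have "\<dots> = (\<Sum>k\<in>{1..n}. M k (\<sigma> j) * (a \<bullet> v k))"
        using sum.permute[OF \<sigma>, of "\<lambda>k. M k (\<sigma> j) * (a \<bullet> v k)"] by (simp add: o_def)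
      also have "\<dots> = 0" by (rule M_kernel[OF \<sigma>j])
      finally show ?thesis .
    qed
    \<comment> \<open>The row sums turn the first variation, times d - 1, into a double sum of
      \<open>M\<close> against the function; by symmetry the kernel relation makes it 0.\<close>
    have "(real CARD('d) - 1) * (\<Sum>j\<in>{1..n}. A j (\<lambda>_. 1) * (a \<bullet> v (\<sigma> j))) = (\<Sum>j\<in>{1..n}. (\<Sum>k\<in>{1..n}. M k j) * (a \<bullet> v (\<sigma> j)))"
      unfolding sum_distrib_left by (intro sum.cong) (use M_row_sum in auto)
    also have "\<dots> = (\<Sum>j\<in>{1..n}. \<Sum>k\<in>{1..n}. M j k * (a \<bullet> v (\<sigma> j)))"
      unfolding sum_distrib_right by (intro sum.cong refl arg_cong2[where f="(*)"] M_sym)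
    also have "\<dots> = (\<Sum>k\<in>{1..n}. \<Sum>j\<in>{1..n}. M j k * (a \<bullet> v (\<sigma> j)))" by (rule sum.swap)
    also have "\<dots> = 0" by (rule sum.neutral) (use ker in auto)
    finally have grad: "(\<Sum>j\<in>{1..n}. A j (\<lambda>_. 1) * (a \<bullet> v (\<sigma> j))) = 0" using False by simp
    show ?thesis
    proof (rule second_order_stationary_imp_linear)
      fix \<eta> :: real assume "\<eta> > 0"
      from V_second_order_stationary[OF ker grad this]
      show "\<exists>r>0. \<forall>t. \<bar>t\<bar> < r \<longrightarrow> \<bar>V (\<lambda>k. 1 + t * (a \<bullet> v (\<sigma> k))) - V (\<lambda>_. 1)\<bar> \<le> \<eta> * t\<^sup>2"
        by blast
    qed
  qed
  then have "\<forall>k. \<exists>b. \<forall>i\<in>{1..n}. axis k 1 \<bullet> v (\<sigma> i) = b \<bullet> v i" by blast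
  from choice[OF this] obtain b :: "'d \<Rightarrow> real^'d" where b: "\<And>k i. i \<in> {1..n} \<Longrightarrow> v (\<sigma> i) $ k = b k \<bullet> v i"
    by (auto simp: inner_axis' )
  define T :: "real^'d \<Rightarrow> real^'d" where "T x = (\<chi> k. b k \<bullet> x)" for x
  have T: "linear T" unfolding T_def by (rule linearI) (simp_all add: vec_eq_iff inner_add_right)
  have Tv: "T (v i) = v (\<sigma> i)" if "i \<in> {1..n}" for i unfolding T_def using b[OF that] by (simp add: vec_eq_iff)
  have "orthogonal_transformation T"
    by (rule linear_orthogonal_if_edges[OF T]) (use Tv vert edge in auto)
  then show ?thesis using that Tv by blast
qed

text \<open>\<open>T\<close> maps the polar of \<open>c \<circ> \<sigma>\<close> onto that of
  \<open>c\<close> and preserves volume, so the partial derivatives are carried along by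
  \<sigma>.\<close>

lemma M_invariant:
  assumes \<sigma>: "\<sigma> permutes {1..n}" and T: "orthogonal_transformation T"
    and Tv: "\<And>i. i \<in> {1..n} \<Longrightarrow> T (v i) = v (\<sigma> i)"
  shows "M (\<sigma> i) (\<sigma> j) = M i j"
proof -
  have inj: "\<sigma> x = \<sigma> y \<longleftrightarrow> x = y" for x y using permutes_inj[OF \<sigma>] by (auto dest: injD)
  have inn: "T x \<bullet> v (\<sigma> k) = x \<bullet> v k" if "k \<in> {1..n}" for x k
    using T Tv[OF that] unfolding orthogonal_transformation_def by metis
  have Vs: "V (c \<circ> \<sigma>) = V c" for c
  proof -
    have "T ` generalized_polar n v (c \<circ> \<sigma>) = generalized_polar n v c"
    proof (intro equalityI subsetI)
      fix y assume "y \<in> T ` generalized_polar n v (c \<circ> \<sigma>)"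
      then obtain x where x: "y = T x" "\<And>k. k \<in> {1..n} \<Longrightarrow> x \<bullet> v k \<le> c (\<sigma> k)"
        unfolding generalized_polar_def by auto
      have "y \<bullet> v k \<le> c k" if k: "k \<in> {1..n}" for k
      proof -
        obtain l where l: "l \<in> {1..n}" "k = \<sigma> l" using permutes_image[OF \<sigma>] k by blast
        then show ?thesis using x(2)[OF l(1)] inn[OF l(1), of x] unfolding x(1) by simp
      qed
      then show "y \<in> generalized_polar n v c" unfolding generalized_polar_def by blast
    next
      fix y assume y: "y \<in> generalized_polar n v c"
      obtain x where x: "y = T x" using orthogonal_transformation_surj[OF T] by auto
      have "x \<bullet> v k \<le> c (\<sigma> k)" if k: "k \<in> {1..n}" for k
      proof -
        have "\<sigma> k \<in> {1..n}" using permutes_in_image[OF \<sigma>] k by blast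
        then have "y \<bullet> v (\<sigma> k) \<le> c (\<sigma> k)" using y unfolding generalized_polar_def by blast
        then show ?thesis using inn[OF k, of x] unfolding x by simp
      qed
      then show "y \<in> T ` generalized_polar n v (c \<circ> \<sigma>)" unfolding x generalized_polar_def by auto
    qed
    then show ?thesis unfolding V_def using orthogonal_image_measure[OF T polar_lmeasurable] by metis
  qed
  have upd: "(c(\<sigma> j := t)) \<circ> \<sigma> = (c \<circ> \<sigma>)(j := t)" for c :: "nat \<Rightarrow> real" and j t by (auto simp: fun_eq_iff inj)
  have As: "A (\<sigma> j) c = A j (c \<circ> \<sigma>)" for j c
  proof -
    have "V (c(\<sigma> j := t)) = V ((c \<circ> \<sigma>)(j := t))" for t using Vs[of "c(\<sigma> j := t)"] unfolding upd by simp
    then show ?thesis unfolding A_def partial_deriv_def by simp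
  qed
  have "A (\<sigma> j) ((\<lambda>_. 1)(\<sigma> i := t)) = A j ((\<lambda>_. 1)(i := t))" for t
    unfolding As upd by (simp add: o_def)
  then show ?thesis unfolding M_eq partial_deriv_def by simp
qed

end

section \<open>Polytopes and their edge-graphs\<close>

locale enumerated_polytope =
  fixes P :: "(real^'d) set" and n :: nat and v :: "nat \<Rightarrow> real^'d"
  assumes polytope_P: "polytope P" and interior_P: "0 \<in> interior P" and enum: "vertex_enumeration P n v"
begin

lemma bij_v: "bij_betw v {1..n} {x. x extreme_point_of P}"
  using enum unfolding vertex_enumeration_def .

lemma v_extreme: "i \<in> {1..n} \<Longrightarrow> v i extreme_point_of P"
  using bij_v unfolding bij_betw_def by blast

lemma P_eq: "P = convex hull (v ` {1..n})"
  using Krein_Milman_polytope[of P] polytope_P bij_v unfolding bij_betw_def polytope_def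
  by (metis Krein_Milman_Minkowski compact_convex_hull convex_convex_hull finite_imp_compact)

lemma inradius_P: "\<exists>\<rho>>0. \<forall>x. \<exists>k\<in>{1..n}. \<rho> * norm x \<le> x \<bullet> v k"
proof -
  obtain e where e: "e > 0" "ball 0 e \<subseteq> P" using interior_P mem_interior by blast
  show ?thesis
  proof (intro exI[of _ "e/2"] conjI allI)
    fix x :: "real^'d"
    show "\<exists>k\<in>{1..n}. e/2 * norm x \<le> x \<bullet> v k"
    proof (rule ccontr)
      assume neg: "\<not> ?thesis"
      have "P \<subseteq> {y. x \<bullet> y < e/2 * norm x}"
        unfolding P_eq
      proof (rule hull_minimal)
        show "v ` {1..n} \<subseteq> {y. x \<bullet> y < e/2 * norm x}" using neg by (auto simp: not_le)
        show "convex {y. x \<bullet> y < e/2 * norm x}" by (rule convex_halfspace_lt)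
      qed
      moreover have "(e/2 / norm x) *\<^sub>R x \<in> P" using e by (intro subsetD[OF e(2)]) (auto simp: norm_scaleR)
      ultimately have "x \<bullet> ((e/2 / norm x) *\<^sub>R x) < e/2 * norm x" by blast
      then show False using e(1) by (cases "x = 0") (auto simp: power2_norm_eq_inner[symmetric] power2_eq_square)
    qed
  qed (use e in simp)
qed

text \<open>An extreme point lies outside the hull of the other vertices and is separated from it.
  Since 0 is interior, the separating functional is positive at \<open>v i\<close> and can be scaled
  to 1 there.\<close>

lemma exposed_P:
  assumes i: "i \<in> {1..n}"
  shows "\<exists>z. z \<bullet> v i = 1 \<and> (\<forall>k\<in>{1..n}-{i}. z \<bullet> v k < 1)"
proof -
  obtain \<rho> where \<rho>: "\<rho> > 0" "\<And>x. \<exists>k\<in>{1..n}. \<rho> * norm x \<le> x \<bullet> v k" using inradius_P by blast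
  let ?W = "v ` ({1..n} - {i})"
  have "convex (P - {v i})" using v_extreme[OF i] by (simp add: extreme_point_of_stillconvex polytope_imp_convex polytope_P)
  moreover have "?W \<subseteq> P - {v i}"
    using bij_v i hull_subset[of "v ` {1..n}" convex] unfolding P_eq[symmetric] bij_betw_def by (auto dest: inj_onD)
  ultimately have "convex hull ?W \<subseteq> P - {v i}" by (intro hull_minimal)
  then have "v i \<notin> convex hull ?W" by blast
  moreover have "closed (convex hull ?W)" by (intro compact_imp_closed finite_imp_compact_convex_hull) auto
  ultimately obtain a b where ab: "a \<bullet> v i < b" "\<And>x. x \<in> convex hull ?W \<Longrightarrow> b < a \<bullet> x"
    using separating_hyperplane_closed_point[of "convex hull ?W" "v i"] by auto
  define y where "y = - a"
  have y: "y \<bullet> v k < y \<bullet> v i" if "k \<in> {1..n} - {i}" for k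
    using ab(1) ab(2)[of "v k"] that hull_inc[of "v k" ?W convex] unfolding y_def by fastforce
  \<comment> \<open>A single vertex would have a positive product with both a unit vector and its
    negative. A second vertex shows that \<open>y\<close> is not 0.\<close>
  have "\<exists>k. k \<in> {1..n} - {i}"
  proof (rule ccontr)
    assume "\<not> ?thesis"
    then have n: "k = i" if "k \<in> {1..n}" for k using that by blast
    let ?x = "axis undefined 1 :: real^'d"
    have "\<rho> * norm ?x \<le> ?x \<bullet> v i" "\<rho> * norm (- ?x) \<le> (- ?x) \<bullet> v i" using \<rho>(2) n by metis+
    then show False using \<rho>(1) by simp
  qed
  then obtain k where k: "k \<in> {1..n} - {i}" by blast
  have y0: "y \<noteq> 0" using y[OF k] by auto
  obtain l where l: "l \<in> {1..n}" "\<rho> * norm y \<le> y \<bullet> v l" using \<rho>(2) by blast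
  have "0 < \<rho> * norm y" using \<rho>(1) y0 by simp
  moreover have "y \<bullet> v l \<le> y \<bullet> v i" using y[of l] l(1) by (cases "l = i") auto
  ultimately have pos: "y \<bullet> v i > 0" using l(2) by linarith
  show ?thesis
    by (rule exI[of _ "(1 / (y \<bullet> v i)) *\<^sub>R y"]) (use pos y in \<open>auto simp: divide_less_eq\<close>)
qed

sublocale exposed_configuration n v
  using exposed_P inradius_P by unfold_locales

text \<open>The supporting hyperplane given by \<open>z\<close> cuts out a face with only
  \<open>v i\<close> and \<open>v j\<close> as extreme points; Krein--Milman identifies it with the
  segment.\<close>

lemma adj_imp_edge:
  assumes ij: "i \<in> {1..n}" "j \<in> {1..n}" "i \<noteq> j" and adj: "adj i j"
  shows "{i, j} \<in> edge_graph P n v"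
proof -
  obtain z where z: "z \<bullet> v i = 1" "z \<bullet> v j = 1" "\<And>k. k \<in> {1..n}-{i,j} \<Longrightarrow> z \<bullet> v k < 1"
    using adj unfolding adj_def by blast
  have zle: "z \<bullet> v k \<le> 1" if "k \<in> {1..n}" for k using z that by (cases "k \<in> {i,j}") (auto intro: less_imp_le)
  have "P \<subseteq> {x. z \<bullet> x \<le> 1}"
    unfolding P_eq by (rule hull_minimal) (use zle in \<open>auto simp: convex_halfspace_le\<close>)
  then have F: "(P \<inter> {x. z \<bullet> x = 1}) face_of P"
    by (intro face_of_Int_supporting_hyperplane_le polytope_imp_convex polytope_P) auto
  let ?F = "P \<inter> {x. z \<bullet> x = 1}"
  have "{x. x extreme_point_of ?F} = {x. x extreme_point_of P \<and> z \<bullet> x = 1}"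
    using extreme_point_of_face[OF F] extreme_point_of_def[of _ P] by blast
  also have "\<dots> = {v i, v j}"
  proof (intro equalityI subsetI)
    fix x assume x: "x \<in> {x. x extreme_point_of P \<and> z \<bullet> x = 1}"
    then obtain k where k: "k \<in> {1..n}" "x = v k" using bij_v unfolding bij_betw_def by blast
    then have "k \<in> {i, j}" using z(3)[of k] x by (cases "k \<in> {i,j}") auto
    then show "x \<in> {v i, v j}" using k by auto
  qed (use z v_extreme ij in auto)
  finally have ext: "{x. x extreme_point_of ?F} = {v i, v j}" .
  have "polytope ?F" by (rule face_of_polytope_polytope[OF polytope_P F])
  then have "?F = convex hull {x. x extreme_point_of ?F}"
    by (intro Krein_Milman_Minkowski polytope_imp_compact polytope_imp_convex)
  then have FE: "?F = convex hull {v i, v j}" unfolding ext .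
  have "v i \<noteq> v j" using inj_v ij by (auto dest: inj_onD)
  then have "(convex hull {v i, v j}) edge_of P"
    using F unfolding FE edge_of_def by (simp add: aff_dim_convex_hull)
  then show ?thesis unfolding edge_graph_def using ij by blast
qed

lemma edge_graph_iff:
  assumes "i \<in> {1..n}" "j \<in> {1..n}"
  shows "{i, j} \<in> edge_graph P n v \<longleftrightarrow> (convex hull {v i, v j}) edge_of P"
proof
  assume "{i, j} \<in> edge_graph P n v"
  then obtain i' j' where "{i, j} = {i', j'}" "(convex hull {v i', v j'}) edge_of P"
    unfolding edge_graph_def by blast
  then show "(convex hull {v i, v j}) edge_of P" by (auto simp: doubleton_eq_iff insert_commute)
qed (use assms in \<open>auto simp: edge_graph_def\<close>)

lemma M_zero_if_not_edge:
  assumes "i \<in> {1..n}" "j \<in> {1..n}" "i \<noteq> j" "{i, j} \<notin> edge_graph P n v"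
  shows "M i j = 0"
  using M_off_diagonal(3)[OF assms(1-3)] adj_imp_edge[OF assms(1-3)] assms(4) by blast

lemma permutation_unique:
  assumes "\<sigma> permutes {1..n}" "\<tau> permutes {1..n}" "\<And>i. i \<in> {1..n} \<Longrightarrow> v (\<sigma> i) = v (\<tau> i)"
  shows "\<sigma> = \<tau>"
proof
  fix i show "\<sigma> i = \<tau> i"
  proof (cases "i \<in> {1..n}")
    case True
    then have "\<sigma> i \<in> {1..n}" "\<tau> i \<in> {1..n}" using assms(1,2) by (meson permutes_in_image)+
    then show ?thesis using inj_v assms(3)[OF True] by (auto dest: inj_onD)
  next
    case False
    then show ?thesis using assms(1,2) by (simp add: permutes_not_in)
  qed
qed

lemma induced_permutation_eq:
  assumes "\<sigma> permutes {1..n}" "\<And>i. i \<in> {1..n} \<Longrightarrow> T (v i) = v (\<sigma> i)"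
  shows "induced_permutation n v T = \<sigma>"
  unfolding induced_permutation_def
proof (rule the_equality)
  fix \<tau> assume "\<tau> permutes {1..n} \<and> (\<forall>i\<in>{1..n}. T (v i) = v (\<tau> i))"
  then show "\<tau> = \<sigma>" using permutation_unique assms by metis
qed (use assms in auto)

lemma symmetry_face_iff:
  assumes T: "T \<in> orthogonal_symmetries P"
  shows "T ` F face_of P \<longleftrightarrow> F face_of P"
proof -
  have "orthogonal_transformation T" "T ` P = P" using T unfolding orthogonal_symmetries_def by auto
  then show ?thesis
    using face_of_linear_image[of T F P] orthogonal_transformation_linear orthogonal_transformation_inj by metis
qed

lemma symmetry_extreme_iff:
  assumes T: "T \<in> orthogonal_symmetries P"
  shows "T x extreme_point_of P \<longleftrightarrow> x extreme_point_of P"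
  using symmetry_face_iff[OF T, of "{x}"] by (simp add: face_of_singleton)

lemma induced_permutation:
  assumes T: "T \<in> orthogonal_symmetries P"
  shows "induced_permutation n v T permutes {1..n}"
    and "i \<in> {1..n} \<Longrightarrow> T (v i) = v (induced_permutation n v T i)"
proof -
  have ot: "orthogonal_transformation T" using T unfolding orthogonal_symmetries_def by auto
  define \<sigma> where "\<sigma> i = (if i \<in> {1..n} then inv_into {1..n} v (T (v i)) else i)" for i
  have Tv: "T (v i) \<in> v ` {1..n}" if "i \<in> {1..n}" for i
    using symmetry_extreme_iff[OF T] v_extreme[OF that] bij_v unfolding bij_betw_def by blast
  have \<sigma>: "T (v i) = v (\<sigma> i)" "\<sigma> i \<in> {1..n}" if "i \<in> {1..n}" for i
    using Tv[OF that] that unfolding \<sigma>_def by (simp_all add: f_inv_into_f inv_into_into del: atLeastAtMost_iff)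
  have "inj_on \<sigma> {1..n}"
  proof (rule inj_onI)
    fix i j assume ij: "i \<in> {1..n}" "j \<in> {1..n}" "\<sigma> i = \<sigma> j"
    then have "T (v i) = T (v j)" using \<sigma>(1) by metis
    then have "v i = v j" using orthogonal_transformation_inj[OF ot] by (auto dest: injD)
    then show "i = j" using inj_v ij by (auto dest: inj_onD)
  qed
  moreover have "\<sigma> ` {1..n} \<subseteq> {1..n}" using \<sigma>(2) by blast
  ultimately have "bij_betw \<sigma> {1..n} {1..n}"
    unfolding bij_betw_def using endo_inj_surj[of "{1..n}" \<sigma>] by simp
  then have perm: "\<sigma> permutes {1..n}" by (rule bij_imp_permutes) (auto simp: \<sigma>_def)
  have "induced_permutation n v T = \<sigma>" by (rule induced_permutation_eq[OF perm \<sigma>(1)])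
  then show "induced_permutation n v T permutes {1..n}"
    "i \<in> {1..n} \<Longrightarrow> T (v i) = v (induced_permutation n v T i)"
    using perm \<sigma>(1) by auto
qed

abbreviation coloring where "coloring \<equiv> izmestiev_coloring n v \<times>\<^sub>c metric_coloring v"

lemma coloring_vertex: "coloring (Inl i) = (M i i, v i \<bullet> v i)"
  by (simp add: product_coloring_def izmestiev_coloring_def matrix_coloring_def metric_coloring_def)

lemma coloring_edge:
  "i \<in> {1..n} \<Longrightarrow> j \<in> {1..n} \<Longrightarrow> coloring (Inr {i, j}) = (M i j, v i \<bullet> v j)"
  by (simp add: product_coloring_def izmestiev_coloring_def matrix_coloring_def metric_coloring_edge
      edge_value_eq M_sym del: atLeastAtMost_iff)

lemma induced_permutation_in_aut:
  assumes T: "T \<in> orthogonal_symmetries P"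
  shows "induced_permutation n v T \<in> colored_graph_automorphisms n (edge_graph P n v) coloring"
proof -
  let ?\<sigma> = "induced_permutation n v T"
  have ot: "orthogonal_transformation T" using T unfolding orthogonal_symmetries_def by auto
  note \<sigma> = induced_permutation[OF T]
  have in\<sigma>: "?\<sigma> i \<in> {1..n}" if "i \<in> {1..n}" for i using permutes_in_image[OF \<sigma>(1)] that by blast
  have inn: "v (?\<sigma> i) \<bullet> v (?\<sigma> j) = v i \<bullet> v j" if "i \<in> {1..n}" "j \<in> {1..n}" for i j
    using ot \<sigma>(2)[OF that(1)] \<sigma>(2)[OF that(2)] unfolding orthogonal_transformation_def by metis
  have MM: "M (?\<sigma> i) (?\<sigma> j) = M i j" for i j by (rule M_invariant[OF \<sigma>(1) ot \<sigma>(2)])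
  have "{i, j} \<in> edge_graph P n v \<longleftrightarrow> {?\<sigma> i, ?\<sigma> j} \<in> edge_graph P n v" if ij: "i \<in> {1..n}" "j \<in> {1..n}" for i j
  proof -
    have img: "convex hull {v (?\<sigma> i), v (?\<sigma> j)} = T ` (convex hull {v i, v j})"
      using convex_hull_linear_image[OF orthogonal_transformation_linear[OF ot], of "{v i, v j}"] \<sigma>(2) ij by simp
    have "v i = v j \<longleftrightarrow> v (?\<sigma> i) = v (?\<sigma> j)"
      using \<sigma>(2)[OF ij(1)] \<sigma>(2)[OF ij(2)] orthogonal_transformation_inj[OF ot] by (metis injD)
    then have "aff_dim (convex hull {v i, v j}) = aff_dim (convex hull {v (?\<sigma> i), v (?\<sigma> j)})"
      by (simp add: aff_dim_convex_hull)
    then show ?thesis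
      unfolding edge_graph_iff[OF ij] edge_graph_iff[OF in\<sigma>[OF ij(1)] in\<sigma>[OF ij(2)]] edge_of_def
      using symmetry_face_iff[OF T, of "convex hull {v i, v j}"] img by simp
  qed
  then show ?thesis
    unfolding colored_graph_automorphisms_def graph_automorphisms_def mem_Collect_eq
    using \<sigma>(1) in\<sigma> inn MM by (simp add: coloring_vertex coloring_edge del: atLeastAtMost_iff)
qed

text \<open>The coloring fixes \<open>M\<close> on the diagonal and on edges, and elsewhere \<sigma>
  compares zero entries with zero entries. So all of \<open>M\<close> is invariant and
  \<open>permutation_realised\<close> applies; the resulting map permutes the vertices and hence
  preserves their hull.\<close>

lemma colored_automorphism_realised:
  assumes s: "\<sigma> \<in> colored_graph_automorphisms n (edge_graph P n v) coloring"
  shows "\<exists>T\<in>orthogonal_symmetries P. induced_permutation n v T = \<sigma>"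
proof -
  have \<sigma>: "\<sigma> permutes {1..n}"
    and ed: "\<And>i j. i \<in> {1..n} \<Longrightarrow> j \<in> {1..n} \<Longrightarrow> {i, j} \<in> edge_graph P n v \<longleftrightarrow> {\<sigma> i, \<sigma> j} \<in> edge_graph P n v"
    and cv: "\<And>i. i \<in> {1..n} \<Longrightarrow> coloring (Inl i) = coloring (Inl (\<sigma> i))"
    and ce: "\<And>i j. i \<in> {1..n} \<Longrightarrow> j \<in> {1..n} \<Longrightarrow> {i, j} \<in> edge_graph P n v \<Longrightarrow> coloring (Inr {i, j}) = coloring (Inr {\<sigma> i, \<sigma> j})"
    using s unfolding colored_graph_automorphisms_def graph_automorphisms_def mem_Collect_eq by blast+
  have in\<sigma>: "\<sigma> i \<in> {1..n}" if "i \<in> {1..n}" for i using permutes_in_image[OF \<sigma>] that by blast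
  have inj: "\<sigma> i = \<sigma> j \<longleftrightarrow> i = j" for i j using permutes_inj[OF \<sigma>] by (auto dest: injD)
  have vert: "M (\<sigma> i) (\<sigma> i) = M i i" "v (\<sigma> i) \<bullet> v (\<sigma> i) = v i \<bullet> v i" if "i \<in> {1..n}" for i
    using cv[OF that] unfolding coloring_vertex by auto
  have edge: "M (\<sigma> i) (\<sigma> j) = M i j" "v (\<sigma> i) \<bullet> v (\<sigma> j) = v i \<bullet> v j"
    if "i \<in> {1..n}" "j \<in> {1..n}" "{i, j} \<in> edge_graph P n v" for i j
    using ce[OF that] unfolding coloring_edge[OF that(1,2)] coloring_edge[OF in\<sigma>[OF that(1)] in\<sigma>[OF that(2)]] by auto
  have MM: "M (\<sigma> i) (\<sigma> j) = M i j" if ij: "i \<in> {1..n}" "j \<in> {1..n}" for i j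
  proof (cases "i = j \<or> {i, j} \<in> edge_graph P n v")
    case False
    then have "M i j = 0" "M (\<sigma> i) (\<sigma> j) = 0"
      using ij in\<sigma> ed[OF ij] inj by (auto intro!: M_zero_if_not_edge simp del: atLeastAtMost_iff)
    then show ?thesis by simp
  qed (use vert edge ij in auto)
  have "v (\<sigma> i) \<bullet> v (\<sigma> j) = v i \<bullet> v j" if "i \<in> {1..n}" "j \<in> {1..n}" "i \<noteq> j" "adj i j" for i j
    using that edge(2) adj_imp_edge by blast
  from permutation_realised[OF \<sigma> MM vert(2) this]
  obtain T where T: "orthogonal_transformation T" "\<And>i. i \<in> {1..n} \<Longrightarrow> T (v i) = v (\<sigma> i)" by blast
  have "T ` v ` {1..n} = v ` \<sigma> ` {1..n}" unfolding image_image using T(2) by (intro image_cong) auto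
  then have "T ` v ` {1..n} = v ` {1..n}" unfolding permutes_image[OF \<sigma>] .
  then have "T ` P = P"
    unfolding P_eq convex_hull_linear_image[OF orthogonal_transformation_linear[OF T(1)]] by metis
  then have "T \<in> orthogonal_symmetries P" using T(1) unfolding orthogonal_symmetries_def by simp
  moreover have "induced_permutation n v T = \<sigma>" by (rule induced_permutation_eq[OF \<sigma> T(2)])
  ultimately show ?thesis by blast
qed

text \<open>The vertices span: the difference of the adjoints at any point is orthogonal to all
  \<open>v k\<close> and hence 0. This gives injectivity of the natural homomorphism.\<close>

lemma linear_determined:
  fixes S T :: "real^'d \<Rightarrow> real^'d"
  assumes S: "linear S" and T: "linear T" and eq: "\<And>i. i \<in> {1..n} \<Longrightarrow> S (v i) = T (v i)"
  shows "S = T"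
proof
  fix x
  have "adjoint S w = adjoint T w" for w
  proof -
    have "adjoint S w - adjoint T w = 0"
    proof (rule eq_zero_if_orthogonal)
      fix k assume "k \<in> {1..n}"
      then show "(adjoint S w - adjoint T w) \<bullet> v k = 0"
        unfolding inner_diff_left inner_commute[of "adjoint S w"] inner_commute[of "adjoint T w"]
          adjoint_works[OF S] adjoint_works[OF T] using eq by simp
    qed
    then show ?thesis by simp
  qed
  then have "S x \<bullet> w = T x \<bullet> w" for w using adjoint_works[OF S, of x w] adjoint_works[OF T, of x w] by simp
  then show "S x = T x" by (metis vector_eq_ldot vector_eq_rdot inner_commute)
qed

lemma coloring_captures_symmetries: "captures_orthogonal_symmetries P n v coloring"
  unfolding captures_orthogonal_symmetries_def
proof (intro conjI ballI)
  show "induced_permutation n v T \<in> colored_graph_automorphisms n (edge_graph P n v) coloring"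
    if "T \<in> orthogonal_symmetries P" for T
    using that by (rule induced_permutation_in_aut)
  have comp: "induced_permutation n v (S \<circ> T) = induced_permutation n v S \<circ> induced_permutation n v T"
    if S: "S \<in> orthogonal_symmetries P" and T: "T \<in> orthogonal_symmetries P" for S T
  proof (rule induced_permutation_eq)
    show "(induced_permutation n v S \<circ> induced_permutation n v T) permutes {1..n}"
      by (rule permutes_compose[OF induced_permutation(1)[OF T] induced_permutation(1)[OF S]])
    fix i assume i: "i \<in> {1..n}"
    then have "induced_permutation n v T i \<in> {1..n}" using permutes_in_image[OF induced_permutation(1)[OF T]] by blast
    then show "(S \<circ> T) (v i) = v ((induced_permutation n v S \<circ> induced_permutation n v T) i)"
      using induced_permutation(2)[OF T i] induced_permutation(2)[OF S] by simp
  qed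
  have inj: "inj_on (induced_permutation n v) (orthogonal_symmetries P)"
  proof (rule inj_onI)
    fix S T assume S: "S \<in> orthogonal_symmetries P" and T: "T \<in> orthogonal_symmetries P"
      and eq: "induced_permutation n v S = induced_permutation n v T"
    show "S = T"
      by (rule linear_determined)
        (use S T eq induced_permutation(2)[OF S] induced_permutation(2)[OF T] in
          \<open>auto simp: orthogonal_symmetries_def orthogonal_transformation_linear simp del: atLeastAtMost_iff\<close>)
  qed
  have "induced_permutation n v ` orthogonal_symmetries P = colored_graph_automorphisms n (edge_graph P n v) coloring"
    using induced_permutation_in_aut colored_automorphism_realised by blast
  then show "induced_permutation n v \<in> iso (orthogonal_aut_group P) (colored_aut_group n (edge_graph P n v) coloring)"
    using inj comp unfolding iso_def hom_def bij_betw_def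
    by (auto simp: orthogonal_aut_group_def colored_aut_group_def)
qed

end

theorem theorem5p2:
  fixes P :: "(real^'d) set" and n :: nat and v :: "nat \<Rightarrow> real^'d"
  assumes "polytope P"
    and "affine hull P = UNIV"
    and "0 \<in> interior P"
    and "vertex_enumeration P n v"
  shows "captures_orthogonal_symmetries P n v
           (izmestiev_coloring n v \<times>\<^sub>c metric_coloring v)"
proof -
  interpret enumerated_polytope P n v using assms(1,3,4) by unfold_locales
  show ?thesis by (rule coloring_captures_symmetries)
qed

end
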